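(* The group $\mathrm{Out}(\mathrm{C}^*(\mathbb Z))$ contains isomorphic copies of the following groups: \begin{enumerate} \item $\mathrm{PL}_\kappa(\mathbb R)$, the group of piecewise linear homeomorphisms $f\colon\mathbb R\to\mathbb R$ so that $\overline{\{x\in\mathbb R\mid f(x)\neq x\}}$ is compact, \item Thompson's group $F$, and \item the free group of rank the continuum. \end{enumerate}
   Context: $\mathbb Z$ carries the usual metric $d(x,y)=|x-y|$. Thompson's group $F$ is the group (under composition) of piecewise linear homeomorphisms of $[0,1]$ onto itself that are differentiable except at finitely many dyadic rationals and whose derivatives, where defined, are powers of $2$ (positive slopes). Let $X$ be a metric space and $H$ a separable infinite-dimensional Hilbert space. $\ell_2(X,H)$ is the Hilbert space of square-summable functions $X\to H$, and $\delta_x\otimes\eta$ is the function with value $\eta$ at $x$ and $0$ elsewhere. For $a\in\mathcal B(\ell_2(X,H))$ and $x,y\in X$, $a_{xy}\in\mathcal B(H)$ is determined by $\langle a_{xy}\xi,\eta\rangle=\langle a(\delta_x\otimes\xi),\delta_y\otimes\eta\rangle$, and $\mathrm{prop}(a)=\sup\{d(x,y)\mid a_{xy}\neq 0\}$. $\mathrm{BD}(X)$ is the norm closure of $\{a\in\mathcal B(\ell_2(X,H))\mid\mathrm{prop}(a)<\infty\}$, and the Roe algebra is $\mathrm{C}^*(X)=\{a\in \mathrm{BD}(X)\mid a_{xy}\text{ is compact for all }x,y\in X\}$, an ideal of $\mathrm{BD}(X)$. $\mathrm{Inn}(\mathrm{BD}(X))$ denotes the normal subgroup of $\mathrm{Aut}(\mathrm{C}^*(X))$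 consisting of the maps $a\mapsto uau^*$ on $\mathrm{C}^*(X)$ with $u\in\mathrm{BD}(X)$ unitary, and $\mathrm{Out}(\mathrm{C}^*(X))=\mathrm{Aut}(\mathrm{C}^*(X))/\mathrm{Inn}(\mathrm{BD}(X))$. *)

theory Defs
  imports "HOL-Analysis.Analysis" "HOL-Algebra.Bij" "HOL-Algebra.Coset"
begin

section \<open>Complex Hilbert spaces\<close>

class scaleC =
  fixes scaleC :: "complex \<Rightarrow> 'a \<Rightarrow> 'a" (infixr \<open>*\<^sub>C\<close> 75)

class complex_vector = real_vector + scaleC +
  assumes scaleC_add_right: "c *\<^sub>C (x + y) = c *\<^sub>C x + c *\<^sub>C y"
    and scaleC_add_left: "(c + d) *\<^sub>C x = c *\<^sub>C x + d *\<^sub>C x"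
    and scaleC_scaleC: "c *\<^sub>C d *\<^sub>C x = (c * d) *\<^sub>C x"
    and scaleC_of_real: "complex_of_real r *\<^sub>C x = r *\<^sub>R x"

lemma scaleC_one [simp]: "1 *\<^sub>C x = (x :: 'a::complex_vector)"
  using scaleC_of_real[of 1 x] by simp

global_interpretation complex_vector:
  vector_space "scaleC :: complex \<Rightarrow> 'a \<Rightarrow> 'a::complex_vector"
  defines cspan = complex_vector.span
  by standard (auto simp: scaleC_add_right scaleC_add_left scaleC_scaleC)

text \<open>
  The inner product is linear in the first argument. The underlying real inner product is its
  real part, so that norm, metric and topology are those of the library class.
\<close>

class complex_inner = real_inner + complex_vector +
  fixes cinner :: "'a \<Rightarrow> 'a \<Rightarrow> complex"
  assumes cinner_commute: "cinner x y = cnj (cinner y x)"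
    and cinner_add_left: "cinner (x + y) z = cinner x z + cinner y z"
    and cinner_scaleC_left: "cinner (c *\<^sub>C x) y = c * cinner x y"
    and inner_eq_Re_cinner: "inner x y = Re (cinner x y)"

class complex_hilbert = complex_inner + complete_space

lemma cinner_scaleC_right: "cinner x (c *\<^sub>C y) = cnj c * cinner x y"
  by (metis cinner_commute cinner_scaleC_left complex_cnj_mult)

lemma cinner_add_right: "cinner x (y + z) = cinner x y + cinner x z"
  by (metis cinner_commute cinner_add_left complex_cnj_add)

lemma cinner_zero_left [simp]: "cinner 0 x = 0"
  using cinner_add_left[of 0 0 x] by simp

lemma cinner_zero_right [simp]: "cinner x 0 = 0"
  using cinner_add_right[of x 0 0] by simp

lemma cinner_diff_left: "cinner (x - y) z = cinner x z - cinner y z"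
  using cinner_add_left[of "x - y" y z] by simp

lemma cinner_self: "cinner x x = of_real ((norm x)\<^sup>2)"
proof -
  have "Im (cinner x x) = 0"
    using cinner_commute[of x x] by (metis cnj.sel(2) equal_neg_zero)
  then show ?thesis
    using inner_eq_Re_cinner[of x x] by (simp add: complex_eq_iff power2_norm_eq_inner)
qed

lemma cinner_ext:
  assumes "\<And>z. cinner x z = cinner y z"
  shows "x = y"
proof -
  have "cinner (x - y) (x - y) = 0"
    using assms by (simp only: cinner_diff_left) simp
  then show ?thesis
    by (simp add: cinner_self)
qed

lemma norm_scaleC: "norm (c *\<^sub>C x) = norm c * norm (x :: 'a::complex_inner)"
proof -
  have "complex_of_real ((norm (c *\<^sub>C x))\<^sup>2) = c * cnj c * of_real ((norm x)\<^sup>2)"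
    by (metis cinner_self cinner_scaleC_left cinner_scaleC_right mult.assoc)
  also have "\<dots> = of_real ((norm c * norm x)\<^sup>2)"
    by (simp only: complex_norm_square[symmetric] power_mult_distrib of_real_mult of_real_power)
  finally have "(norm (c *\<^sub>C x))\<^sup>2 = (norm c * norm x)\<^sup>2"
    using of_real_eq_iff by blast
  then show ?thesis
    by simp
qed

lemma norm_cinner_le: "norm (cinner x y) \<le> 2 * (norm x * norm y)"
proof -
  have "\<bar>Re (cinner x y)\<bar> \<le> norm x * norm y"
    using Cauchy_Schwarz_ineq2[of x y] by (simp add: inner_eq_Re_cinner)
  moreover have "\<bar>Im (cinner x y)\<bar> \<le> norm x * norm y"
    using Cauchy_Schwarz_ineq2[of "\<i> *\<^sub>C x" y]
    by (simp add: inner_eq_Re_cinner cinner_scaleC_left norm_scaleC)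
  ultimately show ?thesis
    using cmod_le[of "cinner x y"] by linarith
qed

lemma bounded_linear_scaleC_right:
  "bounded_linear (\<lambda>x. c *\<^sub>C x :: 'a::complex_inner)"
proof (rule bounded_linear_intro[where K = "norm c"])
  show "c *\<^sub>C (r *\<^sub>R x) = r *\<^sub>R (c *\<^sub>C x)" for r and x :: 'a
    by (simp add: scaleC_scaleC mult.commute flip: scaleC_of_real)
qed (auto simp: scaleC_add_right norm_scaleC)


section \<open>The space of square-summable functions\<close>

typedef (overloaded) ('x, 'h::complex_inner) ell2 =
  "{f :: 'x \<Rightarrow> 'h. (\<lambda>x. (norm (f x))\<^sup>2) summable_on UNIV}"
  morphisms ell2_apply Abs_ell2
  by (rule exI[of _ "\<lambda>_. 0"]) simp

setup_lifting type_definition_ell2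

lemma ell2_eqI: "(\<And>x. ell2_apply f x = ell2_apply g x) \<Longrightarrow> f = g"
  by (metis ell2_apply_inject ext)

lemma summable_norm_product:
  fixes f g :: "'x \<Rightarrow> 'h::complex_inner"
  assumes "(\<lambda>x. (norm (f x))\<^sup>2) summable_on UNIV" "(\<lambda>x. (norm (g x))\<^sup>2) summable_on UNIV"
  shows "(\<lambda>x. norm (f x) * norm (g x)) summable_on UNIV"
proof -
  have "(\<lambda>x. norm (norm (f x) * norm (g x))) summable_on UNIV"
    by (rule Infinite_Sum.abs_summable_product) (use assms in \<open>simp_all flip: power2_eq_square\<close>)
  then show ?thesis
    by simp
qed

lemma summable_cinner:
  fixes f g :: "'x \<Rightarrow> 'h::complex_inner"
  assumes "(\<lambda>x. (norm (f x))\<^sup>2) summable_on UNIV" "(\<lambda>x. (norm (g x))\<^sup>2) summable_on UNIV"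
  shows "(\<lambda>x. cinner (f x) (g x)) summable_on UNIV"
proof -
  have "(\<lambda>x. 2 * (norm (f x) * norm (g x))) summable_on UNIV"
    by (intro summable_on_cmult_right summable_norm_product assms)
  then have "(\<lambda>x. norm (2 * (norm (f x) * norm (g x)))) summable_on UNIV"
    by simp
  then have "(\<lambda>x. norm (cinner (f x) (g x))) summable_on UNIV"
    by (rule Infinite_Sum.abs_summable_on_comparison_test) (simp add: norm_cinner_le)
  then show ?thesis
    by (rule Infinite_Sum.abs_summable_summable)
qed

lemma summable_cinner_ell2:
  "(\<lambda>x. cinner (ell2_apply f x) (ell2_apply g x)) summable_on UNIV"
  using ell2_apply[of f] ell2_apply[of g] by (auto intro: summable_cinner)

lemma summable_norm_ell2: "(\<lambda>x. (norm (ell2_apply f x))\<^sup>2) summable_on UNIV"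
  using ell2_apply[of f] by simp

instantiation ell2 :: (type, complex_inner) complex_inner
begin

lift_definition zero_ell2 :: "('a, 'b) ell2" is "\<lambda>_. 0" by simp

lift_definition plus_ell2 :: "('a, 'b) ell2 \<Rightarrow> ('a, 'b) ell2 \<Rightarrow> ('a, 'b) ell2"
  is "\<lambda>f g x. f x + g x"
proof -
  fix f g :: "'a \<Rightarrow> 'b"
  assume f: "(\<lambda>x. (norm (f x))\<^sup>2) summable_on UNIV" and g: "(\<lambda>x. (norm (g x))\<^sup>2) summable_on UNIV"
  have "(\<lambda>x. 2 * (norm (f x))\<^sup>2 + 2 * (norm (g x))\<^sup>2) summable_on UNIV"
    by (intro summable_on_add summable_on_cmult_right f g)
  then have *: "(\<lambda>x. norm (2 * (norm (f x))\<^sup>2 + 2 * (norm (g x))\<^sup>2)) summable_on UNIV"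
    by simp
  have "(norm (f x + g x))\<^sup>2 \<le> 2 * (norm (f x))\<^sup>2 + 2 * (norm (g x))\<^sup>2" for x
  proof -
    have "(norm (f x + g x))\<^sup>2 \<le> (norm (f x) + norm (g x))\<^sup>2"
      by (intro power_mono norm_triangle_ineq) simp
    also have "\<dots> \<le> 2 * (norm (f x))\<^sup>2 + 2 * (norm (g x))\<^sup>2"
      using sum_squares_bound[of "norm (f x)" "norm (g x)"] by (simp add: power2_sum)
    finally show ?thesis .
  qed
  then have "(\<lambda>x. norm ((norm (f x + g x))\<^sup>2)) summable_on UNIV"
    by (intro Infinite_Sum.abs_summable_on_comparison_test[OF *]) simp
  then show "(\<lambda>x. (norm (f x + g x))\<^sup>2) summable_on UNIV"
    by simp
qed

lift_definition scaleC_ell2 :: "complex \<Rightarrow> ('a, 'b) ell2 \<Rightarrow> ('a, 'b) ell2"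
  is "\<lambda>c f x. c *\<^sub>C f x"
  by (simp add: norm_scaleC power_mult_distrib summable_on_cmult_right)

definition scaleR_ell2 :: "real \<Rightarrow> ('a, 'b) ell2 \<Rightarrow> ('a, 'b) ell2"
  where "scaleR_ell2 r f = complex_of_real r *\<^sub>C f"

definition uminus_ell2 :: "('a, 'b) ell2 \<Rightarrow> ('a, 'b) ell2"
  where "uminus_ell2 f = (- 1) *\<^sub>C f"

definition minus_ell2 :: "('a, 'b) ell2 \<Rightarrow> ('a, 'b) ell2 \<Rightarrow> ('a, 'b) ell2"
  where "minus_ell2 f g = f + - g"

lift_definition cinner_ell2 :: "('a, 'b) ell2 \<Rightarrow> ('a, 'b) ell2 \<Rightarrow> complex"
  is "\<lambda>f g. \<Sum>\<^sub>\<infinity>x. cinner (f x) (g x)" .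

definition inner_ell2 :: "('a, 'b) ell2 \<Rightarrow> ('a, 'b) ell2 \<Rightarrow> real"
  where "inner_ell2 f g = Re (cinner f g)"

definition norm_ell2 :: "('a, 'b) ell2 \<Rightarrow> real"
  where "norm_ell2 f = sqrt (inner f f)"

definition dist_ell2 :: "('a, 'b) ell2 \<Rightarrow> ('a, 'b) ell2 \<Rightarrow> real"
  where "dist_ell2 f g = norm (f - g)"

definition sgn_ell2 :: "('a, 'b) ell2 \<Rightarrow> ('a, 'b) ell2"
  where "sgn_ell2 f = inverse (norm f) *\<^sub>R f"

definition uniformity_ell2 :: "(('a, 'b) ell2 \<times> ('a, 'b) ell2) filter"
  where "uniformity_ell2 = (INF e\<in>{0<..}. principal {(f, g). dist f g < e})"

definition open_ell2 :: "('a, 'b) ell2 set \<Rightarrow> bool"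
  where "open_ell2 U \<longleftrightarrow>
    (\<forall>f\<in>U. eventually (\<lambda>(f', g). f' = f \<longrightarrow> g \<in> U) (uniformity :: (('a, 'b) ell2 \<times> ('a, 'b) ell2) filter))"

instance
proof
  fix f g h :: "('a, 'b) ell2" and c d :: complex and r s :: real
  note [simp] = zero_ell2.rep_eq plus_ell2.rep_eq scaleC_ell2.rep_eq
  note defs = scaleR_ell2_def uminus_ell2_def minus_ell2_def
  have neg: "(- 1) *\<^sub>C x = - x" for x :: 'b
    using scaleC_of_real[of "- 1" x] by simp
  show "f + g + h = f + (g + h)" "f + g = g + f" "0 + f = f"
    by (auto intro!: ell2_eqI simp: add_ac)
  show "- f + f = 0" "f - g = f + - g"
    by (auto intro!: ell2_eqI simp: defs neg)
  show C: "c *\<^sub>C (f + g) = c *\<^sub>C f + c *\<^sub>C g" "(c + d) *\<^sub>C f = c *\<^sub>C f + d *\<^sub>C f"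
    "c *\<^sub>C d *\<^sub>C f = (c * d) *\<^sub>C f" "complex_of_real r *\<^sub>C f = r *\<^sub>R f"
    by (auto intro!: ell2_eqI simp: defs scaleC_add_right scaleC_add_left scaleC_scaleC)
  show "r *\<^sub>R (f + g) = r *\<^sub>R f + r *\<^sub>R g" "(r + s) *\<^sub>R f = r *\<^sub>R f + s *\<^sub>R f"
    "r *\<^sub>R s *\<^sub>R f = (r * s) *\<^sub>R f" "1 *\<^sub>R f = f"
    by (auto intro!: ell2_eqI simp: defs scaleC_add_right scaleC_add_left scaleC_scaleC)
  show comm: "cinner f g = cnj (cinner g f)" for f g :: "('a, 'b) ell2"
    by (simp add: cinner_ell2.rep_eq flip: infsum_cnj cinner_commute)
  show add: "cinner (f + g) h = cinner f h + cinner g h"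
    by (simp add: cinner_ell2.rep_eq cinner_add_left infsum_add summable_cinner_ell2)
  show scal: "cinner (c *\<^sub>C f) g = c * cinner f g" for c
    by (simp add: cinner_ell2.rep_eq cinner_scaleC_left infsum_cmult_right')
  show "inner f g = Re (cinner f g)"
    by (rule inner_ell2_def)
  show "inner f g = inner g f"
    by (subst inner_ell2_def, subst comm) (simp add: inner_ell2_def)
  show "inner (f + g) h = inner f h + inner g h"
    by (simp add: inner_ell2_def add)
  show "inner (r *\<^sub>R f) g = r * inner f g"
    by (simp add: inner_ell2_def scaleR_ell2_def scal)
  have self: "inner f f = (\<Sum>\<^sub>\<infinity>x. (norm (ell2_apply f x))\<^sup>2)"
  proof -
    have "inner f f = Re (\<Sum>\<^sub>\<infinity>x. of_real ((norm (ell2_apply f x))\<^sup>2))"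
      by (simp add: inner_ell2_def cinner_ell2.rep_eq cinner_self)
    also have "\<dots> = (\<Sum>\<^sub>\<infinity>x. Re (of_real ((norm (ell2_apply f x))\<^sup>2)))"
      using infsum_Re[OF summable_cinner_ell2[of f f]] by (simp add: cinner_self)
    finally show ?thesis
      by simp
  qed
  show "0 \<le> inner f f"
    by (simp add: self infsum_nonneg)
  show "(inner f f = 0) = (f = 0)"
  proof
    assume 0: "inner f f = 0"
    show "f = 0"
    proof (rule ell2_eqI)
      fix x
      have "(norm (ell2_apply f x))\<^sup>2 = 0"
        using nonneg_infsum_le_0D[of "\<lambda>x. (norm (ell2_apply f x))\<^sup>2" UNIV x] 0 summable_norm_ell2[of f]
        by (simp add: self)
      then show "ell2_apply f x = ell2_apply 0 x"
        by simp
    qed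
  next
    assume "f = 0"
    then show "inner f f = 0"
      unfolding self by simp
  qed
qed (simp_all add: norm_ell2_def dist_ell2_def sgn_ell2_def uniformity_ell2_def open_ell2_def)

end

lemma ell2_norm_square: "(norm f)\<^sup>2 = (\<Sum>\<^sub>\<infinity>x. (norm (ell2_apply f x))\<^sup>2)"
proof -
  have "complex_of_real ((norm f)\<^sup>2) = (\<Sum>\<^sub>\<infinity>x. of_real ((norm (ell2_apply f x))\<^sup>2))"
    using cinner_self[of f] by (simp add: cinner_ell2.rep_eq cinner_self)
  then have "(norm f)\<^sup>2 = Re (\<Sum>\<^sub>\<infinity>x. of_real ((norm (ell2_apply f x))\<^sup>2))"
    by (metis Re_complex_of_real)
  also have "\<dots> = (\<Sum>\<^sub>\<infinity>x. Re (of_real ((norm (ell2_apply f x))\<^sup>2)))"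
    using infsum_Re[OF summable_cinner_ell2[of f f]] by (simp add: cinner_self)
  finally show ?thesis
    by simp
qed

lemma ell2_apply_diff: "ell2_apply (f - g) x = ell2_apply f x - ell2_apply g x"
  by (metis add_diff_cancel diff_add_cancel plus_ell2.rep_eq)

lemma ell2_sum_le_norm: "finite F \<Longrightarrow> (\<Sum>x\<in>F. (norm (ell2_apply f x))\<^sup>2) \<le> (norm f)\<^sup>2"
  unfolding ell2_norm_square by (intro finite_sum_le_infsum summable_norm_ell2) auto

lemma ell2_apply_norm_le: "norm (ell2_apply f x) \<le> norm f"
  using ell2_sum_le_norm[of "{x}" f] by (simp add: power2_le_iff_abs_le)

lemma ell2_norm_leI:
  assumes "\<And>F. finite F \<Longrightarrow> (\<Sum>x\<in>F. (norm (f x))\<^sup>2) \<le> C\<^sup>2" and "0 \<le> C"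
  shows "(\<lambda>x. (norm (f x))\<^sup>2) summable_on UNIV" and "norm (Abs_ell2 f) \<le> C"
proof -
  show s: "(\<lambda>x. (norm (f x))\<^sup>2) summable_on UNIV"
    by (rule nonneg_bdd_above_summable_on) (use assms in \<open>auto intro!: bdd_aboveI\<close>)
  have "(norm (Abs_ell2 f))\<^sup>2 \<le> C\<^sup>2"
    unfolding ell2_norm_square using s assms
    by (auto simp: Abs_ell2_inverse intro!: infsum_le_finite_sums)
  then show "norm (Abs_ell2 f) \<le> C"
    using assms(2) by (rule power2_le_imp_le)
qed

instance ell2 :: (type, complex_hilbert) complex_hilbert
proof
  fix X :: "nat \<Rightarrow> ('a, 'b) ell2"
  assume X: "Cauchy X"
  have "Cauchy (\<lambda>n. ell2_apply (X n) x)" for x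
  proof (rule metric_CauchyI)
    fix e :: real
    assume "0 < e"
    then obtain M where M: "\<And>m n. m \<ge> M \<Longrightarrow> n \<ge> M \<Longrightarrow> dist (X m) (X n) < e"
      using X unfolding Cauchy_def by blast
    have "dist (ell2_apply (X m) x) (ell2_apply (X n) x) \<le> dist (X m) (X n)" for m n
      using ell2_apply_norm_le[of "X m - X n" x] by (simp add: dist_norm ell2_apply_diff)
    then show "\<exists>M. \<forall>m\<ge>M. \<forall>n\<ge>M. dist (ell2_apply (X m) x) (ell2_apply (X n) x) < e"
      using M by (meson le_less_trans)
  qed
  then have "\<forall>x. \<exists>l. (\<lambda>n. ell2_apply (X n) x) \<longlonglongrightarrow> l"
    using Cauchy_convergent convergent_def by blast
  then obtain l where l: "\<And>x. (\<lambda>n. ell2_apply (X n) x) \<longlonglongrightarrow> l x"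
    by metis
  have fin: "(\<Sum>x\<in>F. (norm (l x - ell2_apply (X n) x))\<^sup>2) \<le> e\<^sup>2"
    if M: "\<And>m n. m \<ge> M \<Longrightarrow> n \<ge> M \<Longrightarrow> dist (X m) (X n) < e" and "n \<ge> M" "finite F" for e M n F
  proof (rule tendsto_upperbound)
    show "(\<lambda>m. \<Sum>x\<in>F. (norm (ell2_apply (X m) x - ell2_apply (X n) x))\<^sup>2)
        \<longlonglongrightarrow> (\<Sum>x\<in>F. (norm (l x - ell2_apply (X n) x))\<^sup>2)"
      by (intro tendsto_intros l)
    show "\<forall>\<^sub>F m in sequentially. (\<Sum>x\<in>F. (norm (ell2_apply (X m) x - ell2_apply (X n) x))\<^sup>2) \<le> e\<^sup>2"
    proof (rule eventually_sequentiallyI)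
      fix m
      assume "m \<ge> M"
      have "(\<Sum>x\<in>F. (norm (ell2_apply (X m - X n) x))\<^sup>2) \<le> (norm (X m - X n))\<^sup>2"
        by (rule ell2_sum_le_norm) fact
      also have "\<dots> \<le> e\<^sup>2"
        using M[OF \<open>m \<ge> M\<close> \<open>n \<ge> M\<close>] by (intro power_mono) (auto simp: dist_norm)
      finally show "(\<Sum>x\<in>F. (norm (ell2_apply (X m) x - ell2_apply (X n) x))\<^sup>2) \<le> e\<^sup>2"
        by (simp add: ell2_apply_diff)
    qed
  qed simp
  obtain N where N: "\<And>m n. m \<ge> N \<Longrightarrow> n \<ge> N \<Longrightarrow> dist (X m) (X n) < 1"
    using X unfolding Cauchy_def by (meson zero_less_one)
  have "(\<lambda>x. (norm (l x - ell2_apply (X N) x))\<^sup>2) summable_on UNIV"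
    using fin[OF N, where n = N] by (intro ell2_norm_leI(1)[where C = 1]) auto
  then have "ell2_apply (Abs_ell2 (\<lambda>x. l x - ell2_apply (X N) x)) = (\<lambda>x. l x - ell2_apply (X N) x)"
    by (simp add: Abs_ell2_inverse)
  then have L: "ell2_apply (Abs_ell2 (\<lambda>x. l x - ell2_apply (X N) x) + X N) = l"
    by (auto simp: plus_ell2.rep_eq)
  define L where "L = Abs_ell2 (\<lambda>x. l x - ell2_apply (X N) x) + X N"
  have "X \<longlonglongrightarrow> L"
  proof (rule metric_LIMSEQ_I)
    fix e :: real
    assume "0 < e"
    then obtain M where M: "\<And>m n. m \<ge> M \<Longrightarrow> n \<ge> M \<Longrightarrow> dist (X m) (X n) < e / 2"
      using X unfolding Cauchy_def by (meson half_gt_zero)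
    have "dist (X n) L < e" if "n \<ge> M" for n
    proof -
      have "ell2_apply (L - X n) = (\<lambda>x. l x - ell2_apply (X n) x)"
        using L by (auto simp: ell2_apply_diff L_def)
      then have "L - X n = Abs_ell2 (\<lambda>x. l x - ell2_apply (X n) x)"
        by (metis ell2_apply_inverse)
      then have "norm (L - X n) \<le> e / 2"
        using ell2_norm_leI(2)[OF fin[OF M that]] \<open>0 < e\<close> by simp
      then show ?thesis
        using \<open>0 < e\<close> by (simp add: dist_norm norm_minus_commute)
    qed
    then show "\<exists>no. \<forall>n\<ge>no. dist (X n) L < e"
      by blast
  qed
  then show "convergent X"
    by (auto simp: convergent_def)
qed

text \<open>The vector \<open>\<delta>\<^sub>x \<otimes> \<eta>\<close>.\<close>

lift_definition delta :: "'x \<Rightarrow> 'h \<Rightarrow> ('x, 'h::complex_inner) ell2"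
  is "\<lambda>x \<eta> y. if y = x then \<eta> else 0"
proof -
  fix x :: 'x and \<eta> :: 'h
  have "(\<lambda>y. (norm (if y = x then \<eta> else 0))\<^sup>2) summable_on {x}"
    by simp
  then show "(\<lambda>y. (norm (if y = x then \<eta> else 0))\<^sup>2) summable_on UNIV"
    by (rule summable_on_cong_neutral[THEN iffD1, rotated -1]) auto
qed

lemma cinner_delta_right: "cinner f (delta x \<eta>) = cinner (ell2_apply f x) \<eta>"
proof -
  have "cinner f (delta x \<eta>) = (\<Sum>\<^sub>\<infinity>y. if y = x then cinner (ell2_apply f x) \<eta> else 0)"
    unfolding cinner_ell2.rep_eq delta.rep_eq by (rule infsum_cong) auto
  also have "\<dots> = (\<Sum>\<^sub>\<infinity>y\<in>{x}. cinner (ell2_apply f x) \<eta>)"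
    by (rule infsum_cong_neutral) auto
  finally show ?thesis
    by simp
qed

lemma norm_delta: "norm (delta x \<eta>) = norm \<eta>"
proof -
  have "complex_of_real ((norm (delta x \<eta>))\<^sup>2) = of_real ((norm \<eta>)\<^sup>2)"
    by (simp only: cinner_self[symmetric] cinner_delta_right) (simp add: delta.rep_eq)
  then have "(norm (delta x \<eta>))\<^sup>2 = (norm \<eta>)\<^sup>2"
    using of_real_eq_iff by blast
  then show ?thesis
    by simp
qed


section \<open>Bounded operators\<close>

text \<open>
  \<^term>\<open>UNIV :: ('a::real_normed_vector \<Rightarrow>\<^sub>L 'a) set\<close> consists of all bounded real-linear operators;
  the algebra of bounded operators of a complex Hilbert space is the closed subset of the
  complex-linear ones, with the same (operator) norm.
\<close>

definition complex_ops :: "('a::complex_inner \<Rightarrow>\<^sub>L 'a) set"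
  where "complex_ops = {a. \<forall>c v. blinfun_apply a (c *\<^sub>C v) = c *\<^sub>C blinfun_apply a v}"

instantiation blinfun :: (real_normed_vector, complex_inner) scaleC
begin

lift_definition scaleC_blinfun :: "complex \<Rightarrow> 'a \<Rightarrow>\<^sub>L 'b \<Rightarrow> 'a \<Rightarrow>\<^sub>L 'b"
  is "\<lambda>c a v. c *\<^sub>C a v"
  by (rule bounded_linear_compose[OF bounded_linear_scaleC_right])

instance ..

end

definition is_adjoint :: "('a::complex_inner \<Rightarrow>\<^sub>L 'a) \<Rightarrow> ('a \<Rightarrow>\<^sub>L 'a) \<Rightarrow> bool"
  where "is_adjoint a b \<longleftrightarrow>
    (\<forall>v w. cinner (blinfun_apply a v) w = cinner v (blinfun_apply b w))"

definition adjoint_op :: "('a::complex_hilbert \<Rightarrow>\<^sub>L 'a) \<Rightarrow> ('a \<Rightarrow>\<^sub>L 'a)"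
  where "adjoint_op a = (THE b. is_adjoint a b)"

lemma adjoint_op_eqI:
  assumes "is_adjoint a b"
  shows "adjoint_op a = b"
  unfolding adjoint_op_def
proof (rule the_equality)
  fix b'
  assume "is_adjoint a b'"
  then have "cinner (blinfun_apply b' w) v = cinner (blinfun_apply b w) v" for v w
    using assms unfolding is_adjoint_def by (metis cinner_commute)
  then show "b' = b"
    by (intro blinfun_eqI cinner_ext)
qed fact

definition unitary_op :: "('a::complex_hilbert \<Rightarrow>\<^sub>L 'a) \<Rightarrow> bool"
  where "unitary_op u \<longleftrightarrow> u \<in> complex_ops \<and>
    u o\<^sub>L adjoint_op u = id_blinfun \<and> adjoint_op u o\<^sub>L u = id_blinfun"

definition compact_op :: "('a::real_normed_vector \<Rightarrow>\<^sub>L 'b::real_normed_vector) \<Rightarrow> bool"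
  where "compact_op a \<longleftrightarrow> compact (closure (blinfun_apply a ` cball 0 1))"


section \<open>Roe algebras\<close>

instantiation int :: metric_space
begin

definition dist_int :: "int \<Rightarrow> int \<Rightarrow> real"
  where "dist_int m n = real_of_int \<bar>m - n\<bar>"

definition uniformity_int :: "(int \<times> int) filter"
  where "uniformity_int = (INF e\<in>{0<..}. principal {(m, n). dist m n < e})"

instance
proof
  fix U :: "int set"
  have "\<forall>\<^sub>F (m', n) in uniformity. m' = m \<longrightarrow> n \<in> U" if "m \<in> U" for m
  proof -
    have "principal {(m, n). dist m n < 1} \<ge> (uniformity :: (int \<times> int) filter)"
      unfolding uniformity_int_def by (rule INF_lower) simp
    moreover have "\<forall>\<^sub>F (m', n) in principal {(m, n). dist m n < 1}. m' = m \<longrightarrow> n \<in> U"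
      using that by (auto simp: eventually_principal dist_int_def simp flip: of_int_diff of_int_abs)
    ultimately show ?thesis
      by (rule filter_leD)
  qed
  then show "open U \<longleftrightarrow> (\<forall>m\<in>U. \<forall>\<^sub>F (m', n) in uniformity. m' = m \<longrightarrow> n \<in> U)"
    by (simp add: open_discrete)
qed (auto simp: uniformity_int_def dist_int_def)

end

type_synonym ('x, 'h) ell2_op = "('x, 'h) ell2 \<Rightarrow>\<^sub>L ('x, 'h) ell2"

definition is_entry :: "('x, 'h::complex_inner) ell2_op \<Rightarrow> 'x \<Rightarrow> 'x \<Rightarrow> ('h \<Rightarrow>\<^sub>L 'h) \<Rightarrow> bool"
  where "is_entry a x y b \<longleftrightarrow>
    (\<forall>\<xi> \<eta>. cinner (blinfun_apply b \<xi>) \<eta> =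
      cinner (blinfun_apply a (delta x \<xi>)) (delta y \<eta>))"

definition entry :: "('x, 'h::complex_inner) ell2_op \<Rightarrow> 'x \<Rightarrow> 'x \<Rightarrow> ('h \<Rightarrow>\<^sub>L 'h)"
  where "entry a x y = (THE b. is_entry a x y b)"

lemma entry_eqI:
  assumes "is_entry a x y b"
  shows "entry a x y = b"
  unfolding entry_def
proof (rule the_equality)
  fix b'
  assume "is_entry a x y b'"
  then show "b' = b"
    using assms unfolding is_entry_def by (intro blinfun_eqI cinner_ext) metis
qed fact

lemma entry_apply: "blinfun_apply (entry a x y) \<xi> = ell2_apply (blinfun_apply a (delta x \<xi>)) y"
proof -
  have d: "delta x (\<xi> + \<xi>') = delta x \<xi> + delta x \<xi>'" for \<xi> \<xi>'
    by (rule ell2_eqI) (simp add: delta.rep_eq plus_ell2.rep_eq)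
  have s: "ell2_apply (r *\<^sub>R f) z = r *\<^sub>R ell2_apply f z" for r f z
    by (simp add: scaleC_ell2.rep_eq flip: scaleC_of_real)
  have ds: "delta x (r *\<^sub>R \<xi>) = r *\<^sub>R delta x \<xi>" for r \<xi>
    by (rule ell2_eqI) (auto simp add: delta.rep_eq s)
  have bl: "bounded_linear (\<lambda>\<xi>. ell2_apply (blinfun_apply a (delta x \<xi>)) y)"
  proof (rule bounded_linear_intro[where K = "norm a"])
    fix \<xi>
    have "norm (ell2_apply (blinfun_apply a (delta x \<xi>)) y) \<le> norm (blinfun_apply a (delta x \<xi>))"
      by (rule ell2_apply_norm_le)
    also have "\<dots> \<le> norm \<xi> * norm a"
      using norm_blinfun[of a "delta x \<xi>"] by (simp add: norm_delta mult.commute)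
    finally show "norm (ell2_apply (blinfun_apply a (delta x \<xi>)) y) \<le> norm \<xi> * norm a" .
  qed (simp_all add: d ds s blinfun.add_right blinfun.scaleR_right plus_ell2.rep_eq)
  then have "is_entry a x y (Blinfun (\<lambda>\<xi>. ell2_apply (blinfun_apply a (delta x \<xi>)) y))"
    by (simp add: is_entry_def bounded_linear_Blinfun_apply cinner_delta_right)
  from entry_eqI[OF this] bl show ?thesis
    by (simp add: bounded_linear_Blinfun_apply)
qed

text \<open>The supremum is taken in \<open>[0, \<infinity>]\<close>, so the zero operator has propagation \<open>0\<close>.\<close>

definition propagation :: "('x::metric_space, 'h::complex_inner) ell2_op \<Rightarrow> ennreal"
  where "propagation a = (SUP (x, y) \<in> {(x, y). entry a x y \<noteq> 0}. ennreal (dist x y))"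

definition BD :: "('x::metric_space, 'h::complex_hilbert) ell2_op set"
  where "BD = closure {a \<in> complex_ops. propagation a < \<infinity>}"

definition Roe :: "('x::metric_space, 'h::complex_hilbert) ell2_op set"
  where "Roe = {a \<in> BD. \<forall>x y. compact_op (entry a x y)}"

definition is_star_hom ::
    "('a::complex_hilbert \<Rightarrow>\<^sub>L 'a) set \<Rightarrow> (('a \<Rightarrow>\<^sub>L 'a) \<Rightarrow> ('a \<Rightarrow>\<^sub>L 'a)) \<Rightarrow> bool"
  where "is_star_hom A \<phi> \<longleftrightarrow>
    (\<forall>a\<in>A. \<forall>b\<in>A. \<phi> (a + b) = \<phi> a + \<phi> b) \<and>
    (\<forall>c. \<forall>a\<in>A. \<phi> (c *\<^sub>C a) = c *\<^sub>C \<phi> a) \<and>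
    (\<forall>a\<in>A. \<forall>b\<in>A. \<phi> (a o\<^sub>L b) = \<phi> a o\<^sub>L \<phi> b) \<and>
    (\<forall>a\<in>A. \<phi> (adjoint_op a) = adjoint_op (\<phi> a))"

definition Aut_Roe ::
    "(('x::metric_space, 'h::complex_hilbert) ell2_op \<Rightarrow> ('x, 'h) ell2_op) monoid"
  where "Aut_Roe = (BijGroup Roe)\<lparr>carrier := {\<phi> \<in> Bij Roe. is_star_hom Roe \<phi>}\<rparr>"

definition Inn_BD ::
    "(('x::metric_space, 'h::complex_hilbert) ell2_op \<Rightarrow> ('x, 'h) ell2_op) set"
  where "Inn_BD = {\<lambda>a\<in>Roe. u o\<^sub>L a o\<^sub>L adjoint_op u | u. u \<in> BD \<and> unitary_op u}"

definition Out_Roe ::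
    "(('x::metric_space, 'h::complex_hilbert) ell2_op \<Rightarrow> ('x, 'h) ell2_op) set monoid"
  where "Out_Roe = Aut_Roe Mod Inn_BD"


section \<open>The three groups\<close>

text \<open>
  Breakpoints are allowed to accumulate only at infinity. On a compact interval, or if \<open>f\<close>
  is the identity off a compact set, the set of breakpoints can hence be taken finite.
\<close>

definition piecewise_linear_on :: "real set \<Rightarrow> (real \<Rightarrow> real) \<Rightarrow> bool"
  where "piecewise_linear_on S f \<longleftrightarrow>
    (\<exists>B. (\<forall>s t. finite (B \<inter> {s..t})) \<and>
      (\<forall>s t. {s..t} \<subseteq> S \<and> {s<..<t} \<inter> B = {} \<longrightarrow>
        (\<exists>m c. \<forall>x\<in>{s..t}. f x = m * x + c)))"

definition PL_kappa :: "(real \<Rightarrow> real) monoid"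
  where "PL_kappa = (BijGroup UNIV)\<lparr>carrier :=
    {f. (\<exists>g. homeomorphism UNIV UNIV f g) \<and> piecewise_linear_on UNIV f \<and>
      compact (closure {x. f x \<noteq> x})}\<rparr>"

definition dyadic_rationals :: "real set"
  where "dyadic_rationals = {real_of_int k / 2 ^ n | k n. True}"

text \<open>
  Elements are maps on \<open>[0, 1]\<close>, extended by \<open>undefined\<close> to the real line; derivatives at the
  end points are one-sided.
\<close>

definition Thompson_F :: "(real \<Rightarrow> real) monoid"
  where "Thompson_F = (BijGroup {0..1})\<lparr>carrier :=
    {f \<in> extensional {0..1}.
      (\<exists>g. homeomorphism {0..1} {0..1} f g) \<and> piecewise_linear_on {0..1} f \<and>
      (\<exists>D \<subseteq> dyadic_rationals. finite D \<and>
        (\<forall>x\<in>{0..1} - D. \<exists>k::int. (f has_real_derivative 2 powi k) (at x within {0..1})))}\<rparr>"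

text \<open>
  The free group on \<open>S\<close>, as the group of reduced words: the letter \<open>(s, True)\<close> is \<open>s\<close> and
  \<open>(s, False)\<close> is its inverse; the product is concatenation followed by cancellation.
\<close>

fun reduced_word :: "('a \<times> bool) list \<Rightarrow> bool" where
  "reduced_word [] = True"
| "reduced_word [g] = True"
| "reduced_word (g # h # w) \<longleftrightarrow> \<not> (fst g = fst h \<and> snd g \<noteq> snd h) \<and> reduced_word (h # w)"

fun cancel_Cons :: "'a \<times> bool \<Rightarrow> ('a \<times> bool) list \<Rightarrow> ('a \<times> bool) list" where
  "cancel_Cons g [] = [g]"
| "cancel_Cons g (h # w) = (if fst g = fst h \<and> snd g \<noteq> snd h then w else g # h # w)"

definition free_group :: "'a set \<Rightarrow> ('a \<times> bool) list monoid"
  where "free_group S =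
    \<lparr>carrier = {w. reduced_word w \<and> fst ` set w \<subseteq> S},
     mult = (\<lambda>v w. foldr cancel_Cons v w),
     one = []\<rparr>"

lemma reduced_word_tl: "reduced_word (g # w) \<Longrightarrow> reduced_word w"
  by (cases w) auto

lemma reduced_cancel_Cons: "reduced_word w \<Longrightarrow> reduced_word (cancel_Cons g w)"
  by (cases w) (auto dest: reduced_word_tl)

lemma reduced_foldr_cancel: "reduced_word w \<Longrightarrow> reduced_word (foldr cancel_Cons v w)"
  by (induction v) (auto intro: reduced_cancel_Cons)

lemma set_cancel_Cons: "set (cancel_Cons g w) \<subseteq> insert g (set w)"
  by (cases w) auto

lemma set_foldr_cancel: "set (foldr cancel_Cons v w) \<subseteq> set v \<union> set w"
  by (induction v) (use set_cancel_Cons in fastforce)+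

lemma cancel_Cons_cancel_Cons:
  assumes "reduced_word w"
  shows "cancel_Cons (s, \<not> b) (cancel_Cons (s, b) w) = w"
proof (cases w)
  case (Cons h w')
  then show ?thesis
    using assms by (cases w'; cases h) auto
qed auto

lemma foldr_cancel_Cons:
  assumes "reduced_word w"
  shows "foldr cancel_Cons (cancel_Cons g v) w = cancel_Cons g (foldr cancel_Cons v w)"
proof (cases v)
  case (Cons h v')
  show ?thesis
  proof (cases "fst g = fst h \<and> snd g \<noteq> snd h")
    case True
    then obtain s b where "h = (s, b)" "g = (s, \<not> b)"
      by (cases g; cases h) auto
    then show ?thesis
      using Cons cancel_Cons_cancel_Cons[OF reduced_foldr_cancel[OF assms]] by simp
  next
    case False
    then have "cancel_Cons g v = g # v"
      using Cons by auto
    then show ?thesis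
      by simp
  qed
qed simp

lemma foldr_cancel_assoc:
  "reduced_word w \<Longrightarrow>
    foldr cancel_Cons (foldr cancel_Cons u v) w = foldr cancel_Cons u (foldr cancel_Cons v w)"
  by (induction u) (auto simp: foldr_cancel_Cons)

lemma foldr_cancel_inverse:
  "reduced_word w \<Longrightarrow>
    foldr cancel_Cons (rev (map (\<lambda>(s, b). (s, \<not> b)) v)) (foldr cancel_Cons v w) = w"
  by (induction v arbitrary: w)
     (auto simp: cancel_Cons_cancel_Cons reduced_foldr_cancel)

lemma foldr_cancel_Nil: "reduced_word v \<Longrightarrow> foldr cancel_Cons v [] = v"
proof (induction v)
  case (Cons g v)
  then show ?case
    using reduced_word_tl[OF Cons.prems] by (cases v) auto
qed simp

lemma group_free_group: "group (free_group S)"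
proof (rule groupI)
  fix v
  assume v: "v \<in> carrier (free_group S)"
  let ?i = "rev (map (\<lambda>(s, b). (s, \<not> b)) v)"
  have i: "fst ` set (foldr cancel_Cons ?i []) \<subseteq> S" "reduced_word (foldr cancel_Cons ?i [])"
    using v set_foldr_cancel[of ?i "[]"] by (fastforce simp: free_group_def, simp add: reduced_foldr_cancel)
  have "foldr cancel_Cons (foldr cancel_Cons ?i []) v = foldr cancel_Cons ?i v"
    using v foldr_cancel_assoc[of v ?i "[]"] by (simp add: free_group_def)
  also have "\<dots> = []"
    using v foldr_cancel_inverse[of "[]" v] by (simp add: free_group_def foldr_cancel_Nil)
  finally show "\<exists>w\<in>carrier (free_group S). w \<otimes>\<^bsub>free_group S\<^esub> v = \<one>\<^bsub>free_group S\<^esub>"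
    using i by (intro bexI[of _ "foldr cancel_Cons ?i []"]) (auto simp: free_group_def)
next
  fix v w
  assume "v \<in> carrier (free_group S)" "w \<in> carrier (free_group S)"
  then show "v \<otimes>\<^bsub>free_group S\<^esub> w \<in> carrier (free_group S)"
    using set_foldr_cancel[of v w] by (fastforce simp: free_group_def reduced_foldr_cancel)
qed (simp_all add: free_group_def foldr_cancel_assoc)

definition contains_copy :: "('a, 'm) monoid_scheme \<Rightarrow> ('b, 'n) monoid_scheme \<Rightarrow> bool"
  where "contains_copy G K \<longleftrightarrow> (\<exists>S. subgroup S G \<and> K \<cong> G\<lparr>carrier := S\<rparr>)"

end

theory Submission
  imports Defs
begin

text \<open>
  A coarse self-equivalence \<open>F\<close> of the integers is implemented by a unitary \<open>U\<close> on \<open>\<ell>\<^sub>2(\<int>, H)\<close> that moves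
  \<open>\<delta>\<^sub>x \<otimes> H\<close> into the sum of the \<open>\<delta>\<^sub>y \<otimes> H\<close> with \<open>y\<close> close to \<open>F x\<close>. To find \<open>U\<close>, take an
  orthonormal basis \<open>B\<close> of \<open>H\<close>. The vectors \<open>\<delta>\<^sub>x \<otimes> e\<close> with \<open>e \<in> B\<close> form a basis of \<open>\<ell>\<^sub>2(\<int>, H)\<close>, and
  as \<open>B\<close> is infinite, there is room to turn \<open>F\<close> and a coarse inverse into injections of \<open>\<int> \<times> B\<close>
  into itself; the Schroeder-Bernstein argument merges them into a bijection, and \<open>U\<close> permutes the
  basis by it (\<open>ex_unitary_near_map\<close>).

  Conjugation by \<open>U\<close> preserves bounded propagation up to a change of the bound, hence it
  preserves \<open>BD\<close> and the Roe algebra. Two unitaries that implement nearby maps differ by a unitary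
  of finite propagation, so the class of \<open>Ad U\<close> modulo \<open>Inn_BD\<close> depends multiplicatively on \<open>F\<close>. If
  \<open>Ad U = Ad u\<close> with \<open>u \<in> BD\<close>, then comparing both sides on rank one operators shows \<open>U = c u\<close> on all
  \<open>\<delta>\<^sub>x \<otimes> \<xi>\<close>, for a scalar \<open>c\<close> of modulus one. But \<open>u\<close> is a norm limit of operators of finite
  propagation, while \<open>U\<close> has matrix coefficients of modulus one close to every \<open>(x, F x)\<close>; so \<open>F\<close> is
  at bounded distance from the identity. Hence every group that acts on \<open>\<int>\<close> by Lipschitz maps up to
  bounded errors, and whose nontrivial elements have unbounded displacement, embeds
  (\<open>contains_copy_Out_Roe_of_quasi_action\<close>).

  Such actions arise from actions on \<open>[0, 1]\<close> by Lipschitz maps that fix the end points: put a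
  rescaled copy on every interval \<open>[2\<^sup>n, 2\<^sup>n\<^sup>+\<^sup>1]\<close>. Rescaling does not change Lipschitz constants but
  multiplies displacements by \<open>2\<^sup>n\<close>. There may even be countably many different actions, each
  of them used on infinitely many of these intervals, as long as the Lipschitz constant of each group
  element is the same for all of them; it is then enough that the actions are jointly faithful
  (\<open>contains_copy_Out_Roe_of_interval_actions\<close>).

  A piecewise linear map with finitely many pieces is Lipschitz. Thus Thompson's group acts as
  required by its definition, and \<open>PL_kappa\<close> does so after the real line is identified with \<open>(0, 1)\<close>
  by a diffeomorphism, which is bi-Lipschitz on the compact supports. For the free group on \<open>\<real>\<close> there is
  one action for each natural number \<open>N\<close> and each reduced word \<open>v\<close> in the letters \<open>\<int>\<close>, in which the
  generator \<open>s\<close> acts as the letter \<open>\<lfloor>N s\<rfloor>\<close>. A letter acts by a map of \<open>[0, 1]\<close> that does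
  what is needed for \<open>v\<close> to move a point step by step through a list of equidistant points. Since
  \<open>v\<close> is reduced, the prescriptions for one letter extend to a bi-Lipschitz map with constant 3,
  whatever \<open>v\<close> and \<open>N\<close> are. A nontrivial element \<open>w\<close> is detected once \<open>N\<close> separates the generators
  that occur in it, with \<open>v\<close> the image of \<open>w\<close>.
\<close>


section \<open>Adjoints\<close>

instance complex_hilbert \<subseteq> banach ..

text \<open>
  The Riesz representation theorem. The quadratic functional \<open>\<parallel>x\<parallel>\<^sup>2 - 2 f x\<close> is bounded below; by the
  parallelogram law its minimising sequences are Cauchy, and stationarity at the minimum \<open>v\<close> says
  that \<open>f\<close> is the inner product with \<open>v\<close>.
\<close>

lemma bounded_linear_functional_representation:
  fixes f :: "'a::{real_inner,complete_space} \<Rightarrow> real"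
  assumes "bounded_linear f"
  shows "\<exists>v. \<forall>x. f x = inner v x"
proof -
  interpret f: bounded_linear f by fact
  define J where "J x = (norm x)\<^sup>2 - 2 * f x" for x
  obtain K where K: "\<And>x. norm (f x) \<le> norm x * K"
    using f.bounded by blast
  have "- K\<^sup>2 \<le> J x" for x
  proof -
    have "0 \<le> (norm x - K)\<^sup>2" by simp
    moreover have "f x \<le> norm x * K" using K[of x] by simp
    ultimately show ?thesis by (simp add: J_def power2_diff)
  qed
  then have bdd: "bdd_below (range J)" by (auto intro!: bdd_belowI)
  define m where "m = Inf (range J)"
  have m_le: "m \<le> J x" for x
    unfolding m_def by (rule cINF_lower[OF bdd]) simp
  have "\<exists>x. J x < m + inverse (real (Suc n))" for n
    using cInf_lessD[of "range J" "m + inverse (real (Suc n))"] by (auto simp: m_def)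
  then obtain X where X: "\<And>n. J (X n) < m + inverse (real (Suc n))"
    by metis
  have par: "(norm (x - y))\<^sup>2 \<le> 2 * (J x - m) + 2 * (J y - m)" for x y
  proof -
    have "J ((1/2) *\<^sub>R (x + y)) = (norm (x + y))\<^sup>2 / 4 - (f x + f y)"
      by (simp add: J_def f.scaleR f.add power_divide add_divide_distrib)
    moreover have "(norm (x + y))\<^sup>2 + (norm (x - y))\<^sup>2 = 2 * (norm x)\<^sup>2 + 2 * (norm y)\<^sup>2"
      by (simp add: power2_norm_eq_inner inner_add inner_diff inner_commute)
    ultimately have "(norm (x - y))\<^sup>2 = 2 * J x + 2 * J y - 4 * J ((1/2) *\<^sub>R (x + y))"
      by (simp add: J_def)
    then show ?thesis using m_le[of "(1/2) *\<^sub>R (x + y)"] by simp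
  qed
  have "Cauchy X"
  proof (rule metric_CauchyI)
    fix e :: real assume "e > 0"
    then obtain M where M: "inverse (real (Suc M)) < e\<^sup>2 / 4"
      using reals_Archimedean[of "e\<^sup>2 / 4"] by auto
    have "dist (X k) (X l) < e" if "k \<ge> M" "l \<ge> M" for k l
    proof -
      have small: "J (X n) - m < e\<^sup>2 / 4" if "n \<ge> M" for n
      proof -
        have "inverse (real (Suc n)) \<le> inverse (real (Suc M))"
          using that by (intro le_imp_inverse_le) auto
        then show ?thesis using X[of n] M by linarith
      qed
      note par[of "X k" "X l"]
      also have "2 * (J (X k) - m) + 2 * (J (X l) - m) < 2 * (e\<^sup>2 / 4) + 2 * (e\<^sup>2 / 4)"
        using small that by (intro add_strict_mono mult_strict_left_mono) auto
      finally have "(norm (X k - X l))\<^sup>2 < e\<^sup>2" by simp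
      then show ?thesis
        using \<open>e > 0\<close> by (simp add: dist_norm power_less_imp_less_base)
    qed
    then show "\<exists>M. \<forall>k\<ge>M. \<forall>l\<ge>M. dist (X k) (X l) < e" by blast
  qed
  then obtain v where v: "X \<longlonglongrightarrow> v"
    using Cauchy_convergent convergent_def by blast
  have "(\<lambda>n. J (X n)) \<longlonglongrightarrow> J v"
    unfolding J_def by (intro tendsto_intros v f.tendsto)
  moreover have "(\<lambda>n. J (X n)) \<longlonglongrightarrow> m"
  proof (rule tendsto_sandwich[where f = "\<lambda>n. m" and h = "\<lambda>n. m + inverse (real (Suc n))"])
    show "(\<lambda>n. m + inverse (real (Suc n))) \<longlonglongrightarrow> m"
      using LIMSEQ_inverse_real_of_nat_add[of m] by simp
    show "(\<lambda>n. m) \<longlonglongrightarrow> m" by simp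
    show "\<forall>\<^sub>F n in sequentially. m \<le> J (X n)" using m_le by simp
    show "\<forall>\<^sub>F n in sequentially. J (X n) \<le> m + inverse (real (Suc n))"
      using X by (simp add: less_imp_le)
  qed
  ultimately have Jv: "J v = m" using LIMSEQ_unique by blast
  have "f y = inner v y" for y
  proof (rule ccontr)
    assume "f y \<noteq> inner v y"
    define d where "d = inner v y - f y"
    have d: "d \<noteq> 0" using \<open>f y \<noteq> inner v y\<close> by (simp add: d_def)
    have quad: "0 \<le> t\<^sup>2 * (norm y)\<^sup>2 + 2 * t * d" for t
    proof -
      have "(norm (v + t *\<^sub>R y))\<^sup>2 = (norm v)\<^sup>2 + t\<^sup>2 * (norm y)\<^sup>2 + 2 * t * inner v y"
        unfolding power2_norm_eq_inner
        by (simp add: inner_add inner_commute power2_eq_square algebra_simps)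
      then have "J (v + t *\<^sub>R y) = J v + t\<^sup>2 * (norm y)\<^sup>2 + 2 * t * d"
        by (simp add: J_def f.add f.scaleR d_def algebra_simps)
      then show ?thesis using m_le[of "v + t *\<^sub>R y"] Jv by simp
    qed
    \<comment> \<open>Any positive upper bound of \<open>\<parallel>y\<parallel>\<^sup>2\<close>; the step \<open>- d / N\<close> then decreases \<open>J\<close>.\<close>
    define N where "N = (norm y)\<^sup>2 + 1"
    have N: "N > 0" "(norm y)\<^sup>2 \<le> N" by (auto simp: N_def intro: add_nonneg_pos)
    have "0 \<le> (d / N)\<^sup>2 * (norm y)\<^sup>2 - 2 * (d / N) * d"
      using quad[of "- d / N"] by simp
    also have "\<dots> \<le> (d / N)\<^sup>2 * N - 2 * (d / N) * d"
      using N(2) by (intro diff_right_mono mult_left_mono) auto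
    also have "\<dots> = - (d\<^sup>2 / N)"
      using N(1) by (simp add: field_simps power2_eq_square)
    also have "\<dots> < 0" using d N(1) by simp
    finally show False by simp
  qed
  then show ?thesis by blast
qed

text \<open>
  Adjoints and the unitaries between orthonormal bases are constructed from this, as the operators
  of suitable forms.
\<close>

lemma bounded_bilinear_form_operator:
  fixes \<beta> :: "'a::real_normed_vector \<Rightarrow> 'b::{real_inner,complete_space} \<Rightarrow> real"
  assumes "bounded_bilinear \<beta>"
  shows "\<exists>T. \<forall>x y. \<beta> x y = inner (blinfun_apply T x) y"
proof -
  interpret bounded_bilinear \<beta> by fact
  have "\<exists>v. \<forall>y. \<beta> x y = inner v y" for x
    by (rule bounded_linear_functional_representation[OF bounded_linear_right])
  then obtain T where T: "\<And>x y. \<beta> x y = inner (T x) y"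
    by metis
  obtain K where K: "0 \<le> K" "\<And>x y. norm (\<beta> x y) \<le> norm x * norm y * K"
    using nonneg_bounded by blast
  have "bounded_linear T"
  proof (rule bounded_linear_intro[where K = K])
    show "T (x + x') = T x + T x'" for x x'
      by (rule vector_eq_rdot[THEN iffD1]) (simp add: inner_add add_left flip: T)
    show "T (r *\<^sub>R x) = r *\<^sub>R T x" for r x
      by (rule vector_eq_rdot[THEN iffD1]) (simp add: scaleR_left flip: T)
    show "norm (T x) \<le> norm x * K" for x
    proof (cases "T x = 0")
      case False
      have "(norm (T x))\<^sup>2 \<le> norm x * norm (T x) * K"
        using K(2)[of x "T x"] by (simp add: T power2_norm_eq_inner)
      then show ?thesis using False by (simp add: power2_eq_square)
    qed (use K(1) in simp)
  qed
  then show ?thesis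
    using T by (metis bounded_linear_Blinfun_apply)
qed

lemma inner_scaleC_cnj: "inner (c *\<^sub>C x) y = inner x (cnj c *\<^sub>C (y :: 'a::complex_inner))"
  by (simp add: inner_eq_Re_cinner cinner_scaleC_left cinner_scaleC_right)

lemma cinner_eq_inner: "cinner x y = Complex (inner x y) (inner x (\<i> *\<^sub>C (y :: 'a::complex_inner)))"
  by (simp add: inner_eq_Re_cinner cinner_scaleC_right complex_eq_iff)

lemma complex_opsD: "a \<in> complex_ops \<Longrightarrow> blinfun_apply a (c *\<^sub>C v) = c *\<^sub>C blinfun_apply a v"
  by (simp add: complex_ops_def)

text \<open>
  The imaginary part of \<open>\<langle>x, y\<rangle>\<close> is the real inner product of \<open>x\<close> and \<open>\<i> y\<close>, so for complex-linear
  operators the adjoint relation can be tested on the real inner product.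
\<close>

lemma is_adjointI:
  assumes "b \<in> complex_ops" "\<And>v w. inner (blinfun_apply a v) w = inner v (blinfun_apply b w)"
  shows "is_adjoint a b"
  unfolding is_adjoint_def cinner_eq_inner using assms by (simp flip: complex_opsD)

lemma ex_adjoint:
  fixes a :: "'a::complex_hilbert \<Rightarrow>\<^sub>L 'a"
  assumes "a \<in> complex_ops"
  shows "\<exists>b\<in>complex_ops. is_adjoint a b"
proof -
  have "bounded_bilinear (\<lambda>w v. inner w (blinfun_apply a v))"
    by (rule bounded_bilinear.comp[OF bounded_bilinear_inner bounded_linear_ident blinfun.bounded_linear_right])
  from bounded_bilinear_form_operator[OF this]
  obtain b where b: "\<And>w v. inner w (blinfun_apply a v) = inner (blinfun_apply b w) v"
    by blast
  have "b \<in> complex_ops"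
    unfolding complex_ops_def
  proof (intro CollectI allI)
    fix c w
    have "inner (blinfun_apply b (c *\<^sub>C w)) v = inner (c *\<^sub>C blinfun_apply b w) v" for v
      by (simp add: inner_scaleC_cnj complex_opsD[OF assms] flip: b)
    then show "blinfun_apply b (c *\<^sub>C w) = c *\<^sub>C blinfun_apply b w"
      by (rule vector_eq_rdot[THEN iffD1, rule_format]) 
  qed
  moreover from this have "is_adjoint a b"
    by (rule is_adjointI) (metis b inner_commute)
  ultimately show ?thesis by blast
qed

lemma
  fixes a :: "'a::complex_hilbert \<Rightarrow>\<^sub>L 'a"
  assumes "a \<in> complex_ops"
  shows adjoint_complex_ops: "adjoint_op a \<in> complex_ops"
    and is_adjoint_adjoint: "is_adjoint a (adjoint_op a)"
  using ex_adjoint[OF assms] adjoint_op_eqI by auto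

lemma cinner_adjoint:
  "a \<in> complex_ops \<Longrightarrow> cinner (blinfun_apply a v) w = cinner v (blinfun_apply (adjoint_op a) w)"
  using is_adjoint_adjoint by (auto simp: is_adjoint_def)

lemma cinner_adjoint':
  "a \<in> complex_ops \<Longrightarrow> cinner (blinfun_apply (adjoint_op a) v) w = cinner v (blinfun_apply a w)"
  by (metis cinner_adjoint cinner_commute)

lemma adjoint_adjoint: "a \<in> complex_ops \<Longrightarrow> adjoint_op (adjoint_op a) = a"
  by (rule adjoint_op_eqI) (simp add: is_adjoint_def cinner_adjoint')

lemma blinfun_apply_scaleC [simp]: "blinfun_apply (c *\<^sub>C a) v = c *\<^sub>C blinfun_apply a v"
  by (rule fun_cong[OF scaleC_blinfun.rep_eq])

lemma id_complex_ops: "id_blinfun \<in> complex_ops"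
  by (simp add: complex_ops_def)

lemma compose_complex_ops: "a \<in> complex_ops \<Longrightarrow> b \<in> complex_ops \<Longrightarrow> a o\<^sub>L b \<in> complex_ops"
  by (simp add: complex_ops_def)

lemma plus_complex_ops: "a \<in> complex_ops \<Longrightarrow> b \<in> complex_ops \<Longrightarrow> a + b \<in> complex_ops"
  by (simp add: complex_ops_def blinfun.add_left scaleC_add_right)

lemma scaleC_complex_ops: "a \<in> complex_ops \<Longrightarrow> c *\<^sub>C a \<in> complex_ops"
  by (simp add: complex_ops_def scaleC_scaleC mult.commute)

lemma adjoint_id: "adjoint_op id_blinfun = id_blinfun"
  by (rule adjoint_op_eqI) (simp add: is_adjoint_def)

lemma adjoint_compose:
  "a \<in> complex_ops \<Longrightarrow> b \<in> complex_ops \<Longrightarrow> adjoint_op (a o\<^sub>L b) = adjoint_op b o\<^sub>L adjoint_op a"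
  by (rule adjoint_op_eqI) (simp add: is_adjoint_def cinner_adjoint)

lemma adjoint_plus:
  "a \<in> complex_ops \<Longrightarrow> b \<in> complex_ops \<Longrightarrow> adjoint_op (a + b) = adjoint_op a + adjoint_op b"
  by (rule adjoint_op_eqI)
    (simp add: is_adjoint_def cinner_adjoint blinfun.add_left cinner_add_left cinner_add_right)

lemma adjoint_scaleC:
  "a \<in> complex_ops \<Longrightarrow> adjoint_op (c *\<^sub>C a) = cnj c *\<^sub>C adjoint_op a"
  by (rule adjoint_op_eqI)
    (simp add: is_adjoint_def cinner_adjoint cinner_scaleC_left cinner_scaleC_right)

lemma norm_adjoint_le:
  fixes a :: "'a::complex_hilbert \<Rightarrow>\<^sub>L 'a"
  assumes "a \<in> complex_ops"
  shows "norm (adjoint_op a) \<le> norm a"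
proof (rule norm_blinfun_bound)
  fix v
  let ?w = "blinfun_apply (adjoint_op a) v"
  have "(norm ?w)\<^sup>2 = inner v (blinfun_apply a ?w)"
    by (simp add: power2_norm_eq_inner inner_eq_Re_cinner cinner_adjoint'[OF assms])
  also have "\<dots> \<le> norm v * (norm a * norm ?w)"
    by (intro order_trans[OF norm_cauchy_schwarz] mult_left_mono norm_blinfun norm_ge_zero)
  finally show "norm ?w \<le> norm a * norm v"
    by (cases "?w = 0") (auto simp: power2_eq_square mult_ac)
qed simp

lemma norm_adjoint_diff_le:
  fixes a b :: "'a::complex_hilbert \<Rightarrow>\<^sub>L 'a"
  assumes "a \<in> complex_ops" "b \<in> complex_ops"
  shows "norm (adjoint_op a - adjoint_op b) \<le> norm (a - b)"
proof -
  have m: "- 1 *\<^sub>C c = - c" for c :: "'a \<Rightarrow>\<^sub>L 'a"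
    by (rule blinfun_eqI) (metis blinfun_apply_scaleC blinfun.minus_left complex_vector.scale_minus_left scaleC_one)
  have "adjoint_op a - adjoint_op b = adjoint_op (a + (- 1) *\<^sub>C b)"
    using assms by (simp only: adjoint_plus adjoint_scaleC scaleC_complex_ops) (simp add: m)
  also have "norm \<dots> \<le> norm (a + (- 1) *\<^sub>C b)"
    using assms by (intro norm_adjoint_le plus_complex_ops scaleC_complex_ops)
  finally show ?thesis by (simp add: m)
qed

lemma closed_complex_ops: "closed (complex_ops :: ('a::complex_inner \<Rightarrow>\<^sub>L 'a) set)"
proof -
  have "closed {a :: 'a \<Rightarrow>\<^sub>L 'a. blinfun_apply a (c *\<^sub>C v) = c *\<^sub>C blinfun_apply a v}" for c v
  proof (rule closed_Collect_eq)
    have app: "bounded_linear (\<lambda>a :: 'a \<Rightarrow>\<^sub>L 'a. blinfun_apply a v)" for v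
      by (rule blinfun.bounded_linear_left)
    show "continuous_on UNIV (\<lambda>a :: 'a \<Rightarrow>\<^sub>L 'a. blinfun_apply a (c *\<^sub>C v))"
      by (intro linear_continuous_on app)
    show "continuous_on UNIV (\<lambda>a :: 'a \<Rightarrow>\<^sub>L 'a. c *\<^sub>C blinfun_apply a v)"
      by (rule linear_continuous_on) (rule bounded_linear_compose[OF bounded_linear_scaleC_right app])
  qed
  moreover have "complex_ops = (\<Inter>c. \<Inter>v. {a :: 'a \<Rightarrow>\<^sub>L 'a. blinfun_apply a (c *\<^sub>C v) = c *\<^sub>C blinfun_apply a v})"
    by (auto simp: complex_ops_def)
  ultimately show ?thesis
    by (metis (no_types, lifting) closed_INT)
qed


section \<open>Compact operators\<close>

text \<open>
  The finite net is chosen inside the unit ball of the domain, so that a net found for one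
  operator can serve for another one.
\<close>

lemma compact_op_iff_totally_bounded:
  fixes a :: "'a::real_normed_vector \<Rightarrow>\<^sub>L 'b::banach"
  shows "compact_op a \<longleftrightarrow>
    (\<forall>e>0. \<exists>k. finite k \<and> k \<subseteq> cball 0 1 \<and> (\<forall>v\<in>cball 0 1. \<exists>w\<in>k. norm (blinfun_apply a v - blinfun_apply a w) < e))"
    (is "_ \<longleftrightarrow> ?R")
proof
  assume c: "compact_op a"
  show ?R
  proof (intro allI impI)
    fix e :: real assume e: "e > 0"
    then obtain k where k: "finite k" "closure (blinfun_apply a ` cball 0 1) \<subseteq> (\<Union>x\<in>k. ball x (e/2))"
      using c unfolding compact_op_def compact_eq_totally_bounded by (meson half_gt_zero)
    define P where "P x v \<longleftrightarrow> v \<in> cball 0 1 \<and> blinfun_apply a v \<in> ball x (e/2)" for x v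
    define k' where "k' = (\<lambda>x. SOME v. P x v) ` {x\<in>k. \<exists>v. P x v}"
    show "\<exists>k. finite k \<and> k \<subseteq> cball 0 1 \<and> (\<forall>v\<in>cball 0 1. \<exists>w\<in>k. norm (blinfun_apply a v - blinfun_apply a w) < e)"
    proof (intro exI conjI ballI)
      show "finite k'" using k(1) by (simp add: k'_def)
      show "k' \<subseteq> cball 0 1"
      proof
        fix w assume "w \<in> k'"
        then obtain x where "\<exists>v. P x v" "w = (SOME v. P x v)" by (auto simp: k'_def)
        then have "P x w" using someI_ex by metis
        then show "w \<in> cball 0 1" by (simp add: P_def)
      qed
      fix v :: 'a assume v: "v \<in> cball 0 1"
      then have "blinfun_apply a v \<in> (\<Union>x\<in>k. ball x (e/2))"
        using subsetD[OF k(2) subsetD[OF closure_subset imageI]] by blast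
      then obtain x where x: "x \<in> k" "P x v" using v by (auto simp: P_def)
      define w where "w = (SOME v. P x v)"
      have "P x w" unfolding w_def using x(2) by (rule someI)
      then have "dist (blinfun_apply a v) (blinfun_apply a w) < e"
        using x(2) unfolding P_def by (metis dist_triangle_half_r mem_ball)
      moreover have "w \<in> k'" using x by (auto simp: k'_def w_def)
      ultimately show "\<exists>w\<in>k'. norm (blinfun_apply a v - blinfun_apply a w) < e"
        by (auto simp: dist_norm)
    qed
  qed
next
  assume R: ?R
  show "compact_op a"
    unfolding compact_op_def compact_eq_totally_bounded
  proof (intro conjI allI impI)
    show "complete (closure (blinfun_apply a ` cball 0 1))"
      by (simp add: complete_eq_closed)
    fix e :: real assume e: "e > 0"
    then obtain k where k: "finite k" "\<forall>v\<in>cball 0 1. \<exists>w\<in>k. norm (blinfun_apply a v - blinfun_apply a w) < e/2"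
      using R by (meson half_gt_zero)
    have "closure (blinfun_apply a ` cball 0 1) \<subseteq> (\<Union>x\<in>blinfun_apply a ` k. ball x e)"
    proof
      fix y assume "y \<in> closure (blinfun_apply a ` cball 0 1)"
      then obtain v where v: "v \<in> cball 0 1" "dist (blinfun_apply a v) y < e/2"
        using e unfolding closure_approachable by (metis half_gt_zero image_iff)
      then obtain w where w: "w \<in> k" "dist (blinfun_apply a v) (blinfun_apply a w) < e/2"
        using k(2) unfolding dist_norm by blast
      have "dist (blinfun_apply a w) y < e"
        using v(2) w(2) by (metis dist_commute dist_triangle_half_l)
      then show "y \<in> (\<Union>x\<in>blinfun_apply a ` k. ball x e)" using w(1) by auto
    qed
    then show "\<exists>k. finite k \<and> closure (blinfun_apply a ` cball 0 1) \<subseteq> (\<Union>x\<in>k. ball x e)"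
      using k(1) by blast
  qed
qed

lemma compact_op_approx:
  fixes a :: "'a::real_normed_vector \<Rightarrow>\<^sub>L 'b::banach"
  assumes "\<And>e. e > 0 \<Longrightarrow> \<exists>b. compact_op b \<and> norm (a - b) < e"
  shows "compact_op a"
  unfolding compact_op_iff_totally_bounded
proof (intro allI impI)
  fix e :: real assume "e > 0"
  then obtain b where b: "compact_op b" "norm (a - b) < e / 3"
    using assms[of "e/3"] by auto
  have close: "norm (blinfun_apply a v - blinfun_apply b v) < e/3" if "v \<in> cball 0 1" for v
  proof -
    have "norm (blinfun_apply (a - b) v) \<le> norm (a - b) * norm v" by (rule norm_blinfun)
    also have "\<dots> \<le> norm (a - b)" using that by (simp add: mult_left_le)
    finally show ?thesis using b(2) by (simp add: blinfun.diff_left)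
  qed
  obtain k where k: "finite k" "k \<subseteq> cball 0 1"
    "\<forall>v\<in>cball 0 1. \<exists>w\<in>k. norm (blinfun_apply b v - blinfun_apply b w) < e/3"
    using b(1) \<open>e > 0\<close> unfolding compact_op_iff_totally_bounded by (metis zero_less_divide_iff zero_less_numeral)
  have "\<exists>w\<in>k. norm (blinfun_apply a v - blinfun_apply a w) < e" if v: "v \<in> cball 0 1" for v
  proof -
    obtain w where w: "w \<in> k" "norm (blinfun_apply b v - blinfun_apply b w) < e/3" using k(3) v by blast
    have "blinfun_apply a v - blinfun_apply a w = (blinfun_apply a v - blinfun_apply b v)
      + (blinfun_apply b v - blinfun_apply b w) + - (blinfun_apply a w - blinfun_apply b w)" by simp
    also have "norm \<dots> \<le> norm (blinfun_apply a v - blinfun_apply b v)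
      + norm (blinfun_apply b v - blinfun_apply b w) + norm (blinfun_apply a w - blinfun_apply b w)"
      by (intro norm_triangle_le add_mono order_refl) (simp_all only: norm_minus_cancel order_refl)
    also have "\<dots> < e" using close[OF v] close[of w] w k(2) by fastforce
    finally show ?thesis using w(1) by blast
  qed
  then show "\<exists>k. finite k \<and> k \<subseteq> cball 0 1 \<and> (\<forall>v\<in>cball 0 1. \<exists>w\<in>k. norm (blinfun_apply a v - blinfun_apply a w) < e)"
    using k by blast
qed

lemma compact_op_zero: "compact_op (0 :: 'a::real_normed_vector \<Rightarrow>\<^sub>L 'b::banach)"
  unfolding compact_op_iff_totally_bounded by (auto intro!: exI[of _ "{0}"])

lemma compact_closure_subset:
  fixes K :: "'a::metric_space set"
  assumes "compact K" "S \<subseteq> K"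
  shows "compact (closure S)"
proof -
  have "closure S \<subseteq> K"
    using assms by (intro closure_minimal compact_imp_closed)
  then have "K \<inter> closure S = closure S" by blast
  then show ?thesis
    using compact_Int_closed[OF assms(1) closed_closure, of S] by simp
qed

lemma compact_op_plus:
  fixes a b :: "'a::real_normed_vector \<Rightarrow>\<^sub>L 'b::banach"
  assumes "compact_op a" "compact_op b"
  shows "compact_op (a + b)"
proof -
  let ?A = "closure (blinfun_apply a ` cball 0 1)" and ?B = "closure (blinfun_apply b ` cball 0 1)"
  have "compact {x + y |x y. x \<in> ?A \<and> y \<in> ?B}"
    using assms by (intro compact_sums) (simp_all add: compact_op_def)
  moreover have "blinfun_apply (a + b) ` cball 0 1 \<subseteq> {x + y |x y. x \<in> ?A \<and> y \<in> ?B}"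
  proof
    fix z assume "z \<in> blinfun_apply (a + b) ` cball 0 1"
    then obtain v where v: "v \<in> cball 0 1" "z = blinfun_apply a v + blinfun_apply b v"
      by (auto simp: blinfun.add_left)
    have "blinfun_apply a v \<in> ?A" "blinfun_apply b v \<in> ?B"
      by (rule subsetD[OF closure_subset imageI[OF v(1)]])+
    then show "z \<in> {x + y |x y. x \<in> ?A \<and> y \<in> ?B}" using v(2) by blast
  qed
  ultimately show ?thesis
    unfolding compact_op_def
    by (rule compact_closure_subset)
qed

lemma compact_op_compose_left:
  fixes a :: "'a::real_normed_vector \<Rightarrow>\<^sub>L 'b::banach" and b :: "'b \<Rightarrow>\<^sub>L 'c::banach"
  assumes "compact_op a"
  shows "compact_op (b o\<^sub>L a)"
proof -
  let ?A = "closure (blinfun_apply a ` cball 0 1)"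
  have "compact (blinfun_apply b ` ?A)"
    using assms by (intro compact_continuous_image linear_continuous_on blinfun.bounded_linear_right) (simp add: compact_op_def)
  moreover have "blinfun_apply (b o\<^sub>L a) ` cball 0 1 \<subseteq> blinfun_apply b ` ?A"
    using closure_subset[of "blinfun_apply a ` cball 0 1"] by auto
  ultimately show ?thesis
    unfolding compact_op_def
    by (rule compact_closure_subset)
qed

lemma compact_op_compose_right:
  fixes a :: "'b::banach \<Rightarrow>\<^sub>L 'c::banach" and b :: "'a::real_normed_vector \<Rightarrow>\<^sub>L 'b"
  assumes "compact_op a"
  shows "compact_op (a o\<^sub>L b)"
proof -
  define r where "r = norm b + 1"
  have r: "r > 0" by (simp add: r_def add_nonneg_pos)
  let ?A = "closure (blinfun_apply a ` cball 0 1)"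
  have "compact ((\<lambda>x. r *\<^sub>R x) ` ?A)"
    using assms by (intro compact_continuous_image continuous_intros) (simp add: compact_op_def)
  moreover have "blinfun_apply (a o\<^sub>L b) ` cball 0 1 \<subseteq> (\<lambda>x. r *\<^sub>R x) ` ?A"
  proof
    fix y assume "y \<in> blinfun_apply (a o\<^sub>L b) ` cball 0 1"
    then obtain v where v: "norm v \<le> 1" "y = blinfun_apply a (blinfun_apply b v)" by auto
    define w where "w = (1/r) *\<^sub>R blinfun_apply b v"
    have "norm (blinfun_apply b v) \<le> norm b * norm v" by (rule norm_blinfun)
    also have "\<dots> \<le> r" using v(1) by (simp add: r_def mult_left_le add_increasing2)
    finally have "norm w \<le> 1" using r by (simp add: w_def)
    then have "blinfun_apply a w \<in> ?A"
      by (intro subsetD[OF closure_subset imageI]) simp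
    moreover have "y = r *\<^sub>R blinfun_apply a w" using r v(2) by (simp add: w_def blinfun.scaleR_right)
    ultimately show "y \<in> (\<lambda>x. r *\<^sub>R x) ` ?A" by blast
  qed
  ultimately show ?thesis
    unfolding compact_op_def
    by (rule compact_closure_subset)
qed

lemma compact_op_scaleC:
  fixes a :: "'a::real_normed_vector \<Rightarrow>\<^sub>L 'b::complex_hilbert"
  assumes "compact_op a"
  shows "compact_op (c *\<^sub>C a)"
proof -
  have "c *\<^sub>C a = (c *\<^sub>C id_blinfun) o\<^sub>L a"
    by (rule blinfun_eqI) simp
  then show ?thesis using compact_op_compose_left[OF assms] by metis
qed

lemma compact_op_sum:
  fixes a :: "'i \<Rightarrow> 'a::real_normed_vector \<Rightarrow>\<^sub>L 'b::banach"
  shows "(\<And>i. i \<in> I \<Longrightarrow> compact_op (a i)) \<Longrightarrow> compact_op (\<Sum>i\<in>I. a i)"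
  by (induction I rule: infinite_finite_induct) (auto intro: compact_op_zero compact_op_plus)

text \<open>
  As \<open>\<parallel>a\<^sup>* z\<parallel>\<^sup>2 = \<langle>z, a a\<^sup>* z\<rangle>\<close>, a fine net for the compact operator \<open>a a\<^sup>*\<close> is a net for \<open>a\<^sup>*\<close>.
\<close>

lemma compact_op_adjoint:
  fixes a :: "'a::complex_hilbert \<Rightarrow>\<^sub>L 'a"
  assumes a: "a \<in> complex_ops" and c: "compact_op a"
  shows "compact_op (adjoint_op a)"
  unfolding compact_op_iff_totally_bounded
proof (intro allI impI)
  fix e :: real assume e: "e > 0"
  have "compact_op (a o\<^sub>L adjoint_op a)" by (rule compact_op_compose_right[OF c])
  moreover have "e\<^sup>2 / 2 > 0" using e by simp
  ultimately obtain k where k: "finite k" "k \<subseteq> cball 0 1" 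
    "\<forall>v\<in>cball 0 1. \<exists>w\<in>k. norm (blinfun_apply (a o\<^sub>L adjoint_op a) v - blinfun_apply (a o\<^sub>L adjoint_op a) w) < e\<^sup>2 / 2"
    unfolding compact_op_iff_totally_bounded by metis
  have "norm (blinfun_apply (adjoint_op a) v - blinfun_apply (adjoint_op a) w) < e"
    if v: "v \<in> cball 0 1" and w: "w \<in> cball 0 1"
      and less: "norm (blinfun_apply (a o\<^sub>L adjoint_op a) v - blinfun_apply (a o\<^sub>L adjoint_op a) w) < e\<^sup>2 / 2" for v w
  proof -
    define z where "z = v - w"
    have "norm z \<le> norm v + norm w" unfolding z_def by (rule norm_triangle_ineq4)
    then have z: "norm z \<le> 2" using v w by simp
    have less: "norm (blinfun_apply a (blinfun_apply (adjoint_op a) z)) < e\<^sup>2 / 2"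
      using less by (simp add: z_def blinfun.diff_right)
    have "(norm (blinfun_apply (adjoint_op a) z))\<^sup>2 = inner z (blinfun_apply a (blinfun_apply (adjoint_op a) z))"
      by (simp add: power2_norm_eq_inner inner_eq_Re_cinner cinner_adjoint'[OF a])
    also have "\<dots> \<le> norm z * norm (blinfun_apply a (blinfun_apply (adjoint_op a) z))"
      by (rule norm_cauchy_schwarz)
    also have "\<dots> \<le> 2 * norm (blinfun_apply a (blinfun_apply (adjoint_op a) z))"
      using z by (intro mult_right_mono) auto
    also have "\<dots> < e\<^sup>2" using less by simp
    finally have "norm (blinfun_apply (adjoint_op a) z) < e"
      using e by (simp add: power_less_imp_less_base)
    then show ?thesis by (simp add: z_def blinfun.diff_right)
  qed
  then show "\<exists>k. finite k \<and> k \<subseteq> cball 0 1 \<and> (\<forall>v\<in>cball 0 1. \<exists>w\<in>k. norm (blinfun_apply (adjoint_op a) v - blinfun_apply (adjoint_op a) w) < e)"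
    using k by (meson subsetD)
qed


section \<open>Matrix entries\<close>

lemma cinner_delta_left: "cinner (delta x \<xi>) f = cinner \<xi> (ell2_apply f x)"
  by (metis cinner_commute cinner_delta_right)

lemma ell2_apply_add [simp]: "ell2_apply (f + g) x = ell2_apply f x + ell2_apply g x"
  by (simp add: plus_ell2.rep_eq)

lemma ell2_apply_zero [simp]: "ell2_apply 0 x = 0"
  by (simp add: zero_ell2.rep_eq)

lemma ell2_apply_scaleC [simp]: "ell2_apply (c *\<^sub>C f) x = c *\<^sub>C ell2_apply f x"
  by (simp add: scaleC_ell2.rep_eq)

lemma ell2_apply_sum: "ell2_apply (\<Sum>i\<in>I. f i) x = (\<Sum>i\<in>I. ell2_apply (f i) x)"
  by (induction I rule: infinite_finite_induct) auto

lemma ell2_apply_delta: "ell2_apply (delta x \<xi>) y = (if y = x then \<xi> else 0)"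
  by (simp add: delta.rep_eq)

lemma delta_scaleC: "delta x (c *\<^sub>C \<xi>) = c *\<^sub>C delta x \<xi>"
  by (rule ell2_eqI) (simp add: ell2_apply_delta)

lemma ell2_finite_support:
  assumes "finite A" "\<And>z. z \<notin> A \<Longrightarrow> ell2_apply v z = 0"
  shows "v = (\<Sum>z\<in>A. delta z (ell2_apply v z))"
proof (rule ell2_eqI)
  fix y
  show "ell2_apply v y = ell2_apply (\<Sum>z\<in>A. delta z (ell2_apply v z)) y"
    using assms by (cases "y \<in> A") (auto simp: ell2_apply_sum ell2_apply_delta sum.delta intro!: sum.neutral[symmetric])
qed

lemma entry_complex_ops: "a \<in> complex_ops \<Longrightarrow> entry a x y \<in> complex_ops"
  by (simp add: complex_ops_def entry_apply delta_scaleC)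

lemma entry_adjoint:
  fixes a :: "('x, 'h::complex_hilbert) ell2_op"
  assumes "a \<in> complex_ops"
  shows "entry (adjoint_op a) y x = adjoint_op (entry a x y)"
proof (rule adjoint_op_eqI[symmetric])
  show "is_adjoint (entry a x y) (entry (adjoint_op a) y x)"
    unfolding is_adjoint_def entry_apply
    by (simp add: cinner_adjoint[OF assms] flip: cinner_delta_left cinner_delta_right)
qed

lemma entry_plus: "entry (a + b) x y = entry a x y + entry b x y"
  by (rule blinfun_eqI) (simp add: entry_apply blinfun.add_left)

lemma entry_diff: "entry (a - b) x y = entry a x y - entry b x y"
  by (rule blinfun_eqI) (simp add: entry_apply blinfun.diff_left ell2_apply_diff)

lemma entry_scaleC: "entry (c *\<^sub>C a) x y = c *\<^sub>C entry a x y"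
  by (rule blinfun_eqI) (simp add: entry_apply)

lemma norm_entry_le: "norm (entry a x y) \<le> norm a"
proof (rule norm_blinfun_bound)
  fix \<xi>
  have "norm (blinfun_apply (entry a x y) \<xi>) \<le> norm (blinfun_apply a (delta x \<xi>))"
    unfolding entry_apply by (rule ell2_apply_norm_le)
  also have "\<dots> \<le> norm a * norm \<xi>"
    using norm_blinfun[of a "delta x \<xi>"] by (simp add: norm_delta)
  finally show "norm (blinfun_apply (entry a x y) \<xi>) \<le> norm a * norm \<xi>" .
qed simp

text \<open>
  Matrix multiplication, in the case where the column of \<open>b\<close> at \<open>x\<close> is finitely supported: then
  \<open>b (\<delta>\<^sub>x \<otimes> \<xi>)\<close> is a finite sum of vectors \<open>\<delta>\<^sub>z \<otimes> \<eta>\<close>.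
\<close>

lemma entry_compose:
  assumes "finite A" "\<And>z. z \<notin> A \<Longrightarrow> entry b x z = 0"
  shows "entry (a o\<^sub>L b) x y = (\<Sum>z\<in>A. entry a z y o\<^sub>L entry b x z)"
proof (rule blinfun_eqI)
  fix \<xi>
  have "blinfun_apply b (delta x \<xi>) = (\<Sum>z\<in>A. delta z (ell2_apply (blinfun_apply b (delta x \<xi>)) z))"
    using assms by (intro ell2_finite_support) (simp_all flip: entry_apply)
  then have "blinfun_apply a (blinfun_apply b (delta x \<xi>)) =
      (\<Sum>z\<in>A. blinfun_apply a (delta z (ell2_apply (blinfun_apply b (delta x \<xi>)) z)))"
    by (metis (no_types, lifting) blinfun.sum_right sum.cong)
  then show "blinfun_apply (entry (a o\<^sub>L b) x y) \<xi> = blinfun_apply (\<Sum>z\<in>A. entry a z y o\<^sub>L entry b x z) \<xi>"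
    by (simp add: entry_apply blinfun.sum_left ell2_apply_sum)
qed


section \<open>Supports of operators\<close>

text \<open>
  Supports are relations rather than propagation bounds because the unitaries that implement
  coarse maps live near the graph of the map and not near the diagonal.
\<close>

definition supported_in :: "('x, 'h::complex_hilbert) ell2_op \<Rightarrow> ('x \<times> 'x) set \<Rightarrow> bool"
  where "supported_in a E \<longleftrightarrow> a \<in> complex_ops \<and> (\<forall>x y. (x, y) \<notin> E \<longrightarrow> entry a x y = 0)"

lemma supported_in_mono: "supported_in a E \<Longrightarrow> E \<subseteq> F \<Longrightarrow> supported_in a F"
  by (auto simp: supported_in_def)

lemma supported_in_plus: "supported_in a E \<Longrightarrow> supported_in b F \<Longrightarrow> supported_in (a + b) (E \<union> F)"
  by (auto simp: supported_in_def plus_complex_ops entry_plus)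

lemma supported_in_scaleC: "supported_in a E \<Longrightarrow> supported_in (c *\<^sub>C a) E"
proof -
  have "c *\<^sub>C (0 :: 'b \<Rightarrow>\<^sub>L 'b) = 0" by (rule blinfun_eqI) simp
  then show "supported_in a E \<Longrightarrow> supported_in (c *\<^sub>C a) E"
    by (auto simp: supported_in_def entry_scaleC scaleC_complex_ops)
qed

lemma adjoint_zero: "adjoint_op 0 = 0"
  by (rule adjoint_op_eqI) (simp add: is_adjoint_def)

lemma supported_in_adjoint:
  assumes "supported_in a E"
  shows "supported_in (adjoint_op a) (E\<inverse>)"
  using assms by (auto simp: supported_in_def adjoint_complex_ops entry_adjoint adjoint_zero)

lemma supported_in_compose:
  assumes a: "supported_in a E" and b: "supported_in b F" and fin: "\<And>x. finite (F `` {x})"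
  shows "supported_in (a o\<^sub>L b) (F O E)"
  unfolding supported_in_def
proof (intro conjI allI impI)
  show "a o\<^sub>L b \<in> complex_ops"
    using a b by (simp add: supported_in_def compose_complex_ops)
  fix x y assume "(x, y) \<notin> F O E"
  show "entry (a o\<^sub>L b) x y = 0"
  proof (rule ccontr)
    assume nz: "entry (a o\<^sub>L b) x y \<noteq> 0"
    have "entry (a o\<^sub>L b) x y = (\<Sum>z\<in>F `` {x}. entry a z y o\<^sub>L entry b x z)"
      using b by (intro entry_compose fin) (auto simp: supported_in_def)
    with nz obtain z where "z \<in> F `` {x}" "entry a z y o\<^sub>L entry b x z \<noteq> 0"
      by (metis (no_types, lifting) sum.neutral)
    then have "(x, z) \<in> F" "entry a z y \<noteq> 0"
      by auto
    then have "(x, z) \<in> F" "(z, y) \<in> E"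
      using a unfolding supported_in_def by blast+
    then show False using \<open>(x, y) \<notin> F O E\<close> by blast
  qed
qed

definition compact_entries :: "('x, 'h::complex_hilbert) ell2_op \<Rightarrow> bool"
  where "compact_entries a \<longleftrightarrow> a \<in> complex_ops \<and> (\<forall>x y. compact_op (entry a x y))"

lemma compact_entries_plus:
  "compact_entries a \<Longrightarrow> compact_entries b \<Longrightarrow> compact_entries (a + b)"
  by (simp add: compact_entries_def plus_complex_ops entry_plus compact_op_plus)

lemma compact_entries_scaleC: "compact_entries a \<Longrightarrow> compact_entries (c *\<^sub>C a)"
  by (simp add: compact_entries_def scaleC_complex_ops entry_scaleC compact_op_scaleC)

lemma compact_entries_adjoint: "compact_entries a \<Longrightarrow> compact_entries (adjoint_op a)"
  by (simp add: compact_entries_def adjoint_complex_ops entry_adjoint compact_op_adjoint entry_complex_ops)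

lemma compact_entries_compose_right:
  assumes a: "compact_entries a" and c: "supported_in c F" and fin: "\<And>x. finite (F `` {x})"
  shows "compact_entries (a o\<^sub>L c)"
  unfolding compact_entries_def
proof (intro conjI allI)
  show "a o\<^sub>L c \<in> complex_ops"
    using a c by (simp add: supported_in_def compact_entries_def compose_complex_ops)
  fix x y
  have "entry (a o\<^sub>L c) x y = (\<Sum>z\<in>F `` {x}. entry a z y o\<^sub>L entry c x z)"
    using c by (intro entry_compose fin) (auto simp: supported_in_def)
  then show "compact_op (entry (a o\<^sub>L c) x y)"
    using a by (simp add: compact_entries_def compact_op_sum compact_op_compose_right)
qed

text \<open>Taking adjoints exchanges the two sides.\<close>

lemma compact_entries_compose_left:
  assumes a: "compact_entries a" and c: "supported_in c E" and fin: "\<And>y. finite (E\<inverse> `` {y})"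
  shows "compact_entries (c o\<^sub>L a)"
proof -
  have ops: "a \<in> complex_ops" "c \<in> complex_ops"
    using a c by (auto simp: compact_entries_def supported_in_def)
  have "compact_entries (adjoint_op a o\<^sub>L adjoint_op c)"
    using compact_entries_adjoint[OF a] supported_in_adjoint[OF c] fin
    by (rule compact_entries_compose_right)
  then have "compact_entries (adjoint_op (adjoint_op a o\<^sub>L adjoint_op c))"
    by (rule compact_entries_adjoint)
  then show ?thesis
    using ops by (simp add: adjoint_compose adjoint_adjoint adjoint_complex_ops)
qed

lemma compact_entries_limit:
  assumes "a \<in> complex_ops" "\<And>e. e > 0 \<Longrightarrow> \<exists>b. compact_entries b \<and> norm (a - b) < e"
  shows "compact_entries a"
  unfolding compact_entries_def
proof (intro conjI allI)
  show "a \<in> complex_ops" by fact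
  fix x y
  show "compact_op (entry a x y)"
  proof (rule compact_op_approx)
    fix e :: real assume "e > 0"
    then obtain b where b: "compact_entries b" "norm (a - b) < e" using assms(2) by blast
    have "norm (entry a x y - entry b x y) < e"
      using norm_entry_le[of "a - b" x y] b(2) by (simp add: entry_diff)
    then show "\<exists>b. compact_op b \<and> norm (entry a x y - b) < e"
      using b(1) by (auto simp: compact_entries_def)
  qed
qed


section \<open>Band-dominated operators and the Roe algebra of the integers\<close>

definition near :: "int \<Rightarrow> (int \<times> int) set"
  where "near r = {(m, n). \<bar>m - n\<bar> \<le> r}"

lemma near_mono: "r \<le> s \<Longrightarrow> near r \<subseteq> near s"
  by (auto simp: near_def)

lemma near_comp: "near r O near s \<subseteq> near (r + s)"
  by (auto simp: near_def)

lemma near_converse [simp]: "(near r)\<inverse> = near r"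
  by (auto simp: near_def)

lemma finite_near [simp]: "finite (near r `` {x})"
  by (rule finite_subset[of _ "{x - r..x + r}"]) (auto simp: near_def)

lemma finite_propagation_iff:
  fixes a :: "(int, 'h::complex_hilbert) ell2_op"
  shows "a \<in> complex_ops \<and> propagation a < \<infinity> \<longleftrightarrow> (\<exists>r. supported_in a (near r))"
proof (intro iffI conjI)
  assume a: "a \<in> complex_ops \<and> propagation a < \<infinity>"
  then obtain n :: nat where n: "propagation a \<le> of_nat n"
    using ennreal_Ex_less_of_nat[of "propagation a"] by (auto dest: less_imp_le)
  have "\<bar>x - y\<bar> \<le> int n" if "entry a x y \<noteq> 0" for x y
  proof -
    have "ennreal (dist x y) \<le> propagation a"
      unfolding propagation_def using that by (intro SUP_upper2[of "(x, y)"]) auto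
    then have "ennreal (dist x y) \<le> ennreal (real n)"
      using n unfolding ennreal_of_nat_eq_real_of_nat by (rule order_trans)
    then have "dist x y \<le> real n" by (simp add: ennreal_le_iff)
    then show ?thesis by (simp add: dist_int_def)
  qed
  then show "\<exists>r. supported_in a (near r)"
    using a unfolding supported_in_def near_def by (intro exI[of _ "int n"]) auto
next
  assume "\<exists>r. supported_in a (near r)"
  then obtain r where r: "supported_in a (near r)" by blast
  then show "a \<in> complex_ops" by (simp add: supported_in_def)
  have "propagation a \<le> ennreal (real_of_int r)"
    unfolding propagation_def using r
    by (intro SUP_least) (force simp: supported_in_def near_def dist_int_def intro!: ennreal_leI)
  then show "propagation a < \<infinity>"
    by (metis ennreal_less_top infinity_ennreal_def order_le_less_trans)
qed

text \<open>
  The complex-linear operators form a closed set, so passing to the closure does not leave it.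
\<close>

lemma BD_iff:
  fixes a :: "(int, 'h::complex_hilbert) ell2_op"
  shows "a \<in> BD \<longleftrightarrow> a \<in> complex_ops \<and> (\<forall>e>0. \<exists>b r. supported_in b (near r) \<and> norm (a - b) < e)"
proof -
  have "{a \<in> complex_ops. propagation a < \<infinity>} = {a :: (int, 'h) ell2_op. \<exists>r. supported_in a (near r)}"
    using finite_propagation_iff by blast
  then have "a \<in> BD \<longleftrightarrow> (\<forall>e>0. \<exists>b r. supported_in b (near r) \<and> norm (a - b) < e)"
    by (auto simp: BD_def closure_approachable dist_norm norm_minus_commute)
  moreover have "BD \<subseteq> (complex_ops :: (int, 'h) ell2_op set)"
    unfolding BD_def by (rule closure_minimal[OF _ closed_complex_ops]) auto
  ultimately show ?thesis by blast
qed

lemma BD_complex_ops: "a \<in> BD \<Longrightarrow> a \<in> complex_ops"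
  for a :: "(int, 'h::complex_hilbert) ell2_op"
  by (simp add: BD_iff)

lemma BD_approx:
  fixes a :: "(int, 'h::complex_hilbert) ell2_op"
  assumes "a \<in> BD" "e > 0"
  obtains b r where "supported_in b (near r)" "norm (a - b) < e"
  using assms BD_iff by blast

lemma supported_near_BD: "supported_in a (near r) \<Longrightarrow> a \<in> BD"
  unfolding BD_iff supported_in_def by (auto intro!: exI[of _ a])

lemma BD_I_limit:
  fixes a :: "(int, 'h::complex_hilbert) ell2_op"
  assumes "a \<in> complex_ops" "\<And>e. e > 0 \<Longrightarrow> \<exists>b\<in>BD. norm (a - b) < e"
  shows "a \<in> BD"
proof -
  have "a \<in> closure BD"
    unfolding closure_approachable using assms(2) by (metis dist_norm norm_minus_commute)
  then show ?thesis by (simp add: BD_def)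
qed

lemma BD_plus:
  fixes a b :: "(int, 'h::complex_hilbert) ell2_op"
  assumes "a \<in> BD" "b \<in> BD"
  shows "a + b \<in> BD"
  unfolding BD_iff
proof (intro conjI allI impI)
  show "a + b \<in> complex_ops" using assms by (simp add: BD_complex_ops plus_complex_ops)
  fix e :: real assume "e > 0"
  obtain a' r where a': "supported_in a' (near r)" "norm (a - a') < e/2"
    using BD_approx[OF assms(1)] \<open>e > 0\<close> by (metis half_gt_zero)
  obtain b' s where b': "supported_in b' (near s)" "norm (b - b') < e/2"
    using BD_approx[OF assms(2)] \<open>e > 0\<close> by (metis half_gt_zero)
  have "supported_in (a' + b') (near (max r s))"
    by (rule supported_in_mono[OF supported_in_plus[OF a'(1) b'(1)]]) (simp add: near_mono)
  moreover have "norm (a + b - (a' + b')) < e"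
    using a'(2) b'(2) norm_triangle_ineq[of "a - a'" "b - b'"] by (simp add: algebra_simps)
  ultimately show "\<exists>b'' r. supported_in b'' (near r) \<and> norm (a + b - b'') < e" by blast
qed

lemma BD_compose:
  fixes a b :: "(int, 'h::complex_hilbert) ell2_op"
  assumes "a \<in> BD" "b \<in> BD"
  shows "a o\<^sub>L b \<in> BD"
proof (rule BD_I_limit)
  show "a o\<^sub>L b \<in> complex_ops" using assms by (simp add: BD_complex_ops compose_complex_ops)
  fix e :: real assume "e > 0"
  define K where "K = norm a + norm b + 1"
  have K: "K > 0" "norm a \<le> K" "norm b + 1 \<le> K" by (auto simp: K_def add_nonneg_pos add.assoc)
  define d where "d = min 1 (e / (2 * K))"
  have d: "d > 0" "d \<le> 1" "d \<le> e / (2 * K)" using \<open>e > 0\<close> K by (auto simp: d_def)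
  obtain a' r where a': "supported_in a' (near r)" "norm (a - a') < d"
    using BD_approx[OF assms(1) d(1)] by blast
  obtain b' s where b': "supported_in b' (near s)" "norm (b - b') < d"
    using BD_approx[OF assms(2) d(1)] by blast
  have "supported_in (a' o\<^sub>L b') (near (s + r))"
    by (rule supported_in_mono[OF supported_in_compose[OF a'(1) b'(1)] near_comp]) simp
  then have "a' o\<^sub>L b' \<in> BD" by (rule supported_near_BD)
  moreover have "norm ((a o\<^sub>L b) - (a' o\<^sub>L b')) < e"
  proof -
    have nb': "norm b' \<le> K"
      using b'(2) d K norm_triangle_ineq4[of b "b - b'"] by simp
    have "(a o\<^sub>L b) - (a' o\<^sub>L b') = (a o\<^sub>L (b - b')) + ((a - a') o\<^sub>L b')"
      by (rule blinfun_eqI) (simp add: blinfun.diff_left blinfun.add_left blinfun.diff_right)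
    also have "norm \<dots> \<le> norm a * norm (b - b') + norm (a - a') * norm b'"
      by (intro norm_triangle_le add_mono norm_blinfun_compose)
    also have "\<dots> \<le> K * norm (b - b') + d * K"
      using K nb' a'(2) d(1) by (intro add_mono mult_mono) auto
    also have "\<dots> < K * d + d * K"
      using K b'(2) by simp
    also have "\<dots> \<le> e" using d(3) K by (simp add: field_simps)
    finally show ?thesis .
  qed
  ultimately show "\<exists>c\<in>BD. norm ((a o\<^sub>L b) - c) < e" by blast
qed

lemma BD_adjoint:
  fixes a :: "(int, 'h::complex_hilbert) ell2_op"
  assumes "a \<in> BD"
  shows "adjoint_op a \<in> BD"
  unfolding BD_iff
proof (intro conjI allI impI)
  have a: "a \<in> complex_ops" by (rule BD_complex_ops[OF assms])
  show "adjoint_op a \<in> complex_ops" by (rule adjoint_complex_ops[OF a])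
  fix e :: real assume "e > 0"
  then obtain b r where b: "supported_in b (near r)" "norm (a - b) < e"
    using BD_approx[OF assms] by blast
  have "norm (adjoint_op a - adjoint_op b) < e"
    using norm_adjoint_diff_le[OF a, of b] b by (simp add: supported_in_def)
  moreover have "supported_in (adjoint_op b) (near r)"
    using supported_in_adjoint[OF b(1)] by simp
  ultimately show "\<exists>b r. supported_in b (near r) \<and> norm (adjoint_op a - b) < e" by blast
qed

lemma entry_id: "x \<noteq> y \<Longrightarrow> entry id_blinfun x y = 0"
  by (rule blinfun_eqI) (simp add: entry_apply ell2_apply_delta)

lemma BD_id: "(id_blinfun :: (int, 'h::complex_hilbert) ell2_op) \<in> BD"
  by (rule supported_near_BD[of _ 0]) (auto simp: supported_in_def id_complex_ops near_def entry_id)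

lemma BD_scaleC: "a \<in> BD \<Longrightarrow> c *\<^sub>C a \<in> BD"
  for a :: "(int, 'h::complex_hilbert) ell2_op"
proof -
  assume a: "a \<in> BD"
  have "(c *\<^sub>C id_blinfun :: (int, 'h) ell2_op) \<in> BD"
    by (rule supported_near_BD[of _ 0], rule supported_in_scaleC)
      (auto simp: supported_in_def id_complex_ops near_def entry_id)
  moreover have "c *\<^sub>C a = (c *\<^sub>C id_blinfun) o\<^sub>L a" by (rule blinfun_eqI) simp
  ultimately show ?thesis using BD_compose[OF _ a] by metis
qed

text \<open>
  This and the next lemma make the Roe algebra an ideal of \<open>BD\<close>: for a factor of finite propagation the
  entries of the product are finite sums of compact operators, and compactness survives norm limits.
\<close>

lemma compact_entries_compose_BD:
  fixes a u :: "(int, 'h::complex_hilbert) ell2_op"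
  assumes a: "compact_entries a" and u: "u \<in> BD"
  shows "compact_entries (a o\<^sub>L u)"
proof (rule compact_entries_limit)
  show "a o\<^sub>L u \<in> complex_ops"
    using a u by (simp add: compact_entries_def BD_complex_ops compose_complex_ops)
  fix e :: real assume "e > 0"
  define K where "K = norm a + 1"
  have K: "K > 0" "norm a \<le> K" by (auto simp: K_def add_nonneg_pos)
  obtain v r where v: "supported_in v (near r)" "norm (u - v) < e / K"
    using BD_approx[OF u, of "e / K"] \<open>e > 0\<close> K(1) by auto
  have "(a o\<^sub>L u) - (a o\<^sub>L v) = a o\<^sub>L (u - v)"
    by (rule blinfun_eqI) (simp add: blinfun.diff_left blinfun.diff_right)
  also have "norm \<dots> \<le> K * norm (u - v)"
    by (intro order_trans[OF norm_blinfun_compose] mult_right_mono K) simp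
  also have "\<dots> < e" using v(2) K(1) by (simp add: field_simps)
  finally have "norm ((a o\<^sub>L u) - (a o\<^sub>L v)) < e" .
  moreover have "compact_entries (a o\<^sub>L v)"
    by (rule compact_entries_compose_right[OF a v(1)]) simp
  ultimately show "\<exists>b. compact_entries b \<and> norm ((a o\<^sub>L u) - b) < e" by blast
qed

lemma compact_entries_BD_compose:
  fixes a u :: "(int, 'h::complex_hilbert) ell2_op"
  assumes a: "compact_entries a" and u: "u \<in> BD"
  shows "compact_entries (u o\<^sub>L a)"
proof -
  have "compact_entries (adjoint_op (adjoint_op a o\<^sub>L adjoint_op u))"
    by (intro compact_entries_adjoint compact_entries_compose_BD BD_adjoint a u)
  then show ?thesis
    using a BD_complex_ops[OF u]
    by (simp add: compact_entries_def adjoint_compose adjoint_adjoint adjoint_complex_ops)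
qed

lemma Roe_iff: "a \<in> Roe \<longleftrightarrow> a \<in> BD \<and> compact_entries a"
  for a :: "(int, 'h::complex_hilbert) ell2_op"
  by (auto simp: Roe_def compact_entries_def BD_complex_ops)

lemma Roe_complex_ops: "a \<in> Roe \<Longrightarrow> a \<in> complex_ops"
  for a :: "(int, 'h::complex_hilbert) ell2_op"
  by (simp add: Roe_iff BD_complex_ops)

lemma
  fixes a b :: "(int, 'h::complex_hilbert) ell2_op"
  shows Roe_plus: "a \<in> Roe \<Longrightarrow> b \<in> Roe \<Longrightarrow> a + b \<in> Roe"
    and Roe_compose: "a \<in> Roe \<Longrightarrow> b \<in> Roe \<Longrightarrow> a o\<^sub>L b \<in> Roe"
    and Roe_scaleC: "a \<in> Roe \<Longrightarrow> c *\<^sub>C a \<in> Roe"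
    and Roe_adjoint: "a \<in> Roe \<Longrightarrow> adjoint_op a \<in> Roe"
  by (simp_all add: Roe_iff BD_plus BD_compose BD_scaleC BD_adjoint compact_entries_plus
      compact_entries_compose_BD compact_entries_scaleC compact_entries_adjoint)

definition conj_op :: "('a::complex_hilbert \<Rightarrow>\<^sub>L 'a) \<Rightarrow> ('a \<Rightarrow>\<^sub>L 'a) \<Rightarrow> ('a \<Rightarrow>\<^sub>L 'a)"
  where "conj_op v a = v o\<^sub>L a o\<^sub>L adjoint_op v"

lemma conj_BD_Roe:
  fixes a u :: "(int, 'h::complex_hilbert) ell2_op"
  assumes "u \<in> BD" "a \<in> Roe"
  shows "conj_op u a \<in> Roe"
  using assms unfolding Roe_iff conj_op_def
  by (intro conjI BD_compose compact_entries_compose_BD compact_entries_BD_compose BD_adjoint) auto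

text \<open>
  The graph of a coarse equivalence, thickened by a bounded amount: both the relation and its converse take
  points at bounded distance to points at bounded distance.
\<close>

definition coarse_rel :: "(int \<times> int) set \<Rightarrow> bool"
  where "coarse_rel E \<longleftrightarrow> (\<forall>r. \<exists>s. E\<inverse> O near r O E \<subseteq> near s \<and> E O near r O E\<inverse> \<subseteq> near s)"

lemma coarse_rel_converse: "coarse_rel E \<Longrightarrow> coarse_rel (E\<inverse>)"
  unfolding coarse_rel_def converse_converse by blast

text \<open>
  The image of a point has bounded diameter, and bounded sets of integers are finite.
\<close>

lemma coarse_rel_finite:
  assumes "coarse_rel E"
  shows "finite (E `` {x})"
proof (cases "E `` {x} = {}")
  case False
  then obtain y where y: "(x, y) \<in> E" by blast
  obtain s where s: "E\<inverse> O near 0 O E \<subseteq> near s"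
    using assms unfolding coarse_rel_def by blast
  have "E `` {x} \<subseteq> near s `` {y}"
  proof
    fix z assume "z \<in> E `` {x}"
    then have "(y, z) \<in> E\<inverse> O near 0 O E"
      using y by (auto simp: near_def)
    then show "z \<in> near s `` {y}" using s by blast
  qed
  then show ?thesis using finite_near finite_subset by blast
qed simp

lemma conj_coarse_BD:
  fixes a v :: "(int, 'h::complex_hilbert) ell2_op"
  assumes E: "coarse_rel E" and v: "supported_in v E" and a: "a \<in> BD"
  shows "conj_op v a \<in> BD"
proof (rule BD_I_limit)
  have v': "v \<in> complex_ops" using v by (simp add: supported_in_def)
  then show "conj_op v a \<in> complex_ops"
    using BD_complex_ops[OF a] by (simp add: conj_op_def compose_complex_ops adjoint_complex_ops)
  fix e :: real assume "e > 0"
  define K where "K = norm v * norm (adjoint_op v) + 1"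
  have K: "K > 0" "norm v * norm (adjoint_op v) \<le> K" by (auto simp: K_def add_nonneg_pos)
  obtain b r where b: "supported_in b (near r)" "norm (a - b) < e / K"
    using BD_approx[OF a, of "e / K"] \<open>e > 0\<close> K(1) by auto
  obtain s where s: "E\<inverse> O near r O E \<subseteq> near s"
    using E unfolding coarse_rel_def by blast
  have fin: "finite (E\<inverse> `` {x})" for x
    using coarse_rel_finite[OF coarse_rel_converse[OF E]] .
  have "supported_in (v o\<^sub>L b) (near r O E)"
    by (rule supported_in_compose[OF v b(1)]) simp
  then have "supported_in (conj_op v b) (E\<inverse> O near r O E)"
    unfolding conj_op_def by (rule supported_in_compose[OF _ supported_in_adjoint[OF v] fin])
  then have "conj_op v b \<in> BD"
    using s by (blast intro: supported_near_BD supported_in_mono)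
  moreover have "norm (conj_op v a - conj_op v b) < e"
  proof -
    have "conj_op v a - conj_op v b = v o\<^sub>L (a - b) o\<^sub>L adjoint_op v"
      by (rule blinfun_eqI) (simp add: conj_op_def blinfun.diff_left blinfun.diff_right)
    also have "norm \<dots> \<le> norm v * norm (a - b) * norm (adjoint_op v)"
      by (intro order_trans[OF norm_blinfun_compose] mult_right_mono norm_blinfun_compose) simp
    also have "\<dots> \<le> K * norm (a - b)"
      using mult_right_mono[OF K(2) norm_ge_zero[of "a - b"]] by (simp add: mult_ac)
    also have "\<dots> < e" using b(2) K(1) by (simp add: field_simps)
    finally show ?thesis .
  qed
  ultimately show "\<exists>b\<in>BD. norm (conj_op v a - b) < e" by blast
qed

lemma conj_coarse_Roe:
  fixes a v :: "(int, 'h::complex_hilbert) ell2_op"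
  assumes E: "coarse_rel E" and v: "supported_in v E" and a: "a \<in> Roe"
  shows "conj_op v a \<in> Roe"
proof -
  have "compact_entries (v o\<^sub>L a)"
    using a coarse_rel_finite[OF coarse_rel_converse[OF E]] compact_entries_compose_left[OF _ v]
    by (simp add: Roe_iff)
  then have "compact_entries (conj_op v a)"
    unfolding conj_op_def
    using compact_entries_compose_right[OF _ supported_in_adjoint[OF v]]
      coarse_rel_finite[OF coarse_rel_converse[OF E]] by blast
  then show ?thesis
    using conj_coarse_BD[OF E v] a by (simp add: Roe_iff)
qed


section \<open>Subgroups of quotients\<close>

text \<open>
  The cosets \<open>N \<phi>(k)\<close> multiply like the elements of \<open>K\<close>, since \<open>\<phi>(k)\<close> normalises \<open>N\<close> and \<open>\<phi>\<close> is
  multiplicative modulo \<open>N\<close>. The inverse in the quotient is a definite description that ranges over all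
  cosets, so its uniqueness has to be checked against arbitrary cosets \<open>N g\<close>.
\<close>

lemma contains_copy_FactGroup:
  assumes G: "group G" and N: "subgroup N G" and K: "group K"
    and \<phi>: "\<And>k. k \<in> carrier K \<Longrightarrow> \<phi> k \<in> carrier G"
    and normalises: "\<And>k n. k \<in> carrier K \<Longrightarrow> n \<in> N \<Longrightarrow> \<phi> k \<otimes>\<^bsub>G\<^esub> n \<otimes>\<^bsub>G\<^esub> inv\<^bsub>G\<^esub> (\<phi> k) \<in> N"
    and hom: "\<And>k l. k \<in> carrier K \<Longrightarrow> l \<in> carrier K \<Longrightarrow>
      \<phi> k \<otimes>\<^bsub>G\<^esub> \<phi> l \<otimes>\<^bsub>G\<^esub> inv\<^bsub>G\<^esub> (\<phi> (k \<otimes>\<^bsub>K\<^esub> l)) \<in> N"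
    and inj: "\<And>k. k \<in> carrier K \<Longrightarrow> \<phi> k \<in> N \<Longrightarrow> k = \<one>\<^bsub>K\<^esub>"
  shows "contains_copy (G Mod N) K"
proof -
  interpret G: group G by fact
  interpret K: group K by fact
  interpret N: subgroup N G by fact
  define C where "C k = N #>\<^bsub>G\<^esub> \<phi> k" for k
  have mem: "x \<in> N #>\<^bsub>G\<^esub> y \<longleftrightarrow> x \<otimes>\<^bsub>G\<^esub> inv\<^bsub>G\<^esub> y \<in> N" if "x \<in> carrier G" "y \<in> carrier G" for x y
    using N.rcos_module[OF G that(2,1)] .
  have mult: "C k <#>\<^bsub>G\<^esub> C l = C (k \<otimes>\<^bsub>K\<^esub> l)" if k: "k \<in> carrier K" and l: "l \<in> carrier K" for k l
  proof -
    define c where "c = \<phi> k \<otimes>\<^bsub>G\<^esub> \<phi> l \<otimes>\<^bsub>G\<^esub> inv\<^bsub>G\<^esub> (\<phi> (k \<otimes>\<^bsub>K\<^esub> l))"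
    have c: "c \<in> N" unfolding c_def by (rule hom[OF k l])
    note [simp] = \<phi>[OF k] \<phi>[OF l] \<phi>[OF K.m_closed[OF k l]]
    have kl: "\<phi> k \<otimes>\<^bsub>G\<^esub> \<phi> l = c \<otimes>\<^bsub>G\<^esub> \<phi> (k \<otimes>\<^bsub>K\<^esub> l)"
      by (simp add: c_def G.m_assoc)
    have kl': "\<phi> (k \<otimes>\<^bsub>K\<^esub> l) = inv\<^bsub>G\<^esub> c \<otimes>\<^bsub>G\<^esub> (\<phi> k \<otimes>\<^bsub>G\<^esub> \<phi> l)"
      unfolding kl using c by (simp flip: G.m_assoc)
    show ?thesis
    proof (rule subset_antisym; rule subsetI)
      fix x assume "x \<in> C k <#>\<^bsub>G\<^esub> C l"
      then obtain n m where nm: "n \<in> N" "m \<in> N"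
        and x: "x = (n \<otimes>\<^bsub>G\<^esub> \<phi> k) \<otimes>\<^bsub>G\<^esub> (m \<otimes>\<^bsub>G\<^esub> \<phi> l)"
        by (auto simp: C_def set_mult_def r_coset_def)
      define m' where "m' = \<phi> k \<otimes>\<^bsub>G\<^esub> m \<otimes>\<^bsub>G\<^esub> inv\<^bsub>G\<^esub> (\<phi> k)"
      have m': "m' \<in> N" unfolding m'_def by (rule normalises[OF k nm(2)])
      have km: "\<phi> k \<otimes>\<^bsub>G\<^esub> m = m' \<otimes>\<^bsub>G\<^esub> \<phi> k"
        using nm by (simp add: m'_def G.m_assoc)
      have "x = n \<otimes>\<^bsub>G\<^esub> ((\<phi> k \<otimes>\<^bsub>G\<^esub> m) \<otimes>\<^bsub>G\<^esub> \<phi> l)"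
        using nm unfolding x by (simp add: G.m_assoc)
      also have "\<dots> = n \<otimes>\<^bsub>G\<^esub> m' \<otimes>\<^bsub>G\<^esub> (\<phi> k \<otimes>\<^bsub>G\<^esub> \<phi> l)"
        using nm m' unfolding km by (simp add: G.m_assoc)
      finally have "x = (n \<otimes>\<^bsub>G\<^esub> m' \<otimes>\<^bsub>G\<^esub> c) \<otimes>\<^bsub>G\<^esub> \<phi> (k \<otimes>\<^bsub>K\<^esub> l)"
        using nm m' c unfolding kl by (simp add: G.m_assoc)
      then show "x \<in> C (k \<otimes>\<^bsub>K\<^esub> l)"
        using N.m_closed[OF N.m_closed[OF nm(1) m'] c] unfolding C_def r_coset_def by blast
    next
      fix x assume "x \<in> C (k \<otimes>\<^bsub>K\<^esub> l)"
      then obtain n where n: "n \<in> N" "x = n \<otimes>\<^bsub>G\<^esub> \<phi> (k \<otimes>\<^bsub>K\<^esub> l)"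
        by (auto simp: C_def r_coset_def)
      have "x = (n \<otimes>\<^bsub>G\<^esub> inv\<^bsub>G\<^esub> c \<otimes>\<^bsub>G\<^esub> \<phi> k) \<otimes>\<^bsub>G\<^esub> (\<one>\<^bsub>G\<^esub> \<otimes>\<^bsub>G\<^esub> \<phi> l)"
        using n(1) c unfolding n(2) kl' by (simp add: G.m_assoc)
      then show "x \<in> C k <#>\<^bsub>G\<^esub> C l"
        using n(1) c N.one_closed N.m_closed[OF n(1) N.m_inv_closed[OF c]]
        unfolding C_def set_mult_def r_coset_def by blast
    qed
  qed
  have one: "\<phi> \<one>\<^bsub>K\<^esub> \<in> N"
    using hom[of "\<one>\<^bsub>K\<^esub>" "\<one>\<^bsub>K\<^esub>"] by (simp add: \<phi> G.m_assoc)
  have C1: "C \<one>\<^bsub>K\<^esub> = N"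
    unfolding C_def using one \<phi> by (intro G.coset_join2) (auto simp: N)
  have \<phi>_in_C: "\<phi> k \<in> C k" if "k \<in> carrier K" for k
    unfolding C_def using that by (intro G.rcos_self \<phi> N)
  have C_carrier: "C k \<in> carrier (G Mod N)" if "k \<in> carrier K" for k
    using \<phi>[OF that] by (auto simp: carrier_FactGroup C_def)
  have inv_C: "inv\<^bsub>G Mod N\<^esub> (C k) = C (inv\<^bsub>K\<^esub> k)" if k: "k \<in> carrier K" for k
    unfolding m_inv_def[of "G Mod N"]
  proof (rule the_equality)
    show "C (inv\<^bsub>K\<^esub> k) \<in> carrier (G Mod N) \<and> C k \<otimes>\<^bsub>G Mod N\<^esub> C (inv\<^bsub>K\<^esub> k) = \<one>\<^bsub>G Mod N\<^esub> \<and>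
        C (inv\<^bsub>K\<^esub> k) \<otimes>\<^bsub>G Mod N\<^esub> C k = \<one>\<^bsub>G Mod N\<^esub>"
      using k by (simp add: C_carrier mult C1)
    fix Y assume Y: "Y \<in> carrier (G Mod N) \<and> C k \<otimes>\<^bsub>G Mod N\<^esub> Y = \<one>\<^bsub>G Mod N\<^esub> \<and>
        Y \<otimes>\<^bsub>G Mod N\<^esub> C k = \<one>\<^bsub>G Mod N\<^esub>"
    then obtain g where g: "g \<in> carrier G" "Y = N #>\<^bsub>G\<^esub> g"
      by (auto simp: carrier_FactGroup)
    have "g \<otimes>\<^bsub>G\<^esub> \<phi> k \<in> Y <#>\<^bsub>G\<^esub> C k"
      using g \<phi>_in_C[OF k] G.rcos_self[OF g(1) N] by (auto simp: set_mult_def)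
    then have gk: "g \<otimes>\<^bsub>G\<^esub> \<phi> k \<in> N" using Y by simp
    have "\<phi> (inv\<^bsub>K\<^esub> k) \<otimes>\<^bsub>G\<^esub> \<phi> k \<in> C (inv\<^bsub>K\<^esub> k) <#>\<^bsub>G\<^esub> C k"
      using \<phi>_in_C k by (auto simp: set_mult_def)
    then have ik: "\<phi> (inv\<^bsub>K\<^esub> k) \<otimes>\<^bsub>G\<^esub> \<phi> k \<in> N" using k by (simp add: mult C1)
    note [simp] = \<phi>[OF k] \<phi>[OF K.inv_closed[OF k]]
    have "g \<otimes>\<^bsub>G\<^esub> inv\<^bsub>G\<^esub> (\<phi> (inv\<^bsub>K\<^esub> k)) =
        (g \<otimes>\<^bsub>G\<^esub> \<phi> k) \<otimes>\<^bsub>G\<^esub> inv\<^bsub>G\<^esub> (\<phi> (inv\<^bsub>K\<^esub> k) \<otimes>\<^bsub>G\<^esub> \<phi> k)"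
      using g(1) by (simp add: G.inv_mult_group G.m_assoc) (simp flip: G.m_assoc)
    also have "\<dots> \<in> N" using gk ik by simp
    finally have "g \<in> N #>\<^bsub>G\<^esub> \<phi> (inv\<^bsub>K\<^esub> k)" using g(1) by (simp add: mem)
    then show "Y = C (inv\<^bsub>K\<^esub> k)"
      unfolding g(2) C_def by (intro G.repr_independence[symmetric] N) auto
  qed
  have "inj_on C (carrier K)"
  proof (rule inj_onI)
    fix k l assume k: "k \<in> carrier K" and l: "l \<in> carrier K" and eq: "C k = C l"
    have "C (k \<otimes>\<^bsub>K\<^esub> inv\<^bsub>K\<^esub> l) = C k <#>\<^bsub>G\<^esub> C (inv\<^bsub>K\<^esub> l)"
      using k l by (simp add: mult)
    also have "\<dots> = N" using l by (simp add: eq mult C1)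
    finally have "\<phi> (k \<otimes>\<^bsub>K\<^esub> inv\<^bsub>K\<^esub> l) \<in> N" using \<phi>_in_C[of "k \<otimes>\<^bsub>K\<^esub> inv\<^bsub>K\<^esub> l"] k l by simp
    then have "k \<otimes>\<^bsub>K\<^esub> inv\<^bsub>K\<^esub> l = \<one>\<^bsub>K\<^esub>" using inj k l by simp
    then show "k = l" using k l by (metis K.inv_equality K.inv_inv K.inv_closed)
  qed
  define S where "S = C ` carrier K"
  have "subgroup S (G Mod N)"
  proof (rule subgroup.intro)
    show "S \<subseteq> carrier (G Mod N)" using C_carrier by (auto simp: S_def)
    show "\<one>\<^bsub>G Mod N\<^esub> \<in> S" using C1 by (auto simp: S_def image_iff intro: bexI[of _ "\<one>\<^bsub>K\<^esub>"])
    show "inv\<^bsub>G Mod N\<^esub> x \<in> S" if "x \<in> S" for x using that inv_C by (auto simp: S_def)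
    show "x \<otimes>\<^bsub>G Mod N\<^esub> y \<in> S" if "x \<in> S" "y \<in> S" for x y
      using that mult by (auto simp: S_def)
  qed
  moreover have "C \<in> iso K ((G Mod N)\<lparr>carrier := S\<rparr>)"
    using \<open>inj_on C (carrier K)\<close>
    by (auto simp: iso_def hom_def S_def bij_betw_def mult)
  ultimately show ?thesis
    unfolding contains_copy_def is_iso_def by blast
qed


section \<open>The automorphism group of the Roe algebra\<close>

lemma subgroup_Aut_Roe:
  "subgroup {\<phi> \<in> Bij Roe. is_star_hom Roe \<phi>}
    (BijGroup (Roe :: (int, 'h::complex_hilbert) ell2_op set))"
proof (rule subgroup.intro)
  let ?A = "Roe :: (int, 'h) ell2_op set"
  note closed = Roe_plus Roe_compose Roe_scaleC Roe_adjoint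
  show "{\<phi> \<in> Bij ?A. is_star_hom ?A \<phi>} \<subseteq> carrier (BijGroup ?A)"
    by (auto simp: BijGroup_def)
  show "\<one>\<^bsub>BijGroup ?A\<^esub> \<in> {\<phi> \<in> Bij ?A. is_star_hom ?A \<phi>}"
    by (auto simp: BijGroup_def id_Bij is_star_hom_def closed)
  fix \<phi> assume \<phi>: "\<phi> \<in> {\<phi> \<in> Bij ?A. is_star_hom ?A \<phi>}"
  have mem: "\<phi> a \<in> ?A" if "a \<in> ?A" for a using that \<phi> by (auto simp: Bij_def bij_betw_def)
  {
    fix \<psi> assume \<psi>: "\<psi> \<in> {\<phi> \<in> Bij ?A. is_star_hom ?A \<phi>}"
    have "is_star_hom ?A (compose ?A \<psi> \<phi>)"
      using \<phi> \<psi> mem by (auto simp: is_star_hom_def compose_def closed)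
    then show "\<psi> \<otimes>\<^bsub>BijGroup ?A\<^esub> \<phi> \<in> {\<phi> \<in> Bij ?A. is_star_hom ?A \<phi>}"
      using \<phi> \<psi> by (simp add: BijGroup_def compose_Bij)
  }
  define \<psi> where "\<psi> = inv_into ?A \<phi>"
  have bij: "bij_betw \<phi> ?A ?A" using \<phi> by (simp add: Bij_def)
  have \<psi>: "\<psi> a \<in> ?A" "\<phi> (\<psi> a) = a" if "a \<in> ?A" for a
    using that bij by (auto simp: \<psi>_def bij_betw_def inv_into_into f_inv_into_f)
  have eqI: "\<psi> a = b" if "a = \<phi> b" "b \<in> ?A" for a b
    using that bij by (simp add: \<psi>_def bij_betw_def)
  have "is_star_hom ?A (restrict \<psi> ?A)"
    unfolding is_star_hom_def
    using \<phi> \<psi> by (auto simp: closed is_star_hom_def intro!: eqI)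
  then show "inv\<^bsub>BijGroup ?A\<^esub> \<phi> \<in> {\<phi> \<in> Bij ?A. is_star_hom ?A \<phi>}"
    using \<phi> by (simp add: inv_BijGroup restrict_inv_into_Bij \<psi>_def)
qed

lemma group_Aut_Roe: "group (Aut_Roe :: ((int, 'h::complex_hilbert) ell2_op \<Rightarrow> _) monoid)"
  unfolding Aut_Roe_def using subgroup.subgroup_is_group[OF subgroup_Aut_Roe group_BijGroup] .

lemma unitary_complex_ops: "unitary_op v \<Longrightarrow> v \<in> complex_ops"
  by (simp add: unitary_op_def)

lemma unitary_apply:
  assumes "unitary_op v"
  shows "blinfun_apply v (blinfun_apply (adjoint_op v) x) = x"
    "blinfun_apply (adjoint_op v) (blinfun_apply v x) = x"
  using assms unfolding unitary_op_def
  by (metis blinfun_apply_blinfun_compose blinfun_apply_id_blinfun id_apply)+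

lemma unitary_adjoint: "unitary_op v \<Longrightarrow> unitary_op (adjoint_op v)"
  by (simp add: unitary_op_def adjoint_complex_ops adjoint_adjoint)

lemma unitary_compose:
  assumes "unitary_op v" "unitary_op w"
  shows "unitary_op (v o\<^sub>L w)"
  unfolding unitary_op_def
proof (intro conjI)
  note c = assms[THEN unitary_complex_ops]
  show "v o\<^sub>L w \<in> complex_ops" using c by (rule compose_complex_ops)
  show "(v o\<^sub>L w) o\<^sub>L adjoint_op (v o\<^sub>L w) = id_blinfun" "adjoint_op (v o\<^sub>L w) o\<^sub>L (v o\<^sub>L w) = id_blinfun"
    by (rule blinfun_eqI; simp add: adjoint_compose[OF c] unitary_apply assms)+
qed

lemma unitary_id: "unitary_op id_blinfun"
  by (auto simp: unitary_op_def id_complex_ops adjoint_id intro!: blinfun_eqI)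

lemma unitary_norm: "unitary_op v \<Longrightarrow> norm (blinfun_apply v x) = norm x"
proof -
  assume v: "unitary_op v"
  have "(norm (blinfun_apply v x))\<^sup>2 = (norm x)\<^sup>2"
    unfolding power2_norm_eq_inner inner_eq_Re_cinner
    by (simp add: cinner_adjoint[OF unitary_complex_ops[OF v]] unitary_apply[OF v])
  then show ?thesis by simp
qed

lemma conj_op_compose:
  assumes "v \<in> complex_ops" "w \<in> complex_ops"
  shows "conj_op (v o\<^sub>L w) a = conj_op v (conj_op w a)"
  by (rule blinfun_eqI) (simp add: conj_op_def adjoint_compose assms)

lemma conj_op_adjoint_cancel:
  assumes "unitary_op v"
  shows "conj_op (adjoint_op v) (conj_op v a) = a" "conj_op v (conj_op (adjoint_op v) a) = a"
  by (rule blinfun_eqI; simp add: conj_op_def adjoint_adjoint unitary_complex_ops unitary_apply assms)+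

text \<open>
  The condition is imposed on the adjoint as well, so that conjugation becomes a bijection of \<open>Roe\<close> and
  the inverse automorphism is of the same form.
\<close>

definition normalising :: "(int, 'h::complex_hilbert) ell2_op \<Rightarrow> bool"
  where "normalising v \<longleftrightarrow> unitary_op v \<and>
    (\<forall>a\<in>BD. conj_op v a \<in> BD \<and> conj_op (adjoint_op v) a \<in> BD) \<and>
    (\<forall>a\<in>Roe. conj_op v a \<in> Roe \<and> conj_op (adjoint_op v) a \<in> Roe)"

lemma normalising_BD: "u \<in> BD \<Longrightarrow> unitary_op u \<Longrightarrow> normalising u"
  by (auto simp: normalising_def conj_BD_Roe BD_adjoint) (auto simp: conj_op_def BD_compose BD_adjoint)

lemma normalising_coarse:
  assumes "coarse_rel E" "supported_in v E" "unitary_op v"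
  shows "normalising v"
  using assms conj_coarse_BD[OF assms(1,2)] conj_coarse_Roe[OF assms(1,2)]
    conj_coarse_BD[OF coarse_rel_converse supported_in_adjoint, OF assms(1,2)]
    conj_coarse_Roe[OF coarse_rel_converse supported_in_adjoint, OF assms(1,2)]
  by (simp add: normalising_def)

lemma normalising_adjoint: "normalising v \<Longrightarrow> normalising (adjoint_op v)"
  by (auto simp: normalising_def unitary_adjoint adjoint_adjoint unitary_complex_ops)

lemma normalising_compose: "normalising v \<Longrightarrow> normalising w \<Longrightarrow> normalising (v o\<^sub>L w)"
  by (simp add: normalising_def unitary_compose conj_op_compose adjoint_compose
      unitary_complex_ops adjoint_complex_ops)

definition Ad :: "(int, 'h::complex_hilbert) ell2_op \<Rightarrow> (int, 'h) ell2_op \<Rightarrow> (int, 'h) ell2_op"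
  where "Ad v = (\<lambda>a\<in>Roe. conj_op v a)"

lemma conj_star_hom:
  assumes "unitary_op v" "a \<in> complex_ops" "b \<in> complex_ops"
  shows "conj_op v (a + b) = conj_op v a + conj_op v b"
    and "conj_op v (c *\<^sub>C a) = c *\<^sub>C conj_op v a"
    and "conj_op v (a o\<^sub>L b) = conj_op v a o\<^sub>L conj_op v b"
    and "conj_op v (adjoint_op a) = adjoint_op (conj_op v a)"
proof -
  note v = unitary_complex_ops[OF assms(1)]
  show "conj_op v (a + b) = conj_op v a + conj_op v b"
    by (rule blinfun_eqI) (simp add: conj_op_def blinfun.add_left blinfun.add_right)
  show "conj_op v (c *\<^sub>C a) = c *\<^sub>C conj_op v a"
    by (rule blinfun_eqI) (simp add: conj_op_def complex_opsD[OF v])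
  show "conj_op v (a o\<^sub>L b) = conj_op v a o\<^sub>L conj_op v b"
    by (rule blinfun_eqI) (simp add: conj_op_def unitary_apply[OF assms(1)])
  show "conj_op v (adjoint_op a) = adjoint_op (conj_op v a)"
    by (rule blinfun_eqI)
      (simp add: conj_op_def adjoint_compose compose_complex_ops adjoint_complex_ops adjoint_adjoint assms v)
qed

lemma Ad_carrier:
  assumes "normalising v"
  shows "Ad v \<in> carrier Aut_Roe"
proof -
  have u: "unitary_op v" using assms by (simp add: normalising_def)
  have "bij_betw (conj_op v) Roe Roe"
    using assms conj_op_adjoint_cancel[OF u]
    by (intro bij_betw_byWitness[where f' = "conj_op (adjoint_op v)"]) (auto simp: normalising_def)
  then have "Ad v \<in> Bij Roe"
    by (auto simp: Bij_def Ad_def cong: bij_betw_cong)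
  moreover have "is_star_hom Roe (Ad v)"
    unfolding is_star_hom_def Ad_def
    using conj_star_hom(1,3)[OF u] conj_star_hom(2,4)[OF u _ id_complex_ops]
    by (simp add: Roe_plus Roe_compose Roe_scaleC Roe_adjoint Roe_complex_ops)
  ultimately show ?thesis by (simp add: Aut_Roe_def)
qed

lemma Ad_compose:
  assumes "normalising v" "normalising w"
  shows "Ad v \<otimes>\<^bsub>Aut_Roe\<^esub> Ad w = Ad (v o\<^sub>L w)"
proof -
  have "Ad v \<in> Bij Roe" "Ad w \<in> Bij Roe"
    using assms[THEN Ad_carrier] by (auto simp: Aut_Roe_def)
  moreover have "compose Roe (Ad v) (Ad w) = Ad (v o\<^sub>L w)"
    using assms by (auto simp: compose_def Ad_def fun_eq_iff normalising_def conj_op_compose unitary_complex_ops)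
  ultimately show ?thesis by (simp add: Aut_Roe_def BijGroup_def)
qed

lemma Ad_id: "Ad id_blinfun = \<one>\<^bsub>Aut_Roe\<^esub>"
  by (auto simp: Ad_def Aut_Roe_def BijGroup_def fun_eq_iff conj_op_def adjoint_id intro!: blinfun_eqI)

lemma Ad_inv:
  assumes "normalising v"
  shows "inv\<^bsub>Aut_Roe\<^esub> (Ad v) = Ad (adjoint_op v)"
proof (rule group.inv_equality[OF group_Aut_Roe])
  have "adjoint_op v o\<^sub>L v = id_blinfun" using assms by (simp add: normalising_def unitary_op_def)
  then show "Ad (adjoint_op v) \<otimes>\<^bsub>Aut_Roe\<^esub> Ad v = \<one>\<^bsub>Aut_Roe\<^esub>"
    using assms by (simp add: Ad_compose normalising_adjoint Ad_id)
qed (use assms in \<open>auto intro: Ad_carrier normalising_adjoint\<close>)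

lemma Inn_BD_eq: "Inn_BD = {Ad u | u :: (int, 'h::complex_hilbert) ell2_op. u \<in> BD \<and> unitary_op u}"
  by (simp add: Inn_BD_def Ad_def conj_op_def)

lemma subgroup_Inn_BD:
  "subgroup Inn_BD (Aut_Roe :: ((int, 'h::complex_hilbert) ell2_op \<Rightarrow> _) monoid)"
proof (rule subgroup.intro)
  show "(Inn_BD :: ((int, 'h) ell2_op \<Rightarrow> _) set) \<subseteq> carrier Aut_Roe"
    by (auto simp: Inn_BD_eq intro: Ad_carrier normalising_BD)
  show "\<one>\<^bsub>Aut_Roe\<^esub> \<in> (Inn_BD :: ((int, 'h) ell2_op \<Rightarrow> _) set)"
    unfolding Inn_BD_eq Ad_id[symmetric] using BD_id unitary_id by blast
  fix \<phi> \<psi> :: "(int, 'h) ell2_op \<Rightarrow> (int, 'h) ell2_op"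
  assume "\<phi> \<in> Inn_BD"
  then obtain u where u: "\<phi> = Ad u" "u \<in> BD" "unitary_op u" by (auto simp: Inn_BD_eq)
  then show "inv\<^bsub>Aut_Roe\<^esub> \<phi> \<in> Inn_BD"
    by (auto simp: Ad_inv normalising_BD Inn_BD_eq BD_adjoint unitary_adjoint)
  assume "\<psi> \<in> Inn_BD"
  then obtain w where w: "\<psi> = Ad w" "w \<in> BD" "unitary_op w" by (auto simp: Inn_BD_eq)
  have "\<phi> \<otimes>\<^bsub>Aut_Roe\<^esub> \<psi> = Ad (u o\<^sub>L w)"
    using u w by (simp add: Ad_compose normalising_BD)
  then show "\<phi> \<otimes>\<^bsub>Aut_Roe\<^esub> \<psi> \<in> Inn_BD"
    using u w BD_compose unitary_compose unfolding Inn_BD_eq by blast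
qed

lemma Ad_normalises_Inn_BD:
  assumes v: "normalising v" and \<phi>: "\<phi> \<in> Inn_BD"
  shows "Ad v \<otimes>\<^bsub>Aut_Roe\<^esub> \<phi> \<otimes>\<^bsub>Aut_Roe\<^esub> inv\<^bsub>Aut_Roe\<^esub> (Ad v) \<in> Inn_BD"
proof -
  obtain u where u: "\<phi> = Ad u" "u \<in> BD" "unitary_op u" using \<phi> by (auto simp: Inn_BD_eq)
  have "Ad v \<otimes>\<^bsub>Aut_Roe\<^esub> \<phi> \<otimes>\<^bsub>Aut_Roe\<^esub> inv\<^bsub>Aut_Roe\<^esub> (Ad v) = Ad (conj_op v u)"
    unfolding conj_op_def using u v
    by (simp add: Ad_inv Ad_compose normalising_BD normalising_compose normalising_adjoint)
  moreover have "conj_op v u \<in> BD" using u v by (simp add: normalising_def)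
  moreover have "unitary_op (conj_op v u)"
    using u v by (simp add: conj_op_def normalising_def unitary_compose unitary_adjoint)
  ultimately show ?thesis unfolding Inn_BD_eq by blast
qed


section \<open>Unitaries that permute an orthonormal basis\<close>

definition orthonormal_on :: "'i set \<Rightarrow> ('i \<Rightarrow> 'a::complex_inner) \<Rightarrow> bool"
  where "orthonormal_on I b \<longleftrightarrow> (\<forall>i\<in>I. \<forall>j\<in>I. cinner (b i) (b j) = (if i = j then 1 else 0))"

definition total_family_on :: "'i set \<Rightarrow> ('i \<Rightarrow> 'a::complex_inner) \<Rightarrow> bool"
  where "total_family_on I b \<longleftrightarrow> (\<forall>v. (\<forall>i\<in>I. cinner v (b i) = 0) \<longrightarrow> v = 0)"

lemma total_family_eqI:
  assumes "total_family_on I b" "\<And>i. i \<in> I \<Longrightarrow> cinner v (b i) = cinner w (b i)"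
  shows "v = w"
proof -
  have "\<forall>i\<in>I. cinner (v - w) (b i) = 0"
    using assms(2) by (simp add: cinner_diff_left)
  then have "v - w = 0"
    using assms(1) unfolding total_family_on_def by blast
  then show ?thesis by simp
qed

lemma cinner_sum_left: "cinner (\<Sum>i\<in>I. f i) g = (\<Sum>i\<in>I. cinner (f i) g)"
  by (induction I rule: infinite_finite_induct) (auto simp: cinner_add_left)

lemma cinner_sum_right: "cinner g (\<Sum>i\<in>I. f i) = (\<Sum>i\<in>I. cinner g (f i))"
  by (induction I rule: infinite_finite_induct) (auto simp: cinner_add_right)

lemma cinner_orthonormal_combination:
  assumes "orthonormal_on I b" "finite F" "F \<subseteq> I" "j \<in> F"
  shows "cinner (\<Sum>i\<in>F. c i *\<^sub>C b i) (b j) = c j"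
proof -
  have "cinner (\<Sum>i\<in>F. c i *\<^sub>C b i) (b j) = (\<Sum>i\<in>F. if i = j then c i else 0)"
    unfolding cinner_sum_left using assms
    by (intro sum.cong) (auto simp: cinner_scaleC_left orthonormal_on_def subset_iff)
  then show ?thesis using assms by simp
qed

text \<open>
  With \<open>w\<close> the projection of \<open>v\<close> to the span of the finite family, \<open>v - w\<close> is orthogonal to \<open>w\<close>.
\<close>

lemma bessel_inequality:
  assumes b: "orthonormal_on I b" and F: "finite F" "F \<subseteq> I"
  shows "(\<Sum>i\<in>F. (norm (cinner v (b i)))\<^sup>2) \<le> (norm v)\<^sup>2"
proof -
  define w where "w = (\<Sum>i\<in>F. cinner v (b i) *\<^sub>C b i)"
  have wb: "cinner w (b j) = cinner v (b j)" if "j \<in> F" for j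
    unfolding w_def by (rule cinner_orthonormal_combination[OF b F that])
  have "cinner (v - w) w = 0"
    unfolding cinner_diff_left
    by (subst (1 3) w_def) (simp add: cinner_sum_right cinner_scaleC_right wb)
  then have orth: "inner (v - w) w = 0"
    by (simp add: inner_eq_Re_cinner)
  have "cinner w w = (\<Sum>i\<in>F. cnj (cinner v (b i)) * cinner v (b i))"
    by (subst (2) w_def) (simp add: cinner_sum_right cinner_scaleC_right wb)
  also have "\<dots> = of_real (\<Sum>i\<in>F. (norm (cinner v (b i)))\<^sup>2)"
    by (simp add: complex_norm_square[symmetric] mult.commute)
  finally have "(norm w)\<^sup>2 = (\<Sum>i\<in>F. (norm (cinner v (b i)))\<^sup>2)"
    unfolding cinner_self using of_real_eq_iff by blast
  moreover have "(norm v)\<^sup>2 = (norm (v - w))\<^sup>2 + (norm w)\<^sup>2"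
    using orth by (simp add: power2_norm_eq_inner inner_diff_left inner_diff_right inner_commute)
  ultimately show ?thesis by simp
qed

lemma finite_sum_coefficient_products_le:
  assumes b: "orthonormal_on I b" and c: "orthonormal_on I c" and F: "finite F" "F \<subseteq> I"
  shows "(\<Sum>i\<in>F. norm (cinner f (b i) * cnj (cinner g (c i)))) \<le> norm f * norm g"
proof -
  have "(\<Sum>i\<in>F. norm (cinner f (b i) * cnj (cinner g (c i)))) =
      (\<Sum>i\<in>F. \<bar>norm (cinner f (b i))\<bar> * \<bar>norm (cinner g (c i))\<bar>)"
    by (simp add: norm_mult)
  also have "\<dots> \<le> L2_set (\<lambda>i. norm (cinner f (b i))) F * L2_set (\<lambda>i. norm (cinner g (c i))) F"
    by (rule L2_set_mult_ineq)
  also have "\<dots> \<le> norm f * norm g"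
    using bessel_inequality[OF b F] bessel_inequality[OF c F]
    by (intro mult_mono) (auto simp: L2_set_def real_le_lsqrt intro!: sum_nonneg)
  finally show ?thesis .
qed

lemma coefficient_products:
  assumes b: "orthonormal_on I b" and c: "orthonormal_on I c"
  shows "(\<lambda>i. cinner f (b i) * cnj (cinner g (c i))) summable_on I"
    and "norm (\<Sum>\<^sub>\<infinity>i\<in>I. cinner f (b i) * cnj (cinner g (c i))) \<le> norm f * norm g"
proof -
  let ?t = "\<lambda>i. cinner f (b i) * cnj (cinner g (c i))"
  have abs: "(\<lambda>i. norm (?t i)) summable_on I"
    by (rule nonneg_bdd_above_summable_on)
      (use finite_sum_coefficient_products_le[OF b c] in \<open>auto intro!: bdd_aboveI\<close>)
  then show "?t summable_on I" by (rule Infinite_Sum.abs_summable_summable)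
  have "norm (infsum ?t I) \<le> (\<Sum>\<^sub>\<infinity>i\<in>I. norm (?t i))"
    by (rule norm_infsum_bound[OF abs])
  also have "\<dots> \<le> norm f * norm g"
    by (rule infsum_le_finite_sums[OF abs finite_sum_coefficient_products_le[OF b c]])
  finally show "norm (infsum ?t I) \<le> norm f * norm g" .
qed

text \<open>
  The operator \<open>\<Sum>\<^sub>i c\<^sub>i \<langle>\<cdot>, b\<^sub>i\<rangle>\<close>, defined by its sesquilinear form. That form is a series which converges
  absolutely, by Bessel's inequality for both families and the Cauchy-Schwarz inequality.
\<close>

lemma ex_transfer_operator:
  fixes b c :: "'i \<Rightarrow> 'a::complex_hilbert"
  assumes b: "orthonormal_on I b" and c: "orthonormal_on I c"
  shows "\<exists>T\<in>complex_ops. \<forall>f g. inner (blinfun_apply T f) g =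
    Re (\<Sum>\<^sub>\<infinity>i\<in>I. cinner f (b i) * cnj (cinner g (c i)))"
proof -
  define \<beta> where "\<beta> f g = Re (\<Sum>\<^sub>\<infinity>i\<in>I. cinner f (b i) * cnj (cinner g (c i)))" for f g
  note s = coefficient_products(1)[OF b c]
  have sc: "cinner (r *\<^sub>R x) y = of_real r * cinner x y" for r and x y :: 'a
    by (simp add: cinner_scaleC_left flip: scaleC_of_real)
  have "bounded_bilinear \<beta>"
  proof
    show "\<beta> (f + f') g = \<beta> f g + \<beta> f' g" for f f' g
      by (simp add: \<beta>_def cinner_add_left distrib_right infsum_add s)
    show "\<beta> f (g + g') = \<beta> f g + \<beta> f g'" for f g g'
      by (simp add: \<beta>_def cinner_add_left distrib_left infsum_add s)
    show "\<beta> (r *\<^sub>R f) g = r *\<^sub>R \<beta> f g" for r f g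
      by (simp add: \<beta>_def sc mult.assoc infsum_cmult_right')
    show "\<beta> f (r *\<^sub>R g) = r *\<^sub>R \<beta> f g" for r f g
      by (simp add: \<beta>_def sc mult.left_commute infsum_cmult_right')
    have "norm (\<beta> f g) \<le> norm f * norm g * 1" for f g
      using coefficient_products(2)[OF b c, of f g] abs_Re_le_cmod order_trans
      by (fastforce simp: \<beta>_def)
    then show "\<exists>K. \<forall>f g. norm (\<beta> f g) \<le> norm f * norm g * K" by blast
  qed
  then obtain T where T: "\<And>f g. \<beta> f g = inner (blinfun_apply T f) g"
    using bounded_bilinear_form_operator by blast
  have "T \<in> complex_ops"
    unfolding complex_ops_def
  proof (intro CollectI allI)
    fix z f
    have "inner (blinfun_apply T (z *\<^sub>C f)) g = inner (z *\<^sub>C blinfun_apply T f) g" for g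
    proof -
      have "\<beta> (z *\<^sub>C f) g = \<beta> f (cnj z *\<^sub>C g)"
        by (simp add: \<beta>_def cinner_scaleC_left mult_ac)
      then show ?thesis by (simp add: T inner_scaleC_cnj)
    qed
    then show "blinfun_apply T (z *\<^sub>C f) = z *\<^sub>C blinfun_apply T f"
      by (rule vector_eq_rdot[THEN iffD1, rule_format])
  qed
  then show ?thesis
    using T by (auto simp: \<beta>_def)
qed

text \<open>
  The transfer operators from \<open>b\<close> to \<open>c\<close> and from \<open>c\<close> to \<open>b\<close> are adjoint to each other because the defining
  series are conjugate, and inverse to each other because they preserve coefficients and
  both families are total.
\<close>

lemma ex_unitary_of_bases:
  fixes b c :: "'i \<Rightarrow> 'a::complex_hilbert"
  assumes b: "orthonormal_on I b" "total_family_on I b" and c: "orthonormal_on I c" "total_family_on I c"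
  shows "\<exists>u. unitary_op u \<and> (\<forall>i\<in>I. blinfun_apply u (b i) = c i)"
proof -
  have coeff: "cinner (blinfun_apply T f) (c j) = cinner f (b j)"
    if T: "\<And>f g. inner (blinfun_apply T f) g = Re (\<Sum>\<^sub>\<infinity>i\<in>I. cinner f (b i) * cnj (cinner g (c i)))"
      and c: "orthonormal_on I c" and j: "j \<in> I"
    for T and f and b c :: "'i \<Rightarrow> 'a" and j
  proof -
    have "inner (blinfun_apply T f) (z *\<^sub>C c j) = Re (cinner f (b j) * cnj z)" for z
    proof -
      have "(\<Sum>\<^sub>\<infinity>i\<in>I. cinner f (b i) * cnj (cinner (z *\<^sub>C c j) (c i))) =
          (\<Sum>\<^sub>\<infinity>i\<in>{j}. cinner f (b i) * cnj (cinner (z *\<^sub>C c j) (c i)))"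
        using c j by (intro infsum_cong_neutral) (auto simp: cinner_scaleC_left orthonormal_on_def)
      also have "\<dots> = cinner f (b j) * cnj z"
        using c j by (simp add: cinner_scaleC_left orthonormal_on_def)
      finally show ?thesis by (simp add: T)
    qed
    from this[of 1] this[of \<i>] show ?thesis
      by (simp add: cinner_eq_inner complex_eq_iff)
  qed
  obtain T where T: "T \<in> complex_ops"
    "\<And>f g. inner (blinfun_apply T f) g = Re (\<Sum>\<^sub>\<infinity>i\<in>I. cinner f (b i) * cnj (cinner g (c i)))"
    using ex_transfer_operator[OF b(1) c(1)] by blast
  obtain S where S: "S \<in> complex_ops"
    "\<And>f g. inner (blinfun_apply S f) g = Re (\<Sum>\<^sub>\<infinity>i\<in>I. cinner f (c i) * cnj (cinner g (b i)))"
    using ex_transfer_operator[OF c(1) b(1)] by blast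
  have "inner (blinfun_apply T f) g = inner f (blinfun_apply S g)" for f g
  proof -
    have "(\<Sum>\<^sub>\<infinity>i\<in>I. cinner g (c i) * cnj (cinner f (b i))) =
        cnj (\<Sum>\<^sub>\<infinity>i\<in>I. cinner f (b i) * cnj (cinner g (c i)))"
      unfolding infsum_cnj[symmetric] by (intro infsum_cong) simp
    then have "inner (blinfun_apply S g) f = inner (blinfun_apply T f) g"
      by (simp add: T S)
    then show ?thesis by (simp add: inner_commute)
  qed
  then have adj: "adjoint_op T = S"
    by (intro adjoint_op_eqI is_adjointI S)
  have "T o\<^sub>L S = id_blinfun"
    by (rule blinfun_eqI) (auto intro!: total_family_eqI[OF c(2)] simp: coeff[OF T(2) c(1)] coeff[OF S(2) b(1)])
  moreover have "S o\<^sub>L T = id_blinfun"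
    by (rule blinfun_eqI) (auto intro!: total_family_eqI[OF b(2)] simp: coeff[OF T(2) c(1)] coeff[OF S(2) b(1)])
  ultimately have "unitary_op T"
    using T(1) by (simp add: unitary_op_def adj)
  moreover have "blinfun_apply T (b i) = c i" if "i \<in> I" for i
    using that b(1) c(1)
    by (intro total_family_eqI[OF c(2)]) (auto simp: coeff[OF T(2) c(1)] orthonormal_on_def)
  ultimately show ?thesis by blast
qed

text \<open>
  Zorn's lemma: a maximal orthonormal set is total, as a nonzero vector orthogonal to it could be
  normalised and added.
\<close>

lemma ex_orthonormal_basis:
  "\<exists>B :: 'a::complex_inner set. orthonormal_on B (\<lambda>x. x) \<and> total_family_on B (\<lambda>x. x)"
proof -
  let ?A = "{B :: 'a set. orthonormal_on B (\<lambda>x. x)}"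
  have "\<exists>M\<in>?A. \<forall>X\<in>?A. M \<subseteq> X \<longrightarrow> X = M"
  proof (rule subset_Zorn')
    fix C assume C: "subset.chain ?A C"
    have "cinner x y = (if x = y then 1 else 0)" if xy: "x \<in> \<Union>C" "y \<in> \<Union>C" for x y
    proof -
      obtain X Y where XY: "X \<in> C" "x \<in> X" "Y \<in> C" "y \<in> Y" using xy by blast
      then have "X \<subseteq> Y \<or> Y \<subseteq> X" using C by (auto simp: subset_chain_def)
      then obtain Z where "Z \<in> C" "x \<in> Z" "y \<in> Z" using XY by blast
      moreover have "orthonormal_on Z (\<lambda>x. x)" using \<open>Z \<in> C\<close> C by (auto simp: subset_chain_def)
      ultimately show ?thesis by (simp add: orthonormal_on_def)
    qed
    then show "\<Union>C \<in> ?A" by (simp add: orthonormal_on_def)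
  qed
  then obtain B where B: "orthonormal_on B (\<lambda>x :: 'a. x)"
    and max: "\<And>X. orthonormal_on X (\<lambda>x. x) \<Longrightarrow> B \<subseteq> X \<Longrightarrow> X = B"
    by blast
  have "v = 0" if v: "\<forall>x\<in>B. cinner v x = 0" for v
  proof (rule ccontr)
    assume "v \<noteq> 0"
    define e where "e = complex_of_real (inverse (norm v)) *\<^sub>C v"
    have "norm e = 1"
      using \<open>v \<noteq> 0\<close> by (simp add: e_def norm_scaleC norm_inverse)
    then have ee: "cinner e e = 1"
      by (simp add: cinner_self)
    have ex: "cinner e x = 0" "cinner x e = 0" if "x \<in> B" for x
    proof -
      show "cinner e x = 0" using v that by (simp add: e_def cinner_scaleC_left)
      then show "cinner x e = 0" using cinner_commute[of x e] by simp
    qed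
    have "orthonormal_on (insert e B) (\<lambda>x. x)"
      using B ee ex by (auto simp: orthonormal_on_def)
    then have "e \<in> B" using max[of "insert e B"] by blast
    then show False using ee ex by force
  qed
  then show ?thesis using B by (auto simp: total_family_on_def)
qed

lemma finite_orthonormal_basis_spans:
  assumes B: "orthonormal_on B (\<lambda>x. x)" "total_family_on B (\<lambda>x. x)" and fin: "finite B"
  shows "cspan B = UNIV"
proof -
  have "v \<in> cspan B" for v
  proof -
    have "v = (\<Sum>x\<in>B. cinner v x *\<^sub>C x)"
      by (rule total_family_eqI[OF B(2)])
        (use cinner_orthonormal_combination[OF B(1) fin] in auto)
    also have "\<dots> \<in> cspan B"
      by (intro complex_vector.span_sum complex_vector.span_scale complex_vector.span_base)
    finally show ?thesis .
  qed
  then show ?thesis by blast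
qed

lemma
  assumes "orthonormal_on B (\<lambda>x. x)"
  shows orthonormal_on_delta: "orthonormal_on (UNIV \<times> B) (\<lambda>(x, e). delta x e)"
  using assms by (auto simp: orthonormal_on_def cinner_delta_right ell2_apply_delta)

lemma total_family_delta:
  assumes "total_family_on B (\<lambda>x. x)"
  shows "total_family_on (UNIV \<times> B) (\<lambda>(x, e). delta x e)"
  unfolding total_family_on_def
proof (intro allI impI)
  fix v assume v: "\<forall>i\<in>UNIV \<times> B. cinner v (case i of (x, e) \<Rightarrow> delta x e) = 0"
  have "ell2_apply v x = 0" for x
    using assms v by (fastforce simp: total_family_on_def cinner_delta_right)
  then show "v = 0" by (intro ell2_eqI) simp
qed


section \<open>Bijections inside a relation\<close>

text \<open>
  The Schroeder-Bernstein theorem for injections along a relation: the bijection agrees with \<open>f\<close> on one part of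
  \<open>A\<close> and with the inverse of \<open>g\<close> on the other, so it also stays inside the relation.
\<close>

lemma ex_bijection_in_relation:
  assumes f: "inj_on f A" "\<And>a. a \<in> A \<Longrightarrow> f a \<in> B \<and> R a (f a)"
    and g: "inj_on g B" "\<And>b. b \<in> B \<Longrightarrow> g b \<in> A \<and> R (g b) b"
  shows "\<exists>h. bij_betw h A B \<and> (\<forall>a\<in>A. R a (h a))"
proof -
  define X where "X = lfp (\<lambda>X. A - g ` (B - f ` X))"
  have X: "X = A - g ` (B - f ` X)"
    unfolding X_def by (rule lfp_unfold) (blast intro: monoI)
  define h where "h a = (if a \<in> X then f a else the_inv_into B g a)" for a
  have g_inv: "the_inv_into B g (g b) = b" if "b \<in> B" for b
    using g(1) that by (rule the_inv_into_f_f)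
  have AX: "A - X = g ` (B - f ` X)" using X g(2) by blast
  have XA: "X \<subseteq> A" using X by blast
  have "bij_betw h A B"
  proof (rule bij_betw_imageI)
    have "h ` X = f ` X" by (simp add: h_def)
    moreover have "h ` (A - X) = B - f ` X"
      unfolding AX image_image using AX by (auto simp: h_def g_inv image_iff)
    moreover have "h ` A = h ` X \<union> h ` (A - X)"
      unfolding image_Un[symmetric] by (simp only: Diff_partition[OF XA])
    moreover have "f ` X \<subseteq> B" using XA f(2) by blast
    ultimately show "h ` A = B" by simp blast
    show "inj_on h A"
    proof (rule inj_onI)
      fix a a' assume a: "a \<in> A" "a' \<in> A" "h a = h a'"
      have outside: "\<exists>b. a = g b \<and> b \<in> B \<and> b \<notin> f ` X \<and> h a = b" if "a \<in> A" "a \<notin> X" for a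
      proof -
        have "a \<in> A - X" using that by simp
        then obtain b where b: "b \<in> B - f ` X" "a = g b" unfolding AX by (rule imageE)
        have "h a = b" using that b(1) unfolding h_def b(2) by (simp add: g_inv)
        then show ?thesis using b by blast
      qed
      have inside: "h a \<in> f ` X" if "a \<in> X" for a
        using that by (simp add: h_def)
      show "a = a'"
      proof (cases "a \<in> X"; cases "a' \<in> X")
        assume "a \<in> X" "a' \<in> X"
        then show ?thesis using a f(1) by (simp add: h_def inj_on_def)
      next
        assume "a \<in> X" "a' \<notin> X"
        then show ?thesis using inside[of a] outside[OF a(2)] a(3) by auto
      next
        assume "a \<notin> X" "a' \<in> X"
        then show ?thesis using inside[of a'] outside[OF a(1)] a(3) by auto
      next
        assume "a \<notin> X" "a' \<notin> X"
        then show ?thesis using a outside[of a] outside[of a'] by metis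
      qed
    qed
  qed
  moreover have "R a (h a)" if "a \<in> A" for a
  proof (cases "a \<in> X")
    case True
    then show ?thesis using f(2) that by (simp add: h_def)
  next
    case False
    have "a \<in> A - X" using that False by simp
    then obtain b where b: "b \<in> B" "a = g b" unfolding AX by blast
    have "h a = b" using False b(1) unfolding h_def b(2) by (simp add: g_inv)
    then show ?thesis using g(2)[OF b(1)] b(2) by simp
  qed
  ultimately show ?thesis by blast
qed

lemma ex_injection_Times_infinite:
  includes cardinal_syntax
  assumes "infinite B"
  shows "\<exists>p :: int \<times> 'b \<Rightarrow> 'b. inj_on p (UNIV \<times> B) \<and> p ` (UNIV \<times> B) \<subseteq> B"
proof -
  have "|UNIV :: int set| \<le>o |B|"
  proof -
    obtain f :: "nat \<Rightarrow> 'b" where f: "inj f" "range f \<subseteq> B"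
      using assms infinite_countable_subset by blast
    have "inj (f \<circ> to_nat :: int \<Rightarrow> 'b)" using f(1) by (simp add: inj_compose)
    then show ?thesis
      unfolding card_of_ordLeq[symmetric] using f(2) by (intro exI[of _ "f \<circ> to_nat"]) auto
  qed
  then have "|(UNIV :: int set) \<times> B| \<le>o |B|"
    using card_of_Times_infinite[OF assms, of "UNIV :: int set"] ordIso_iff_ordLeq by blast
  then show ?thesis by (simp add: card_of_ordLeq[symmetric])
qed


section \<open>Inner automorphisms determine the unitary up to a scalar\<close>

definition rank_one :: "'a::complex_inner \<Rightarrow> 'a \<Rightarrow> 'a \<Rightarrow>\<^sub>L 'a"
  where "rank_one f g = Blinfun (\<lambda>z. cinner z g *\<^sub>C f)"

lemma rank_one_apply: "blinfun_apply (rank_one f g) z = cinner z g *\<^sub>C f"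
proof -
  have "bounded_linear (\<lambda>z. cinner z g *\<^sub>C f)"
  proof (rule bounded_linear_intro[where K = "2 * norm g * norm f"])
    show "cinner (r *\<^sub>R z) g *\<^sub>C f = r *\<^sub>R (cinner z g *\<^sub>C f)" for r z
      by (simp add: cinner_scaleC_left scaleC_scaleC flip: scaleC_of_real)
    show "norm (cinner z g *\<^sub>C f) \<le> norm z * (2 * norm g * norm f)" for z
      using mult_right_mono[OF norm_cinner_le[of z g] norm_ge_zero[of f]]
      by (simp add: norm_scaleC mult_ac)
  qed (simp add: cinner_add_left scaleC_add_left)
  then show ?thesis by (simp add: rank_one_def bounded_linear_Blinfun_apply)
qed

lemma rank_one_complex_ops: "rank_one f g \<in> complex_ops"
  by (simp add: complex_ops_def rank_one_apply cinner_scaleC_left scaleC_scaleC)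

lemma compact_op_rank_one: "compact_op (rank_one f g :: 'a::complex_hilbert \<Rightarrow>\<^sub>L 'a)"
proof -
  have bl: "bounded_linear (\<lambda>c. c *\<^sub>C f)"
  proof (rule bounded_linear_intro[where K = "norm f"])
    show "(r *\<^sub>R c) *\<^sub>C f = r *\<^sub>R (c *\<^sub>C f)" for r c
      by (simp add: scaleC_scaleC scaleR_conv_of_real flip: scaleC_of_real)
  qed (auto simp: scaleC_add_left norm_scaleC)
  have "compact ((\<lambda>c. c *\<^sub>C f) ` cball 0 (2 * norm g))"
    by (intro compact_continuous_image linear_continuous_on bl compact_cball)
  moreover have "blinfun_apply (rank_one f g) ` cball 0 1 \<subseteq> (\<lambda>c. c *\<^sub>C f) ` cball 0 (2 * norm g)"
  proof -
    have "norm (cinner z g) \<le> 2 * norm g" if "norm z \<le> 1" for z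
      using norm_cinner_le[of z g] mult_right_mono[OF that norm_ge_zero[of g]] by simp
    then show ?thesis by (auto simp: rank_one_apply)
  qed
  ultimately show ?thesis
    unfolding compact_op_def by (rule compact_closure_subset)
qed

lemma rank_one_delta_Roe:
  fixes \<xi> \<eta> :: "'h::complex_hilbert"
  shows "rank_one (delta x \<xi>) (delta y \<eta>) \<in> (Roe :: (int, 'h) ell2_op set)"
proof -
  let ?a = "rank_one (delta x \<xi>) (delta y \<eta>)"
  have e: "entry ?a x' y' = (if x' = y \<and> y' = x then rank_one \<xi> \<eta> else 0)" for x' y'
    by (rule blinfun_eqI) (auto simp: entry_apply rank_one_apply cinner_delta_right ell2_apply_delta)
  have "supported_in ?a (near \<bar>x - y\<bar>)"
    by (auto simp: supported_in_def rank_one_complex_ops e near_def)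
  moreover have "compact_entries ?a"
    by (simp add: compact_entries_def rank_one_complex_ops e compact_op_rank_one compact_op_zero)
  ultimately show ?thesis using supported_near_BD by (simp add: Roe_iff)
qed

text \<open>
  If \<open>Ad v = Ad w\<close>, then \<open>w\<^sup>* v\<close> commutes with the Roe algebra. Commuting with the rank one operator from a
  fixed unit vector \<open>h\<close> to \<open>\<delta>\<^sub>x \<otimes> \<xi>\<close> forces \<open>w\<^sup>* v\<close> to multiply \<open>\<delta>\<^sub>x \<otimes> \<xi>\<close> by its diagonal coefficient at \<open>h\<close>.
\<close>

lemma Ad_eq_imp_proportional:
  fixes v w :: "(int, 'h::complex_hilbert) ell2_op"
  assumes v: "unitary_op v" and w: "unitary_op w" and eq: "Ad v = Ad w" and ne: "\<exists>e :: 'h. e \<noteq> 0"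
  shows "\<exists>c. norm c = 1 \<and> (\<forall>x \<xi>. blinfun_apply v (delta x \<xi>) = c *\<^sub>C blinfun_apply w (delta x \<xi>))"
proof -
  obtain e' :: 'h where "e' \<noteq> 0" using ne by blast
  define e where "e = complex_of_real (inverse (norm e')) *\<^sub>C e'"
  have e: "norm e = 1" using \<open>e' \<noteq> 0\<close> by (simp add: e_def norm_scaleC norm_inverse)
  define h where "h = (delta 0 e :: (int, 'h) ell2)"
  have hh: "cinner h h = 1" by (simp add: h_def cinner_self norm_delta e)
  define T where "T = adjoint_op w o\<^sub>L v"
  define c where "c = cinner (blinfun_apply T h) h"
  have main: "blinfun_apply v (delta x \<xi>) = c *\<^sub>C blinfun_apply w (delta x \<xi>)" for x \<xi>
  proof -
    define a where "a = rank_one (delta x \<xi>) h"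
    have "a \<in> Roe" unfolding a_def h_def by (rule rank_one_delta_Roe)
    then have "conj_op v a = conj_op w a" using fun_cong[OF eq, of a] by (simp add: Ad_def)
    then have "blinfun_apply (conj_op v a) (blinfun_apply v h) = blinfun_apply (conj_op w a) (blinfun_apply v h)"
      by simp
    then have "blinfun_apply v (delta x \<xi>) = blinfun_apply w (blinfun_apply a (blinfun_apply T h))"
      by (simp add: conj_op_def T_def unitary_apply[OF v]) (simp add: a_def rank_one_apply hh)
    also have "\<dots> = c *\<^sub>C blinfun_apply w (delta x \<xi>)"
      by (simp add: a_def rank_one_apply c_def complex_opsD[OF unitary_complex_ops[OF w]])
    finally show ?thesis .
  qed
  have "norm (blinfun_apply v h) = norm c * norm (blinfun_apply w h)"
    unfolding h_def main by (simp add: norm_scaleC)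
  then have "norm c = 1" by (simp add: unitary_norm v w h_def norm_delta e)
  then show ?thesis using main by blast
qed


section \<open>Quasi-actions on the integers\<close>

text \<open>
  The fibres of \<open>F\<close> may be large and \<open>F\<close> may miss points. Both are repaired in the second
  coordinate of \<open>\<int> \<times> B\<close>: the maps \<open>(x, e) \<mapsto> (F x, p (x, e))\<close> and \<open>(y, e) \<mapsto> (G y, p (y, e))\<close> are injective if
  \<open>p\<close> is an injection of \<open>\<int> \<times> B\<close> into \<open>B\<close>, and both run along the relation \<open>\<bar>F x - y\<bar> \<le> C\<close>. The final
  clause exhibits matrix coefficients of modulus one near every point \<open>(x, F x)\<close>.
\<close>

lemma ex_unitary_near_map:
  fixes F :: "int \<Rightarrow> int"
  assumes infinite_dimensional: "\<nexists>B :: 'h::complex_hilbert set. finite B \<and> cspan B = UNIV"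
    and C: "\<And>y. \<bar>F (G y) - y\<bar> \<le> C" "0 \<le> C"
  shows "\<exists>u :: (int, 'h) ell2_op. unitary_op u \<and> supported_in u {(x, y). \<bar>F x - y\<bar> \<le> C} \<and>
    (\<forall>x. \<exists>e y e'. norm e = 1 \<and> norm e' = 1 \<and> \<bar>F x - y\<bar> \<le> C \<and>
      blinfun_apply u (delta x e) = delta y e')"
proof -
  obtain B :: "'h set" where B: "orthonormal_on B (\<lambda>x. x)" "total_family_on B (\<lambda>x. x)"
    using ex_orthonormal_basis by blast
  have "infinite B"
    using finite_orthonormal_basis_spans[OF B] infinite_dimensional by blast
  then obtain p :: "int \<times> 'h \<Rightarrow> 'h" where p: "inj_on p (UNIV \<times> B)" "p ` (UNIV \<times> B) \<subseteq> B"
    using ex_injection_Times_infinite by blast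
  let ?A = "(UNIV :: int set) \<times> B"
  let ?R = "\<lambda>a a' :: int \<times> 'h. \<bar>F (fst a) - fst a'\<bar> \<le> C"
  have inj: "inj_on (\<lambda>a. (f (fst a) :: int, p a)) ?A" for f
    using p(1) by (auto simp: inj_on_def)
  have pB: "p a \<in> B" if "a \<in> ?A" for a using that p(2) by blast
  have "\<exists>h. bij_betw h ?A ?A \<and> (\<forall>a\<in>?A. ?R a (h a))"
    by (rule ex_bijection_in_relation[OF inj[of F] _ inj[of G]]) (use pB C in auto)
  then obtain \<pi> where \<pi>: "bij_betw \<pi> ?A ?A" "\<And>a. a \<in> ?A \<Longrightarrow> ?R a (\<pi> a)"
    by blast
  define b where "b = (\<lambda>(x, e). delta x e :: (int, 'h) ell2)"
  have b: "orthonormal_on ?A b" "total_family_on ?A b"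
    unfolding b_def using orthonormal_on_delta[OF B(1)] total_family_delta[OF B(2)] by auto
  have inj_\<pi>: "inj_on \<pi> ?A" and im_\<pi>: "\<pi> ` ?A = ?A"
    using \<pi>(1) by (auto simp: bij_betw_def)
  have "orthonormal_on ?A (b \<circ> \<pi>)"
    unfolding orthonormal_on_def
  proof (intro ballI)
    fix i j assume ij: "i \<in> ?A" "j \<in> ?A"
    have "\<pi> i \<in> ?A" "\<pi> j \<in> ?A"
      using imageI[OF ij(1), of \<pi>] imageI[OF ij(2), of \<pi>] unfolding im_\<pi> .
    then have "cinner (b (\<pi> i)) (b (\<pi> j)) = (if \<pi> i = \<pi> j then 1 else 0)"
      using b(1)[unfolded orthonormal_on_def, rule_format, of "\<pi> i" "\<pi> j"] by simp
    also have "\<dots> = (if i = j then 1 else 0)"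
      using inj_on_eq_iff[OF inj_\<pi> ij] by simp
    finally show "cinner ((b \<circ> \<pi>) i) ((b \<circ> \<pi>) j) = (if i = j then 1 else 0)" by simp
  qed
  moreover have "total_family_on ?A (b \<circ> \<pi>)"
    unfolding total_family_on_def
  proof (intro allI impI)
    fix v assume v: "\<forall>i\<in>?A. cinner v ((b \<circ> \<pi>) i) = 0"
    have "cinner v (b j) = 0" if "j \<in> ?A" for j
    proof -
      have "j \<in> \<pi> ` ?A" unfolding im_\<pi> by (rule that)
      then obtain i where "i \<in> ?A" "j = \<pi> i" by blast
      then show ?thesis using bspec[OF v, of i] by simp
    qed
    then show "v = 0" using b(2) by (simp add: total_family_on_def)
  qed
  ultimately obtain u where u: "unitary_op u" "\<And>i. i \<in> ?A \<Longrightarrow> blinfun_apply u (b i) = b (\<pi> i)"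
    using ex_unitary_of_bases[OF b, of "b \<circ> \<pi>"] unfolding comp_apply by blast
  have norm_B: "norm e = 1" if "e \<in> B" for e
  proof -
    have "cinner e e = 1"
      using B(1) that by (simp add: orthonormal_on_def)
    then have "inner e e = 1"
      by (simp add: inner_eq_Re_cinner)
    then show ?thesis by (simp add: norm_eq_sqrt_inner)
  qed
  have "supported_in u {(x, y). \<bar>F x - y\<bar> \<le> C}"
    unfolding supported_in_def
  proof (intro conjI allI impI)
    show "u \<in> complex_ops" using u(1) by (rule unitary_complex_ops)
    fix x y assume far: "(x, y) \<notin> {(x, y). \<bar>F x - y\<bar> \<le> C}"
    show "entry u x y = 0"
    proof (rule blinfun_eqI)
      fix \<xi>
      have "cinner (blinfun_apply (entry u x y) \<xi>) e = 0" if e: "e \<in> B" for e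
      proof -
        have "(y, e) \<in> \<pi> ` ?A" unfolding im_\<pi> using e by simp
        then obtain x' e' where x': "(x', e') \<in> ?A" "\<pi> (x', e') = (y, e)" by force
        then have "\<bar>F x' - y\<bar> \<le> C" using \<pi>(2)[OF x'(1)] by simp
        then have "x' \<noteq> x" using far by auto
        have "cinner (blinfun_apply (entry u x y) \<xi>) e = cinner (blinfun_apply u (delta x \<xi>)) (delta y e)"
          by (simp add: entry_apply cinner_delta_right)
        also have "delta y e = blinfun_apply u (delta x' e')"
          using u(2)[OF x'(1)] x'(2) by (simp add: b_def)
        also have "cinner (blinfun_apply u (delta x \<xi>)) (blinfun_apply u (delta x' e')) =
            cinner (delta x \<xi>) (delta x' e')"
          by (simp add: cinner_adjoint[OF unitary_complex_ops[OF u(1)]] unitary_apply[OF u(1)])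
        also have "\<dots> = 0"
          using \<open>x' \<noteq> x\<close> by (simp add: cinner_delta_right ell2_apply_delta)
        finally show ?thesis .
      qed
      then show "blinfun_apply (entry u x y) \<xi> = blinfun_apply 0 \<xi>"
        using B(2) by (simp add: total_family_on_def)
    qed
  qed
  moreover have "\<exists>e y e'. norm e = 1 \<and> norm e' = 1 \<and> \<bar>F x - y\<bar> \<le> C \<and>
      blinfun_apply u (delta x e) = delta y e'" for x
  proof -
    have "B \<noteq> {}" using \<open>infinite B\<close> by auto
    then obtain e where e: "e \<in> B" by blast
    obtain y e' where y: "\<pi> (x, e) = (y, e')" by fastforce
    have "\<pi> (x, e) \<in> \<pi> ` ?A" using e by (intro imageI) simp
    then have "e' \<in> B" unfolding im_\<pi> y by simp
    moreover have "\<bar>F x - y\<bar> \<le> C" using \<pi>(2)[of "(x, e)"] e y by simp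
    moreover have "blinfun_apply u (delta x e) = delta y e'"
      using u(2)[of "(x, e)"] e y by (simp add: b_def)
    ultimately show ?thesis using norm_B e by blast
  qed
  ultimately show ?thesis using u(1) by blast
qed

text \<open>
  The unitary implementing \<open>k\<close> is supported near the graph of \<open>F k\<close>. This graph is coarse, as
  \<open>F (inv k)\<close> is a Lipschitz inverse of \<open>F k\<close> up to bounded errors.
\<close>

theorem contains_copy_Out_Roe_of_quasi_action:
  fixes K (structure) and F :: "'k \<Rightarrow> int \<Rightarrow> int"
  assumes infinite_dimensional: "\<nexists>B :: 'h::complex_hilbert set. finite B \<and> cspan B = UNIV"
    and K: "group K"
    and lip: "\<And>k. k \<in> carrier K \<Longrightarrow> \<exists>L\<ge>0. \<forall>x y. \<bar>F k x - F k y\<bar> \<le> L * \<bar>x - y\<bar> + L"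
    and mult: "\<And>k l. k \<in> carrier K \<Longrightarrow> l \<in> carrier K \<Longrightarrow> \<exists>C. \<forall>x. \<bar>F k (F l x) - F (k \<otimes> l) x\<bar> \<le> C"
    and one: "\<exists>C. \<forall>x. \<bar>F \<one> x - x\<bar> \<le> C"
    and faithful: "\<And>k C. k \<in> carrier K \<Longrightarrow> \<forall>x. \<bar>F k x - x\<bar> \<le> C \<Longrightarrow> k = \<one>"
  shows "contains_copy (Out_Roe :: ((int, 'h) ell2_op \<Rightarrow> (int, 'h) ell2_op) set monoid) K"
proof -
  interpret K: group K by fact
  have quasi_inv: "\<exists>C. \<forall>x. \<bar>F k (F l x) - x\<bar> \<le> C"
    if kl: "k \<in> carrier K" "l \<in> carrier K" "k \<otimes> l = \<one>" for k l
  proof -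
    obtain C where C: "\<And>x. \<bar>F k (F l x) - F \<one> x\<bar> \<le> C" using mult[OF kl(1,2)] kl(3) by auto
    obtain D where D: "\<And>x. \<bar>F \<one> x - x\<bar> \<le> D" using one by blast
    have "\<bar>F k (F l x) - x\<bar> \<le> C + D" for x using C[of x] D[of x] by linarith
    then show ?thesis by blast
  qed
  define near_map where "near_map k C = {(x, y). \<bar>F k x - y\<bar> \<le> C}" for k and C :: int
  have "\<exists>u :: (int, 'h) ell2_op. \<exists>C\<ge>0. unitary_op u \<and> supported_in u (near_map k C) \<and>
      (\<forall>x. \<exists>e y e'. norm e = 1 \<and> norm e' = 1 \<and> \<bar>F k x - y\<bar> \<le> C \<and>
        blinfun_apply u (delta x e) = delta y e')" if k: "k \<in> carrier K" for k
  proof -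
    obtain C where C: "\<And>x. \<bar>F k (F (inv k) x) - x\<bar> \<le> C"
      using quasi_inv[OF k K.inv_closed[OF k]] k by auto
    have "0 \<le> C" using C[of 0] by linarith
    then show ?thesis
      using ex_unitary_near_map[OF infinite_dimensional, of "F k" "F (inv k)" C] C
      unfolding near_map_def by blast
  qed
  then obtain u :: "'k \<Rightarrow> (int, 'h) ell2_op" and C where
    C: "\<And>k. k \<in> carrier K \<Longrightarrow> 0 \<le> C k" and
    unitary: "\<And>k. k \<in> carrier K \<Longrightarrow> unitary_op (u k)" and
    supp: "\<And>k. k \<in> carrier K \<Longrightarrow> supported_in (u k) (near_map k (C k))" and
    moves: "\<And>k x. k \<in> carrier K \<Longrightarrow> \<exists>e y e'. norm e = 1 \<and> norm e' = 1 \<and> \<bar>F k x - y\<bar> \<le> C k \<and>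
        blinfun_apply (u k) (delta x e) = delta y e'"
    by metis
  have coarse: "coarse_rel (near_map k (C k))" if k: "k \<in> carrier K" for k
    unfolding coarse_rel_def
  proof
    fix r
    obtain L where L: "0 \<le> L" "\<And>x y. \<bar>F k x - F k y\<bar> \<le> L * \<bar>x - y\<bar> + L" using lip[OF k] by blast
    obtain M where M: "0 \<le> M" "\<And>x y. \<bar>F (inv k) x - F (inv k) y\<bar> \<le> M * \<bar>x - y\<bar> + M"
      using lip[OF K.inv_closed[OF k]] by blast
    obtain D where D: "\<And>x. \<bar>F (inv k) (F k x) - x\<bar> \<le> D"
      using quasi_inv[OF K.inv_closed[OF k] k] k by auto
    define s1 where "s1 = 2 * C k + L * r + L"
    define s2 where "s2 = 2 * D + M * (2 * C k + r) + M"
    have 1: "(near_map k (C k))\<inverse> O near r O near_map k (C k) \<subseteq> near s1"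
    proof (clarsimp simp: near_map_def near_def)
      fix y x x' y' assume a: "\<bar>F k x - y\<bar> \<le> C k" "\<bar>x - x'\<bar> \<le> r" "\<bar>F k x' - y'\<bar> \<le> C k"
      have "L * \<bar>x - x'\<bar> \<le> L * r" using a(2) L(1) by (rule mult_left_mono)
      then show "\<bar>y - y'\<bar> \<le> s1" using a L(2)[of x x'] unfolding s1_def by linarith
    qed
    have 2: "near_map k (C k) O near r O (near_map k (C k))\<inverse> \<subseteq> near s2"
    proof (clarsimp simp: near_map_def near_def)
      fix x y y' x' assume a: "\<bar>F k x - y\<bar> \<le> C k" "\<bar>y - y'\<bar> \<le> r" "\<bar>F k x' - y'\<bar> \<le> C k"
      have "\<bar>F k x - F k x'\<bar> \<le> 2 * C k + r" using a by linarith
      then have "M * \<bar>F k x - F k x'\<bar> \<le> M * (2 * C k + r)" using M(1) by (rule mult_left_mono)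
      then show "\<bar>x - x'\<bar> \<le> s2"
        using M(2)[of "F k x" "F k x'"] D[of x] D[of x'] unfolding s2_def by linarith
    qed
    show "\<exists>s. (near_map k (C k))\<inverse> O near r O near_map k (C k) \<subseteq> near s \<and>
        near_map k (C k) O near r O (near_map k (C k))\<inverse> \<subseteq> near s"
      using 1 2 near_mono[of s1 "max s1 s2"] near_mono[of s2 "max s1 s2"]
      by (intro exI[of _ "max s1 s2"]) auto
  qed
  have norm_u: "normalising (u k)" if "k \<in> carrier K" for k
    using coarse[OF that] supp[OF that] unitary[OF that] by (rule normalising_coarse)
  have nontrivial: "\<exists>e :: 'h. e \<noteq> 0"
  proof -
    obtain e :: 'h where "norm e = 1" using moves[OF K.one_closed, of 0] by blast
    then show ?thesis by (intro exI[of _ e]) auto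
  qed
  show ?thesis
    unfolding Out_Roe_def
  proof (rule contains_copy_FactGroup[OF group_Aut_Roe subgroup_Inn_BD K, where \<phi> = "\<lambda>k. Ad (u k)"])
    fix k assume k: "k \<in> carrier K"
    show "Ad (u k) \<in> carrier Aut_Roe" using norm_u[OF k] by (rule Ad_carrier)
    show "Ad (u k) \<otimes>\<^bsub>Aut_Roe\<^esub> n \<otimes>\<^bsub>Aut_Roe\<^esub> inv\<^bsub>Aut_Roe\<^esub> (Ad (u k)) \<in> Inn_BD" if "n \<in> Inn_BD" for n
      using norm_u[OF k] that by (rule Ad_normalises_Inn_BD)
    show "Ad (u k) \<otimes>\<^bsub>Aut_Roe\<^esub> Ad (u l) \<otimes>\<^bsub>Aut_Roe\<^esub> inv\<^bsub>Aut_Roe\<^esub> (Ad (u (k \<otimes> l))) \<in> Inn_BD"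
      if l: "l \<in> carrier K" for l
    proof -
      have kl: "k \<otimes> l \<in> carrier K" using k l by simp
      define w where "w = u k o\<^sub>L u l o\<^sub>L adjoint_op (u (k \<otimes> l))"
      obtain L where L: "0 \<le> L" "\<And>x y. \<bar>F k x - F k y\<bar> \<le> L * \<bar>x - y\<bar> + L" using lip[OF k] by blast
      obtain D where D: "\<And>x. \<bar>F k (F l x) - F (k \<otimes> l) x\<bar> \<le> D" using mult[OF k l] by blast
      define s where "s = C (k \<otimes> l) + D + L * C l + L + C k"
      have "supported_in (u k o\<^sub>L u l) (near_map l (C l) O near_map k (C k))"
        by (rule supported_in_compose[OF supp[OF k] supp[OF l] coarse_rel_finite[OF coarse[OF l]]])
      then have "supported_in w ((near_map (k \<otimes> l) (C (k \<otimes> l)))\<inverse> O near_map l (C l) O near_map k (C k))"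
        unfolding w_def
        by (rule supported_in_compose[OF _ supported_in_adjoint[OF supp[OF kl]]])
          (rule coarse_rel_finite[OF coarse_rel_converse[OF coarse[OF kl]]])
      moreover have "(near_map (k \<otimes> l) (C (k \<otimes> l)))\<inverse> O near_map l (C l) O near_map k (C k) \<subseteq> near s"
      proof (clarsimp simp: near_map_def near_def)
        fix y x v z assume a: "\<bar>F (k \<otimes> l) x - y\<bar> \<le> C (k \<otimes> l)" "\<bar>F l x - v\<bar> \<le> C l" "\<bar>F k v - z\<bar> \<le> C k"
        have "L * \<bar>F l x - v\<bar> \<le> L * C l" using a(2) L(1) by (rule mult_left_mono)
        then show "\<bar>y - z\<bar> \<le> s" using a L(2)[of "F l x" v] D[of x] unfolding s_def by linarith
      qed
      ultimately have "w \<in> BD" by (blast intro: supported_near_BD supported_in_mono)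
      moreover have "unitary_op w"
        unfolding w_def by (intro unitary_compose unitary_adjoint unitary k l kl)
      moreover have "Ad (u k) \<otimes>\<^bsub>Aut_Roe\<^esub> Ad (u l) \<otimes>\<^bsub>Aut_Roe\<^esub> inv\<^bsub>Aut_Roe\<^esub> (Ad (u (k \<otimes> l))) = Ad w"
        unfolding w_def using norm_u k l kl
        by (simp add: Ad_inv Ad_compose normalising_compose normalising_adjoint)
      ultimately show ?thesis unfolding Inn_BD_eq by blast
    qed
    assume "Ad (u k) \<in> Inn_BD"
    then obtain w where w: "Ad (u k) = Ad w" "w \<in> BD" "unitary_op w" unfolding Inn_BD_eq by blast
    obtain c where c: "norm c = 1" "\<And>x \<xi>. blinfun_apply (u k) (delta x \<xi>) = c *\<^sub>C blinfun_apply w (delta x \<xi>)"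
      using Ad_eq_imp_proportional[OF unitary[OF k] w(3,1) nontrivial] by blast
    \<comment> \<open>Below \<open>1/2\<close> because the bound \<open>norm_cinner_le\<close> for the inner product has a factor 2.\<close>
    obtain b r where b: "supported_in b (near r)" "norm (w - b) < 1/4"
      using BD_approx[OF w(2), of "1/4"] by auto
    have "\<bar>F k x - x\<bar> \<le> C k + r" for x
    proof -
      obtain e y e' where e: "norm e = 1" "norm e' = 1" "\<bar>F k x - y\<bar> \<le> C k"
        "blinfun_apply (u k) (delta x e) = delta y e'"
        using moves[OF k] by blast
      have "\<bar>x - y\<bar> \<le> r"
      proof (rule ccontr)
        assume far: "\<not> \<bar>x - y\<bar> \<le> r"
        have "entry b x y = 0"
          using b(1) far by (auto simp: supported_in_def near_def)
        then have b0: "cinner (blinfun_apply b (delta x e)) (delta y e') = 0"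
          by (simp add: cinner_delta_right flip: entry_apply)
        have "1 = norm (cinner (delta y e') (delta y e'))"
          by (simp add: cinner_self norm_delta e)
        also have "\<dots> = norm (cinner (blinfun_apply w (delta x e)) (delta y e'))"
          by (subst (1) e(4)[symmetric]) (simp add: c cinner_scaleC_left norm_mult)
        also have "\<dots> = norm (cinner (blinfun_apply (w - b) (delta x e)) (delta y e'))"
          by (simp add: blinfun.diff_left cinner_diff_left b0)
        also have "\<dots> \<le> 2 * (norm (blinfun_apply (w - b) (delta x e)) * norm (delta y e'))"
          by (rule norm_cinner_le)
        also have "\<dots> \<le> 2 * norm (w - b)"
          using norm_blinfun[of "w - b" "delta x e"] by (simp add: norm_delta e)
        also have "\<dots> < 1" using b(2) by simp
        finally show False by simp
      qed
      then show ?thesis using e(3) by linarith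
    qed
    then show "k = \<one>" using faithful[OF k] by blast
  qed
qed


section \<open>From actions on the unit interval to quasi-actions on the integers\<close>

definition dyadic_level :: "real \<Rightarrow> nat"
  where "dyadic_level x = (LEAST m. x < 2 ^ Suc m)"

lemma dyadic_level:
  assumes "1 \<le> x"
  shows "2 ^ dyadic_level x \<le> x" "x < 2 ^ Suc (dyadic_level x)"
proof -
  obtain n where "x < 2 ^ n" using real_arch_pow[of 2 x] by auto
  then have "x < 2 ^ Suc n" by (rule order_less_le_trans) simp
  then show "x < 2 ^ Suc (dyadic_level x)"
    unfolding dyadic_level_def by (rule LeastI)
  show "2 ^ dyadic_level x \<le> x"
  proof (cases "dyadic_level x")
    case (Suc m)
    then have "\<not> x < 2 ^ Suc m"
      unfolding dyadic_level_def using not_less_Least[of m "\<lambda>m. x < 2 ^ Suc m"] by simp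
    then show ?thesis using Suc by simp
  qed (use assms in simp)
qed

lemma dyadic_level_eqI:
  assumes "2 ^ m \<le> x" "x < 2 ^ Suc m"
  shows "dyadic_level x = m"
  unfolding dyadic_level_def
proof (rule Least_equality)
  show "x < 2 ^ Suc m" by fact
  fix n assume "x < 2 ^ Suc n"
  then have "(2::real) ^ m < 2 ^ Suc n" using assms(1) by linarith
  then have "m < Suc n" by (simp only: power_strict_increasing_iff)
  then show "m \<le> n" by simp
qed

text \<open>
  A copy of \<open>f n\<close>, rescaled by \<open>2\<^sup>n\<close>, on each interval \<open>[2\<^sup>n, 2\<^sup>n\<^sup>+\<^sup>1]\<close>.
\<close>

definition spread :: "(nat \<Rightarrow> real \<Rightarrow> real) \<Rightarrow> real \<Rightarrow> real"
  where "spread f x = (if x < 1 then x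
    else 2 ^ dyadic_level x * (1 + f (dyadic_level x) (x / 2 ^ dyadic_level x - 1)))"

locale interval_maps =
  fixes f :: "nat \<Rightarrow> real \<Rightarrow> real" and L :: real
  assumes lip: "\<And>n. L-lipschitz_on {0..1} (f n)"
    and ends [simp]: "\<And>n. f n 0 = 0" "\<And>n. f n 1 = 1"
    and maps: "\<And>n t. t \<in> {0..1} \<Longrightarrow> f n t \<in> {0..1}"
begin

lemma one_le_L: "1 \<le> L"
  using lipschitz_onD[OF lip[of 0], of 0 1] by (simp add: dist_real_def)

text \<open>
  As the \<open>f n\<close> fix the end points, the formulas of adjacent intervals agree at the common end point; hence
  closed intervals are allowed here.
\<close>

lemma spread_block:
  assumes "2 ^ m \<le> x" "x \<le> 2 ^ Suc m"
  shows "spread f x = 2 ^ m * (1 + f m (x / 2 ^ m - 1))"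
proof -
  have "1 \<le> (2::real) ^ m" by simp
  then have x: "1 \<le> x" using assms(1) by linarith
  show ?thesis
  proof (cases "x = 2 ^ Suc m")
    case True
    have "dyadic_level x = Suc m" unfolding True by (rule dyadic_level_eqI) auto
    then show ?thesis using x True by (simp add: spread_def)
  next
    case False
    then have "dyadic_level x = m" using assms by (intro dyadic_level_eqI) auto
    then show ?thesis using x by (simp add: spread_def)
  qed
qed

lemma rescaled_block:
  assumes "2 ^ m \<le> x" "x \<le> 2 ^ Suc m"
  shows "x / 2 ^ m - 1 \<in> {0..(1::real)}"
  using assms by (auto simp: field_simps)

lemma spread_in_block:
  assumes "2 ^ m \<le> x" "x \<le> 2 ^ Suc m"
  shows "2 ^ m \<le> spread f x" "spread f x \<le> 2 ^ Suc m"
  using maps[OF rescaled_block[OF assms], of m] unfolding spread_block[OF assms] by simp_all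

lemma spread_node: "spread f (2 ^ m) = 2 ^ m"
  by (subst spread_block[of m]) auto

lemma spread_lipschitz_block:
  assumes "2 ^ m \<le> x" "x \<le> 2 ^ Suc m" "2 ^ m \<le> y" "y \<le> 2 ^ Suc m"
  shows "\<bar>spread f x - spread f y\<bar> \<le> L * \<bar>x - y\<bar>"
proof -
  let ?s = "x / 2 ^ m - 1" and ?t = "y / 2 ^ m - 1"
  have "\<bar>spread f x - spread f y\<bar> = 2 ^ m * \<bar>f m ?s - f m ?t\<bar>"
    unfolding spread_block[OF assms(1,2)] spread_block[OF assms(3,4)]
    by (simp add: abs_mult flip: right_diff_distrib)
  also have "\<dots> \<le> 2 ^ m * (L * \<bar>?s - ?t\<bar>)"
    using lipschitz_onD[OF lip rescaled_block[OF assms(1,2)] rescaled_block[OF assms(3,4)], of m]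
    by (simp add: dist_real_def)
  also have "\<dots> = L * \<bar>x - y\<bar>"
    by (simp add: abs_divide flip: diff_divide_distrib)
  finally show ?thesis .
qed

text \<open>
  Two points in different intervals are joined through the fixed points \<open>2\<^sup>m\<close> between them; the Lipschitz
  constant does not grow since it is at least 1.
\<close>

lemma spread_lipschitz: "\<bar>spread f x - spread f y\<bar> \<le> L * \<bar>x - y\<bar>"
proof -
  have main: "\<bar>spread f x - spread f y\<bar> \<le> L * (y - x)" if "x \<le> y" for x y
  proof -
    have id_le: "q - p \<le> L * (q - p)" if "p \<le> q" for p q
      using mult_right_mono[OF one_le_L, of "q - p"] that by simp
    have up: "\<exists>p. x \<le> p \<and> p \<le> y \<and> \<bar>spread f x - p\<bar> \<le> L * (p - x)"
      if "x < 1 \<or> dyadic_level x < dyadic_level y \<and> 1 \<le> y"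
    proof (cases "x < 1")
      case True
      then show ?thesis using \<open>x \<le> y\<close> by (intro exI[of _ x]) (simp add: spread_def)
    next
      case False
      then have x: "1 \<le> x" by simp
      define p where "p = (2::real) ^ Suc (dyadic_level x)"
      have "p \<le> 2 ^ dyadic_level y"
        unfolding p_def using that False by (intro power_increasing) auto
      also have "\<dots> \<le> y" using that False by (intro dyadic_level) auto
      finally have "p \<le> y" .
      moreover have "x \<le> p" using dyadic_level(2)[OF x] by (simp add: p_def)
      moreover have "\<bar>spread f x - spread f p\<bar> \<le> L * \<bar>x - p\<bar>"
        unfolding p_def using dyadic_level[OF x]
        by (intro spread_lipschitz_block[of "dyadic_level x"]) auto
      moreover have "spread f p = p" unfolding p_def by (rule spread_node)
      ultimately show ?thesis by (intro exI[of _ p]) (simp add: abs_minus_commute)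
    qed
    consider "y < 1" | "x < 1" "1 \<le> y" | "1 \<le> x" "dyadic_level x = dyadic_level y"
      | "1 \<le> x" "dyadic_level x < dyadic_level y" | "1 \<le> x" "dyadic_level y < dyadic_level x"
      by linarith
    then show ?thesis
    proof cases
      case 1
      then show ?thesis using id_le[OF that] that by (simp add: spread_def)
    next
      case 3
      then show ?thesis
        using spread_lipschitz_block[of "dyadic_level x" x y] dyadic_level[of x] dyadic_level[of y] that
        by simp
    next
      case 5
      have "(2::real) ^ Suc (dyadic_level y) \<le> 2 ^ dyadic_level x"
        using 5 by (intro power_increasing) auto
      then show ?thesis using dyadic_level[of x] dyadic_level[of y] 5(1) that by linarith
    next
      case 2
      then have y: "1 \<le> y" by simp
      have *: "\<bar>spread f (2 ^ dyadic_level y) - spread f y\<bar> \<le> L * \<bar>2 ^ dyadic_level y - y\<bar>"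
        using dyadic_level[OF y] by (intro spread_lipschitz_block[of "dyadic_level y"]) auto
      have "(1::real) \<le> 2 ^ dyadic_level y" by simp
      then have "x \<le> 2 ^ dyadic_level y" using 2 by linarith
      then show ?thesis
        using * id_le[of x "2 ^ dyadic_level y"] dyadic_level(1)[OF y] 2
        by (simp add: spread_node) (simp add: spread_def algebra_simps)
    next
      case 4
      then have y: "1 \<le> y" using that by simp
      define p q where "p = (2::real) ^ Suc (dyadic_level x)" and "q = (2::real) ^ dyadic_level y"
      have px: "\<bar>spread f x - p\<bar> \<le> L * (p - x)"
        using spread_lipschitz_block[of "dyadic_level x" x p] dyadic_level[OF 4(1)] spread_node[of "Suc (dyadic_level x)"]
        by (simp add: p_def)
      have qy: "\<bar>q - spread f y\<bar> \<le> L * (y - q)"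
        using spread_lipschitz_block[of "dyadic_level y" q y] dyadic_level[OF y] spread_node[of "dyadic_level y"]
        by (simp add: q_def)
      have "p \<le> q" unfolding p_def q_def using 4 by (intro power_increasing) auto
      then have "\<bar>spread f x - spread f y\<bar> \<le> L * (p - x) + L * (q - p) + L * (y - q)"
        using px qy id_le[of p q] by linarith
      also have "\<dots> = L * (y - x)" by (simp add: algebra_simps)
      finally show ?thesis .
    qed
  qed
  show ?thesis
    using main[of x y] main[of y x] by (cases "x \<le> y") (simp_all add: abs_minus_commute)
qed

end

lemma spread_compose:
  assumes "interval_maps f L" "interval_maps g M"
  shows "spread f (spread g x) = spread (\<lambda>n t. f n (g n t)) x"
proof (cases "x < 1")
  case False
  interpret f: interval_maps f L by fact
  interpret g: interval_maps g M by fact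
  define m where "m = dyadic_level x"
  have m: "2 ^ m \<le> x" "x \<le> 2 ^ Suc m" "m = dyadic_level x"
    using False dyadic_level[of x] by (auto simp: m_def)
  have "spread f (spread g x) = 2 ^ m * (1 + f m (spread g x / 2 ^ m - 1))"
    by (rule f.spread_block[OF g.spread_in_block[OF m(1,2)]])
  also have "spread g x / 2 ^ m - 1 = g m (x / 2 ^ m - 1)"
    unfolding g.spread_block[OF m(1,2)] by simp
  also have "2 ^ m * (1 + f m (g m (x / 2 ^ m - 1))) = spread (\<lambda>n t. f n (g n t)) x"
    using False by (simp add: spread_def m(3))
  finally show ?thesis .
qed (simp add: spread_def)

lemma (in interval_maps) spread_displacement:
  assumes "t \<in> {0..1}"
  shows "spread f (2 ^ m * (1 + t)) - 2 ^ m * (1 + t) = 2 ^ m * (f m t - t)"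
proof -
  have "2 ^ m * (1 + t) / 2 ^ m - 1 = t" by simp
  then show ?thesis
    using assms by (subst spread_block[of m]) (auto simp: algebra_simps)
qed

text \<open>
  The \<open>m\<close>-th interval carries the action whose index is the first component of the pair encoded by \<open>m\<close>, so
  each action appears at arbitrarily large scales, where any displacement exceeds any given bound.
\<close>

theorem contains_copy_Out_Roe_of_interval_actions:
  fixes K (structure) and \<rho> :: "'k \<Rightarrow> nat \<Rightarrow> real \<Rightarrow> real"
  assumes infinite_dimensional: "\<nexists>B :: 'h::complex_hilbert set. finite B \<and> cspan B = UNIV"
    and K: "group K"
    and lip: "\<And>k. k \<in> carrier K \<Longrightarrow> \<exists>L. \<forall>n. L-lipschitz_on {0..1} (\<rho> k n)"
    and ends: "\<And>k n. k \<in> carrier K \<Longrightarrow> \<rho> k n 0 = 0" "\<And>k n. k \<in> carrier K \<Longrightarrow> \<rho> k n 1 = 1"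
    and maps: "\<And>k n t. k \<in> carrier K \<Longrightarrow> t \<in> {0..1} \<Longrightarrow> \<rho> k n t \<in> {0..1}"
    and mult: "\<And>k l n t. k \<in> carrier K \<Longrightarrow> l \<in> carrier K \<Longrightarrow> t \<in> {0..1} \<Longrightarrow>
      \<rho> (k \<otimes> l) n t = \<rho> k n (\<rho> l n t)"
    and one: "\<And>n t. t \<in> {0..1} \<Longrightarrow> \<rho> \<one> n t = t"
    and faithful: "\<And>k. k \<in> carrier K \<Longrightarrow> (\<And>n t. t \<in> {0..1} \<Longrightarrow> \<rho> k n t = t) \<Longrightarrow> k = \<one>"
  shows "contains_copy (Out_Roe :: ((int, 'h) ell2_op \<Rightarrow> (int, 'h) ell2_op) set monoid) K"
proof -
  interpret K: group K by fact
  define f where "f k m = \<rho> k (fst (prod_decode m))" for k m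
  define F where "F k x = \<lfloor>spread (f k) (real_of_int x)\<rfloor>" for k x
  have "\<exists>L. interval_maps (f k) L" if k: "k \<in> carrier K" for k
    using lip[OF k] ends[OF k] maps[OF k] by (auto simp: interval_maps_def f_def)
  then obtain L where L: "\<And>k. k \<in> carrier K \<Longrightarrow> interval_maps (f k) (L k)" by metis
  have spread_mult: "spread (f (k \<otimes> l)) x = spread (f k) (spread (f l) x)"
    if k: "k \<in> carrier K" and l: "l \<in> carrier K" for k l x
  proof -
    have "spread (f (k \<otimes> l)) x = spread (\<lambda>n t. f k n (f l n t)) x"
    proof (cases "x < 1")
      case False
      then have "x / 2 ^ dyadic_level x - 1 \<in> {0..1}"
        using interval_maps.rescaled_block[OF L[OF k]] dyadic_level[of x] by simp
      then show ?thesis by (simp add: spread_def f_def mult[OF k l])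
    qed (simp add: spread_def)
    then show ?thesis by (simp add: spread_compose[OF L[OF k] L[OF l]])
  qed
  have spread_one: "spread (f \<one>) x = x" for x
  proof (cases "x < 1")
    case False
    then have "x / 2 ^ dyadic_level x - 1 \<in> {0..1}"
      using interval_maps.rescaled_block[OF L[OF K.one_closed]] dyadic_level[of x] by simp
    then show ?thesis using False by (simp add: spread_def f_def one)
  qed (simp add: spread_def)
  show ?thesis
  proof (rule contains_copy_Out_Roe_of_quasi_action[OF infinite_dimensional K, where F = F])
    fix k assume k: "k \<in> carrier K"
    interpret k: interval_maps "f k" "L k" by (rule L[OF k])
    define M where "M = \<lceil>L k\<rceil>"
    have M: "1 \<le> M" "L k \<le> real_of_int M" using k.one_le_L by (auto simp: M_def)
    have F: "real_of_int \<bar>F k x - F k y\<bar> \<le> \<bar>spread (f k) (real_of_int x) - spread (f k) (real_of_int y)\<bar> + 1" for x y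
      unfolding F_def of_int_abs by linarith
    show "\<exists>L\<ge>0. \<forall>x y. \<bar>F k x - F k y\<bar> \<le> L * \<bar>x - y\<bar> + L"
    proof (intro exI[of _ M] conjI allI)
      fix x y
      have "real_of_int \<bar>F k x - F k y\<bar> \<le> L k * \<bar>real_of_int x - real_of_int y\<bar> + 1"
        using F[of x y] k.spread_lipschitz[of "real_of_int x" "real_of_int y"] by linarith
      also have "\<dots> \<le> real_of_int M * \<bar>real_of_int x - real_of_int y\<bar> + real_of_int M"
        using M by (intro add_mono mult_right_mono) auto
      also have "\<dots> = real_of_int (M * \<bar>x - y\<bar> + M)" by simp
      finally show "\<bar>F k x - F k y\<bar> \<le> M * \<bar>x - y\<bar> + M" by (simp only: of_int_le_iff)
    qed (use M in simp)
    show "\<exists>C. \<forall>x. \<bar>F k (F l x) - F (k \<otimes> l) x\<bar> \<le> C" if l: "l \<in> carrier K" for l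
    proof (intro exI[of _ "M + 1"] allI)
      fix x
      let ?y = "spread (f l) (real_of_int x)"
      have "\<bar>spread (f k) (real_of_int \<lfloor>?y\<rfloor>) - spread (f k) ?y\<bar> \<le> L k * \<bar>real_of_int \<lfloor>?y\<rfloor> - ?y\<bar>"
        by (rule k.spread_lipschitz)
      also have "\<dots> \<le> L k * 1"
        using k.one_le_L by (intro mult_left_mono) linarith+
      also have "\<dots> \<le> real_of_int M" using M by simp
      finally show "\<bar>F k (F l x) - F (k \<otimes> l) x\<bar> \<le> M + 1"
        unfolding F_def spread_mult[OF k l] by linarith
    qed
    fix C assume C: "\<forall>x. \<bar>F k x - x\<bar> \<le> C"
    show "k = \<one>"
    proof (rule faithful[OF k])
      have bound: "\<bar>spread (f k) x - x\<bar> \<le> real_of_int C + L k + 2" for x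
      proof -
        have "\<bar>spread (f k) x - spread (f k) (real_of_int \<lfloor>x\<rfloor>)\<bar> \<le> L k * \<bar>x - real_of_int \<lfloor>x\<rfloor>\<bar>"
          by (rule k.spread_lipschitz)
        also have "\<dots> \<le> L k * 1"
          using k.one_le_L by (intro mult_left_mono) linarith+
        finally have "\<bar>spread (f k) x - spread (f k) (real_of_int \<lfloor>x\<rfloor>)\<bar> \<le> L k" by simp
        moreover have "\<bar>F k \<lfloor>x\<rfloor> - \<lfloor>x\<rfloor>\<bar> \<le> C" using C by blast
        ultimately show ?thesis unfolding F_def by linarith
      qed
      fix n t assume t: "t \<in> {0..(1::real)}"
      show "\<rho> k n t = t"
      proof (rule ccontr)
        assume "\<rho> k n t \<noteq> t"
        then have d: "0 < \<bar>\<rho> k n t - t\<bar>" by simp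
        then obtain j :: nat where j: "real_of_int C + L k + 2 < real j * \<bar>\<rho> k n t - t\<bar>"
          using reals_Archimedean3 by blast
        define m where "m = prod_encode (n, j)"
        have "j \<le> m" unfolding m_def by (rule le_prod_encode_2)
        then have "real j \<le> 2 ^ m"
          using of_nat_less_two_power[of m, where 'a = real] by (meson less_imp_le of_nat_mono order_trans)
        then have "real j * \<bar>\<rho> k n t - t\<bar> \<le> \<bar>2 ^ m * (f k m t - t)\<bar>"
          by (simp add: f_def m_def abs_mult mult_right_mono)
        also have "\<dots> \<le> real_of_int C + L k + 2"
          using bound[of "2 ^ m * (1 + t)"] by (simp only: k.spread_displacement[OF t])
        finally show False using j by simp
      qed
    qed
  next
    show "\<exists>C. \<forall>x. \<bar>F \<one> x - x\<bar> \<le> C"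
      by (intro exI[of _ 0]) (simp add: F_def spread_one)
  qed
qed


section \<open>Piecewise linear maps\<close>

lemma piecewise_linear_onE:
  assumes "piecewise_linear_on S f"
  obtains B where "\<And>s t. finite (B \<inter> {s..t})"
    "\<And>s t. {s..t} \<subseteq> S \<Longrightarrow> {s<..<t} \<inter> B = {} \<Longrightarrow> \<exists>m c. \<forall>x\<in>{s..t}. f x = m * x + c"
proof -
  obtain B where B: "\<forall>s t. finite (B \<inter> {s..t})"
    "\<forall>s t. {s..t} \<subseteq> S \<and> {s<..<t} \<inter> B = {} \<longrightarrow> (\<exists>m c. \<forall>x\<in>{s..t}. f x = m * x + c)"
    using assms unfolding piecewise_linear_on_def by (elim exE conjE)
  show thesis by (rule that[of B]) (use B in simp_all)
qed

lemma piecewise_linear_onI: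
  assumes "\<And>s t. finite (B \<inter> {s..t})"
    "\<And>s t. {s..t} \<subseteq> S \<Longrightarrow> {s<..<t} \<inter> B = {} \<Longrightarrow> \<exists>m c. \<forall>x\<in>{s..t}. f x = m * x + c"
  shows "piecewise_linear_on S f"
  unfolding piecewise_linear_on_def by (rule exI[of _ B]) (use assms in simp)

lemma piecewise_linear_on_cong:
  assumes "\<And>x. x \<in> S \<Longrightarrow> f x = g x" "piecewise_linear_on S f"
  shows "piecewise_linear_on S g"
proof -
  obtain B where B: "\<And>s t. finite (B \<inter> {s..t})"
    "\<And>s t. {s..t} \<subseteq> S \<Longrightarrow> {s<..<t} \<inter> B = {} \<Longrightarrow> \<exists>m c. \<forall>x\<in>{s..t}. f x = m * x + c"
    by (rule piecewise_linear_onE[OF assms(2)]) blast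
  show ?thesis
  proof (rule piecewise_linear_onI[of B])
    fix s t :: real assume st: "{s..t} \<subseteq> S" "{s<..<t} \<inter> B = {}"
    obtain m c where "\<forall>x\<in>{s..t}. f x = m * x + c" using B(2)[OF st] by blast
    then have "\<forall>x\<in>{s..t}. g x = m * x + c" using assms(1) st(1) by (simp add: subset_iff)
    then show "\<exists>m c. \<forall>x\<in>{s..t}. g x = m * x + c" by blast
  qed (rule B(1))
qed

lemma bounded_image_Int_Icc:
  fixes f :: "real \<Rightarrow> real"
  assumes "closed S" "continuous_on S f"
  shows "\<exists>c d. f ` (S \<inter> {s..t}) \<subseteq> {c..d}"
proof -
  have "compact (f ` (S \<inter> {s..t}))"
    using assms by (intro compact_continuous_image closed_Int_compact compact_Icc)
      (auto intro: continuous_on_subset)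
  then obtain M where "\<forall>y\<in>f ` (S \<inter> {s..t}). norm y \<le> M"
    using compact_imp_bounded bounded_iff by meson
  then have "f ` (S \<inter> {s..t}) \<subseteq> {-M..M}" by (force simp: abs_le_iff)
  then show ?thesis by blast
qed

text \<open>
  The break points of the composite are those of \<open>f\<close> and the preimages of those of \<open>g\<close>. Preimages under the
  injective map \<open>f\<close> are locally finite, since \<open>f\<close> maps bounded parts of the closed set \<open>S\<close> to bounded sets.
\<close>

lemma piecewise_linear_on_compose:
  assumes S: "closed S" and f: "continuous_on S f" "strict_mono_on S f" "f ` S \<subseteq> S"
    and pl: "piecewise_linear_on S f" "piecewise_linear_on S g"
  shows "piecewise_linear_on S (\<lambda>x. g (f x))"
proof -
  obtain B where B: "\<And>s t. finite (B \<inter> {s..t})"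
    "\<And>s t. {s..t} \<subseteq> S \<Longrightarrow> {s<..<t} \<inter> B = {} \<Longrightarrow> \<exists>m c. \<forall>x\<in>{s..t}. f x = m * x + c"
    by (rule piecewise_linear_onE[OF pl(1)]) blast
  obtain B' where B': "\<And>s t. finite (B' \<inter> {s..t})"
    "\<And>s t. {s..t} \<subseteq> S \<Longrightarrow> {s<..<t} \<inter> B' = {} \<Longrightarrow> \<exists>m c. \<forall>x\<in>{s..t}. g x = m * x + c"
    by (rule piecewise_linear_onE[OF pl(2)]) blast
  have inj: "inj_on f S" using f(2) by (rule strict_mono_on_imp_inj_on)
  define E where "E = B \<union> {x \<in> S. f x \<in> B'}"
  show ?thesis
    unfolding piecewise_linear_on_def
  proof (intro exI[of _ E] conjI allI impI)
    fix s t :: real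
    obtain c d where cd: "f ` (S \<inter> {s..t}) \<subseteq> {c..d}"
      using bounded_image_Int_Icc[OF S f(1)] by blast
    have "finite ({x \<in> S. f x \<in> B'} \<inter> {s..t})"
    proof (rule finite_imageD)
      have "f ` ({x \<in> S. f x \<in> B'} \<inter> {s..t}) \<subseteq> B' \<inter> {c..d}" using cd by blast
      then show "finite (f ` ({x \<in> S. f x \<in> B'} \<inter> {s..t}))" using B'(1) finite_subset by blast
      show "inj_on f ({x \<in> S. f x \<in> B'} \<inter> {s..t})" using inj by (rule inj_on_subset) auto
    qed
    then show "finite (E \<inter> {s..t})"
      using B(1) unfolding E_def Int_Un_distrib2 by blast
    assume st: "{s..t} \<subseteq> S \<and> {s<..<t} \<inter> E = {}"
    show "\<exists>m c. \<forall>x\<in>{s..t}. g (f x) = m * x + c"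
    proof (cases "s < t")
      case False
      then have "x = s" if "x \<in> {s..t}" for x using that by auto
      then have "\<forall>x\<in>{s..t}. g (f x) = 0 * x + g (f s)" by (metis add_0 mult_zero_left)
      then show ?thesis by blast
    next
      case True
      obtain m c where mc: "\<forall>x\<in>{s..t}. f x = m * x + c"
        using B(2)[of s t] st by (auto simp: E_def)
      have "s \<in> {s..t}" "t \<in> {s..t}" using True by auto
      then have "s \<in> S" "t \<in> S" using st by blast+
      then have "f s < f t" using strict_mono_onD[OF f(2)] True by blast
      then have "0 < m * (t - s)" using mc True by (simp add: algebra_simps)
      then have m: "m > 0" using True by (simp add: zero_less_mult_iff)
      \<comment> \<open>On an affine piece of positive slope the image of the interval can be computed.\<close>
      have pre: "\<exists>x\<in>{s..t}. y = f x \<and> (f s < y \<longrightarrow> s < x) \<and> (y < f t \<longrightarrow> x < t)" if "y \<in> {f s..f t}" for y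
      proof -
        define x where "x = (y - c) / m"
        have mx: "m * x = y - c" using m by (simp add: x_def)
        have "m * s \<le> m * x" "m * x \<le> m * t" using that mc mx True by auto
        then have x: "x \<in> {s..t}" using m by simp
        then have "y = f x" using mc mx by simp
        moreover have "f s < y \<longrightarrow> s < x" "y < f t \<longrightarrow> x < t"
          using calculation x by (auto simp: less_le)
        ultimately show ?thesis using x by blast
      qed
      have "{f s..f t} \<subseteq> S"
        using pre f(3) st by blast
      moreover have "{f s<..<f t} \<inter> B' = {}"
      proof (rule ccontr)
        assume "{f s<..<f t} \<inter> B' \<noteq> {}"
        then obtain y where y: "f s < y" "y < f t" "y \<in> B'" by auto
        then obtain x where "x \<in> {s<..<t}" "y = f x" using pre[of y] by auto
        moreover from this have "x \<in> S" using st by auto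
        ultimately have "x \<in> {s<..<t} \<inter> E" using y(3) by (auto simp: E_def)
        then show False using st by blast
      qed
      ultimately obtain m' c' where mc': "\<forall>y\<in>{f s..f t}. g y = m' * y + c'"
        using B'(2) by blast
      have "g (f x) = (m' * m) * x + (m' * c + c')" if x: "x \<in> {s..t}" for x
      proof -
        have "m * s \<le> m * x" "m * x \<le> m * t" using x m by auto
        then have "f x \<in> {f s..f t}" using mc x True by auto
        then show ?thesis using mc mc' x by (simp add: algebra_simps)
      qed
      then show ?thesis by blast
    qed
  qed
qed

text \<open>
  The break points of the inverse are the images of those of \<open>f\<close>.
\<close>

lemma piecewise_linear_on_inverse:
  assumes S: "closed S" "convex S" and f: "strict_mono_on S f" "f ` S \<subseteq> S"
    and g: "continuous_on S g" "g ` S \<subseteq> S" "\<And>y. y \<in> S \<Longrightarrow> f (g y) = y"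
    and pl: "piecewise_linear_on S f"
  shows "piecewise_linear_on S g"
proof -
  obtain B where B: "\<And>s t. finite (B \<inter> {s..t})"
    "\<And>s t. {s..t} \<subseteq> S \<Longrightarrow> {s<..<t} \<inter> B = {} \<Longrightarrow> \<exists>m c. \<forall>x\<in>{s..t}. f x = m * x + c"
    by (rule piecewise_linear_onE[OF pl]) blast
  have gf: "g (f x) = x" if "x \<in> S" for x
  proof -
    have "f x \<in> S" using f(2) that by blast
    then have "g (f x) \<in> S" "f (g (f x)) = f x" using g(2,3) by blast+
    then show ?thesis
      using inj_onD[OF strict_mono_on_imp_inj_on[OF f(1)]] that by blast
  qed
  have g_mono: "g s < g t" if "s \<in> S" "t \<in> S" "s < t" for s t
  proof (rule ccontr)
    assume "\<not> g s < g t"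
    then have "f (g t) \<le> f (g s)"
      using that g(2) by (cases "g t = g s") (auto intro!: less_imp_le strict_mono_onD[OF f(1)])
    then show False using that g(3) by simp
  qed
  define E where "E = f ` (B \<inter> S)"
  show ?thesis
    unfolding piecewise_linear_on_def
  proof (intro exI[of _ E] conjI allI impI)
    fix s t :: real
    obtain c d where cd: "g ` (S \<inter> {s..t}) \<subseteq> {c..d}"
      using bounded_image_Int_Icc[OF S(1) g(1)] by blast
    have "E \<inter> {s..t} \<subseteq> f ` (B \<inter> {c..d})"
    proof
      fix y assume "y \<in> E \<inter> {s..t}"
      then obtain x where x: "x \<in> B" "x \<in> S" "y = f x" "y \<in> {s..t}" by (auto simp: E_def)
      then have "g y \<in> {c..d}" using cd f(2) by blast
      then show "y \<in> f ` (B \<inter> {c..d})" using x gf by auto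
    qed
    then show "finite (E \<inter> {s..t})" using B(1) finite_subset by blast
    assume st: "{s..t} \<subseteq> S \<and> {s<..<t} \<inter> E = {}"
    show "\<exists>m c. \<forall>x\<in>{s..t}. g x = m * x + c"
    proof (cases "s < t")
      case False
      then have "x = s" if "x \<in> {s..t}" for x using that by auto
      then have "\<forall>x\<in>{s..t}. g x = 0 * x + g s" by (metis add_0 mult_zero_left)
      then show ?thesis by blast
    next
      case True
      then have "s \<in> {s..t}" "t \<in> {s..t}" by auto
      then have "s \<in> S" "t \<in> S" using st by blast+
      then have st': "s \<in> S" "t \<in> S" "g s \<in> S" "g t \<in> S" "g s < g t"
        using g(2) g_mono True by blast+
      have sub: "{g s..g t} \<subseteq> S"
        using closed_segment_subset[OF st'(3,4) S(2)] st'(5) by (simp add: closed_segment_eq_real_ivl)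
      have "{g s<..<g t} \<inter> B = {}"
      proof (rule ccontr)
        assume "{g s<..<g t} \<inter> B \<noteq> {}"
        then obtain x where x: "g s < x" "x < g t" "x \<in> B" by auto
        then have "x \<in> S" using sub by auto
        have "f (g s) < f x" "f x < f (g t)"
          using x st' \<open>x \<in> S\<close> by (auto intro: strict_mono_onD[OF f(1)])
        then have "f x \<in> {s<..<t} \<inter> E" using g(3) st' x \<open>x \<in> S\<close> by (auto simp: E_def)
        then show False using st by blast
      qed
      then obtain m c where mc: "\<forall>x\<in>{g s..g t}. f x = m * x + c" using B(2) sub by blast
      have "f (g s) < f (g t)" using g(3) st' True by simp
      then have "m \<noteq> 0" using mc st' by auto
      have "g y = (1 / m) * y + (- c / m)" if y: "y \<in> {s..t}" for y
      proof -
        have "y \<in> S" using y st by blast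
        have "g s \<le> g y" "g y \<le> g t"
          using y st' \<open>y \<in> S\<close> g_mono[of s y] g_mono[of y t] by (auto simp: le_less)
        then have "m * g y + c = y" using mc g(3)[OF \<open>y \<in> S\<close>] by auto
        then have "m * g y = y - c" by simp
        then show ?thesis using \<open>m \<noteq> 0\<close> by (simp add: field_simps)
      qed
      then show ?thesis by blast
    qed
  qed
qed

text \<open>
  An interval with break points in its interior is cut at one of them, which lowers their number on both
  sides.
\<close>

lemma piecewise_linear_on_Icc_induct:
  fixes a b :: real
  assumes B: "finite (B \<inter> {a<..<b})" and "a \<le> b"
    and base: "\<And>s t. a \<le> s \<Longrightarrow> s \<le> t \<Longrightarrow> t \<le> b \<Longrightarrow> {s<..<t} \<inter> B = {} \<Longrightarrow> P s t"
    and step: "\<And>s p t. a \<le> s \<Longrightarrow> s < p \<Longrightarrow> p < t \<Longrightarrow> t \<le> b \<Longrightarrow> p \<in> B \<Longrightarrow> P s p \<Longrightarrow> P p t \<Longrightarrow> P s t"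
  shows "P a b"
proof -
  have "P s t" if "a \<le> s" "s \<le> t" "t \<le> b" for s t
    using that
  proof (induction "card (B \<inter> {s<..<t})" arbitrary: s t rule: less_induct)
    case less
    have fin: "finite (B \<inter> {s<..<t})"
      using less.prems by (intro finite_subset[OF _ B]) (auto intro: le_less_trans less_le_trans)
    show ?case
    proof (cases "{s<..<t} \<inter> B = {}")
      case True
      then show ?thesis using base less.prems by blast
    next
      case False
      then obtain p where p: "s < p" "p < t" "p \<in> B" by auto
      have "B \<inter> {s<..<p} \<subset> B \<inter> {s<..<t}" "B \<inter> {p<..<t} \<subset> B \<inter> {s<..<t}"
        using p by auto
      then have "card (B \<inter> {s<..<p}) < card (B \<inter> {s<..<t})" "card (B \<inter> {p<..<t}) < card (B \<inter> {s<..<t})"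
        using fin by (auto intro: psubset_card_mono)
      then have "P s p" "P p t" using less p by auto
      then show ?thesis using step p less.prems by blast
    qed
  qed
  then show ?thesis using \<open>a \<le> b\<close> by blast
qed

lemma piecewise_linear_on_lipschitz:
  assumes pl: "piecewise_linear_on S f" and sub: "{a..b} \<subseteq> S" and "a \<le> b"
  shows "\<exists>L. L-lipschitz_on {a..b} f"
proof -
  obtain B where B: "\<And>s t. finite (B \<inter> {s..t})"
    "\<And>s t. {s..t} \<subseteq> S \<Longrightarrow> {s<..<t} \<inter> B = {} \<Longrightarrow> \<exists>m c. \<forall>x\<in>{s..t}. f x = m * x + c"
    by (rule piecewise_linear_onE[OF pl]) blast
  have fin: "finite (B \<inter> {a<..<b})"
    by (rule finite_subset[OF _ B(1)[of a b]]) auto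
  show ?thesis
  proof (rule piecewise_linear_on_Icc_induct[OF fin \<open>a \<le> b\<close>, where P = "\<lambda>s t. \<exists>L. L-lipschitz_on {s..t} f"])
    fix s t assume st: "a \<le> s" "s \<le> t" "t \<le> b" "{s<..<t} \<inter> B = {}"
    then have "{s..t} \<subseteq> S" using sub by auto
    then obtain m c where mc: "\<forall>x\<in>{s..t}. f x = m * x + c" using B(2) st(4) by blast
    have "\<bar>m\<bar>-lipschitz_on {s..t} f"
    proof (rule lipschitz_onI)
      fix x y assume xy: "x \<in> {s..t}" "y \<in> {s..t}"
      have "f x - f y = m * (x - y)" using mc xy by (simp add: algebra_simps)
      then show "dist (f x) (f y) \<le> \<bar>m\<bar> * dist x y" by (simp add: dist_real_def abs_mult)
    qed simp
    then show "\<exists>L. L-lipschitz_on {s..t} f" by blast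
  next
    fix s p t assume "s < p" "p < t" "\<exists>L. L-lipschitz_on {s..p} f" "\<exists>L. L-lipschitz_on {p..t} f"
    then show "\<exists>L. L-lipschitz_on {s..t} f"
      using lipschitz_on_concat_max[of _ s p f _ t f] by auto
  qed
qed

lemma affine_slope_eq_derivative:
  fixes f :: "real \<Rightarrow> real"
  assumes aff: "\<And>x. x \<in> {a..b} \<Longrightarrow> f x = m * x + c" and "a < b" "p \<in> {a..b}"
    and der: "(f has_real_derivative d) (at p)"
  shows "d = m"
proof (rule has_field_derivative_unique[of f d p "{a..b}"])
  show "(f has_real_derivative d) (at p within {a..b})"
    using der by (rule has_field_derivative_at_within)
  have "((\<lambda>x. m * x + c) has_real_derivative m) (at p within {a..b})"
    by (auto intro!: derivative_eq_intros)
  then show "(f has_real_derivative m) (at p within {a..b})"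
    by (rule has_field_derivative_transform_within[of _ _ _ _ 1]) (use assms in auto)
  have "p islimpt {a..b}"
    using assms(2,3) by (intro connected_imp_perfect connected_Icc) auto
  then show "at p within {a..b} \<noteq> bot"
    using trivial_limit_within by blast
qed


section \<open>Compactly supported piecewise linear homeomorphisms\<close>

text \<open>
  A homeomorphism of the line that fixes all points far out is increasing, so membership in \<open>PL_kappa\<close> amounts
  to this.
\<close>

definition pl_kappa_map :: "(real \<Rightarrow> real) \<Rightarrow> bool"
  where "pl_kappa_map f \<longleftrightarrow> continuous_on UNIV f \<and> strict_mono f \<and> piecewise_linear_on UNIV f \<and>
    (\<exists>N. \<forall>x. N \<le> \<bar>x\<bar> \<longrightarrow> f x = x)"

lemma surj_of_eventually_id:
  fixes f :: "real \<Rightarrow> real"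
  assumes "continuous_on UNIV f" "\<And>x. N \<le> \<bar>x\<bar> \<Longrightarrow> f x = x"
  shows "surj f"
proof -
  have "\<exists>x. f x = y" for y
  proof -
    define M where "M = max \<bar>N\<bar> \<bar>y\<bar>"
    have "f (-M) = -M" "f M = M" by (auto simp: M_def intro!: assms(2))
    moreover have "-M \<le> y" "y \<le> M" by (auto simp: M_def)
    ultimately show ?thesis
      using IVT'[of f "-M" y M] continuous_on_subset[OF assms(1)] by force
  qed
  then show ?thesis by (metis surjI)
qed

lemma PL_kappa_carrier: "f \<in> carrier PL_kappa \<longleftrightarrow> pl_kappa_map f"
proof
  assume "f \<in> carrier PL_kappa"
  then obtain g where h: "homeomorphism UNIV UNIV f g" and pl: "piecewise_linear_on UNIV f"
    and "compact (closure {x. f x \<noteq> x})"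
    by (auto simp: PL_kappa_def)
  then have "bounded {x. f x \<noteq> x}" using bounded_closure_image compact_imp_bounded bounded_subset closure_subset by metis
  then obtain N where N: "\<And>x. f x \<noteq> x \<Longrightarrow> \<bar>x\<bar> \<le> N" by (auto simp: bounded_iff)
  have cont: "continuous_on UNIV f" using h by (rule homeomorphism_cont1)
  have inj: "inj f" using h by (metis UNIV_I homeomorphism_apply1 injI)
  have fixed: "f x = x" if "\<bar>N\<bar> + 1 \<le> \<bar>x\<bar>" for x using N[of x] that by linarith
  have "f x < f y" if "x < y" for x y
  proof -
    define M where "M = \<bar>N\<bar> + \<bar>x\<bar> + \<bar>y\<bar> + 1"
    have M: "f (-M) = -M" "f M = M" "-M < x" "y < M" "x < M" "0 < M"
      by (auto simp: M_def intro!: fixed)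
    have dichotomy: "f s < f t \<and> f t < f u \<or> f u < f t \<and> f t < f s" if "s < t" "t < u" for s t u
      using that by (rule continuous_inj_imp_mono)
        (auto intro: continuous_on_subset[OF cont] inj_on_subset[OF inj])
    have "f x < f M"
      using dichotomy[OF M(3,5)] M by auto
    then show ?thesis
      using dichotomy[OF \<open>x < y\<close> M(4)] by auto
  qed
  then have "strict_mono f" by (rule strict_monoI)
  then show "pl_kappa_map f" using cont pl fixed by (auto simp: pl_kappa_map_def)
next
  assume f: "pl_kappa_map f"
  then obtain N where N: "\<And>x. N \<le> \<bar>x\<bar> \<Longrightarrow> f x = x" by (auto simp: pl_kappa_map_def)
  have cont: "continuous_on UNIV f" and mono: "strict_mono f" and pl: "piecewise_linear_on UNIV f"
    using f by (auto simp: pl_kappa_map_def)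
  have surj: "surj f" using surj_of_eventually_id[OF cont N] .
  have inj: "inj f" using mono by (rule strict_mono_imp_inj_on)
  obtain g where "homeomorphism UNIV (range f) f g"
    by (rule invariance_of_domain_homeomorphism[OF open_UNIV cont order_refl inj])
  then have "\<exists>g. homeomorphism UNIV UNIV f g"
    unfolding surj by blast
  moreover have "compact (closure {x. f x \<noteq> x})"
  proof -
    have "x \<in> cball 0 \<bar>N\<bar>" if "f x \<noteq> x" for x
      using N[of x] that by (cases "N \<le> \<bar>x\<bar>") auto
    then have "{x. f x \<noteq> x} \<subseteq> cball 0 \<bar>N\<bar>" by blast
    then show ?thesis using compact_closure_subset compact_cball by blast
  qed
  ultimately show "f \<in> carrier PL_kappa" using pl by (auto simp: PL_kappa_def)
qed

lemma pl_kappa_map_compose: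
  assumes "pl_kappa_map f" "pl_kappa_map g"
  shows "pl_kappa_map (\<lambda>x. g (f x))"
proof -
  obtain N M where N: "\<And>x. N \<le> \<bar>x\<bar> \<Longrightarrow> f x = x" and M: "\<And>x. M \<le> \<bar>x\<bar> \<Longrightarrow> g x = x"
    using assms by (auto simp: pl_kappa_map_def)
  have f: "continuous_on UNIV f" "strict_mono f" "piecewise_linear_on UNIV f"
    and g: "continuous_on UNIV g" "strict_mono g" "piecewise_linear_on UNIV g"
    using assms by (simp_all add: pl_kappa_map_def)
  have "\<forall>x. max N M \<le> \<bar>x\<bar> \<longrightarrow> g (f x) = x" using N M by simp
  moreover have "piecewise_linear_on UNIV (\<lambda>x. g (f x))"
    by (rule piecewise_linear_on_compose[OF closed_UNIV f(1,2) subset_UNIV f(3) g(3)])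
  moreover have "continuous_on UNIV (\<lambda>x. g (f x))"
    by (rule continuous_on_compose2[OF g(1) f(1) subset_UNIV])
  moreover have "strict_mono (\<lambda>x. g (f x))"
    by (rule strict_monoI) (rule strict_monoD[OF g(2) strict_monoD[OF f(2)]])
  ultimately show ?thesis unfolding pl_kappa_map_def by blast
qed

lemma pl_kappa_map_id: "pl_kappa_map (\<lambda>x. x)"
proof -
  have "\<forall>x\<in>{s..t}. x = 1 * x + (0::real)" for s t :: real by simp
  then have "piecewise_linear_on UNIV (\<lambda>x. x)"
    by (intro piecewise_linear_onI[of "{}"]) (simp, blast)
  then show ?thesis by (auto simp: pl_kappa_map_def strict_mono_def)
qed

lemma
  assumes "f \<in> carrier PL_kappa"
  shows PL_kappa_bij: "bij f"
    and PL_kappa_inv: "inv_into UNIV f \<in> carrier PL_kappa"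
proof -
  obtain N where N: "\<And>x. N \<le> \<bar>x\<bar> \<Longrightarrow> f x = x"
    using assms by (auto simp: PL_kappa_carrier pl_kappa_map_def)
  have f: "continuous_on UNIV f" "strict_mono f" "piecewise_linear_on UNIV f"
    using assms by (auto simp: PL_kappa_carrier pl_kappa_map_def)
  obtain g where h: "homeomorphism UNIV UNIV f g" using assms by (auto simp: PL_kappa_def)
  then show "bij f" by (intro o_bij[of g f]) (auto simp: homeomorphism_def)
  have g: "inv_into UNIV f = g"
    using \<open>bij f\<close> h by (intro ext inv_f_eq) (auto simp: homeomorphism_def bij_def)
  have gf: "\<And>x. g (f x) = x" "\<And>y. f (g y) = y" and cont: "continuous_on UNIV g"
    using h by (auto simp: homeomorphism_def)
  have "\<forall>x. N \<le> \<bar>x\<bar> \<longrightarrow> g x = x" using N gf(1) by metis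
  moreover have "strict_mono g"
    using f(2) gf(2) by (metis strict_mono_def strict_mono_less)
  moreover have "piecewise_linear_on UNIV g"
    using piecewise_linear_on_inverse[of UNIV f g] f cont gf by simp
  ultimately show "inv_into UNIV f \<in> carrier PL_kappa"
    unfolding g PL_kappa_carrier pl_kappa_map_def using cont by blast
qed

lemma PL_kappa_mult:
  assumes "f \<in> carrier PL_kappa" "g \<in> carrier PL_kappa"
  shows "f \<otimes>\<^bsub>PL_kappa\<^esub> g = (\<lambda>x. f (g x))"
  using assms[THEN PL_kappa_bij]
  by (simp add: PL_kappa_def BijGroup_def Bij_def compose_def restrict_def)

lemma PL_kappa_one: "\<one>\<^bsub>PL_kappa\<^esub> = (\<lambda>x. x)"
  by (simp add: PL_kappa_def BijGroup_def restrict_def)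

lemma group_PL_kappa: "group PL_kappa"
proof (rule groupI)
  show "\<one>\<^bsub>PL_kappa\<^esub> \<in> carrier PL_kappa"
    by (simp add: PL_kappa_one PL_kappa_carrier pl_kappa_map_id)
  fix f g assume f: "f \<in> carrier PL_kappa" and g: "g \<in> carrier PL_kappa"
  show fg: "f \<otimes>\<^bsub>PL_kappa\<^esub> g \<in> carrier PL_kappa" if "f \<in> carrier PL_kappa" "g \<in> carrier PL_kappa" for f g
    using that by (simp add: PL_kappa_mult) (simp add: PL_kappa_carrier pl_kappa_map_compose)
  show "f \<otimes>\<^bsub>PL_kappa\<^esub> g \<otimes>\<^bsub>PL_kappa\<^esub> h = f \<otimes>\<^bsub>PL_kappa\<^esub> (g \<otimes>\<^bsub>PL_kappa\<^esub> h)"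
    if h: "h \<in> carrier PL_kappa" for h
    using PL_kappa_mult[OF fg[OF f g] h] PL_kappa_mult[OF f fg[OF g h]]
      PL_kappa_mult[OF f g] PL_kappa_mult[OF g h] by simp
  show "\<one>\<^bsub>PL_kappa\<^esub> \<otimes>\<^bsub>PL_kappa\<^esub> f = f"
    using f pl_kappa_map_id by (subst PL_kappa_mult) (auto simp: PL_kappa_one PL_kappa_carrier)
  show "\<exists>g\<in>carrier PL_kappa. g \<otimes>\<^bsub>PL_kappa\<^esub> f = \<one>\<^bsub>PL_kappa\<^esub>"
    using PL_kappa_inv[OF f] PL_kappa_mult[OF PL_kappa_inv[OF f] f] PL_kappa_bij[OF f]
    by (intro bexI[of _ "inv_into UNIV f"]) (auto simp: PL_kappa_one bij_def)
qed

text \<open>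
  An increasing diffeomorphism from the real line to \<open>(0, 1)\<close> with inverse \<open>unsqueeze\<close>.
\<close>

definition squeeze :: "real \<Rightarrow> real"
  where "squeeze x = arctan x / pi + 1 / 2"

definition unsqueeze :: "real \<Rightarrow> real"
  where "unsqueeze t = tan (pi * (t - 1 / 2))"

lemma squeeze_bounds: "0 < squeeze x" "squeeze x < 1"
  using arctan_lbound[of x] arctan_ubound[of x] by (auto simp: squeeze_def field_simps)

lemma unsqueeze_squeeze: "unsqueeze (squeeze x) = x"
  by (simp add: squeeze_def unsqueeze_def tan_arctan)

lemma unsqueeze_angle:
  assumes "0 < t" "t < 1"
  shows "- (pi / 2) < pi * (t - 1 / 2)" "pi * (t - 1 / 2) < pi / 2"
proof -
  have "0 < pi * t" using assms by simp
  then show "- (pi / 2) < pi * (t - 1 / 2)" by (simp add: algebra_simps)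
  have "pi * t < pi * 1" using assms by (intro mult_strict_left_mono) auto
  then show "pi * (t - 1 / 2) < pi / 2" by (simp add: algebra_simps)
qed

lemma squeeze_unsqueeze:
  assumes "0 < t" "t < 1"
  shows "squeeze (unsqueeze t) = t"
  unfolding squeeze_def unsqueeze_def
  using arctan_tan[OF unsqueeze_angle[OF assms]] by simp

lemma squeeze_less_iff: "squeeze x < squeeze y \<longleftrightarrow> x < y"
  by (simp add: squeeze_def divide_less_cancel arctan_less_iff)

lemma squeeze_lipschitz: "1-lipschitz_on UNIV squeeze"
proof (rule lipschitz_onI)
  fix x y :: real
  have "norm (squeeze x - squeeze y) \<le> 1 * norm (x - y)"
  proof (rule field_differentiable_bound[of UNIV squeeze "\<lambda>x. inverse (1 + x\<^sup>2) / pi" 1])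
    fix z :: real
    show "(squeeze has_real_derivative inverse (1 + z\<^sup>2) / pi) (at z within UNIV)"
      unfolding squeeze_def[abs_def] by (auto intro!: derivative_eq_intros)
    have "1 \<le> (1 + z\<^sup>2) * pi"
      using mult_mono[of 1 "1 + z\<^sup>2" 1 pi] pi_gt3 by auto
    then show "norm (inverse (1 + z\<^sup>2) / pi) \<le> 1"
      by (simp add: field_simps)
  qed auto
  then show "dist (squeeze x) (squeeze y) \<le> 1 * dist x y" by (simp add: dist_norm)
qed simp

text \<open>
  The derivative of \<open>tan\<close> is \<open>1 + tan\<^sup>2\<close>, so that of \<open>unsqueeze\<close> is \<open>\<pi> (1 + unsqueeze\<^sup>2)\<close>.
\<close>

lemma unsqueeze_lipschitz:
  "(pi * (1 + N\<^sup>2))-lipschitz_on {squeeze (- N)..squeeze N} unsqueeze"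
proof (rule lipschitz_onI)
  fix s t assume st: "s \<in> {squeeze (- N)..squeeze N}" "t \<in> {squeeze (- N)..squeeze N}"
  have "norm (unsqueeze s - unsqueeze t) \<le> pi * (1 + N\<^sup>2) * norm (s - t)"
  proof (rule field_differentiable_bound[of "{squeeze (- N)..squeeze N}" unsqueeze "\<lambda>t. pi * (1 + (unsqueeze t)\<^sup>2)"])
    fix t assume t: "t \<in> {squeeze (- N)..squeeze N}"
    then have t01: "0 < t" "t < 1" using squeeze_bounds[of "- N"] squeeze_bounds[of N] by auto
    have c: "cos (pi * (t - 1 / 2)) \<noteq> 0"
      using cos_gt_zero_pi[of "pi * (t - 1 / 2)"] unsqueeze_angle[OF t01] by simp
    have "(unsqueeze has_real_derivative inverse ((cos (pi * (t - 1 / 2)))\<^sup>2) * pi) (at t within {squeeze (- N)..squeeze N})"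
      unfolding unsqueeze_def[abs_def] using c by (auto intro!: derivative_eq_intros)
    then show "(unsqueeze has_real_derivative pi * (1 + (unsqueeze t)\<^sup>2)) (at t within {squeeze (- N)..squeeze N})"
      using tan_sec[OF c] by (simp add: unsqueeze_def mult.commute power_inverse)
    have "\<not> squeeze (unsqueeze t) < squeeze (- N)" "\<not> squeeze N < squeeze (unsqueeze t)"
      using t by (auto simp: squeeze_unsqueeze t01)
    then have "\<bar>unsqueeze t\<bar> \<le> N" by (auto simp: squeeze_less_iff)
    then have "(unsqueeze t)\<^sup>2 \<le> N\<^sup>2" by (metis abs_ge_zero power2_abs power_mono)
    then have "pi * (1 + (unsqueeze t)\<^sup>2) \<le> pi * (1 + N\<^sup>2)" by (intro mult_left_mono) auto
    moreover have "0 \<le> pi * (1 + (unsqueeze t)\<^sup>2)" by (intro mult_nonneg_nonneg) auto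
    ultimately show "norm (pi * (1 + (unsqueeze t)\<^sup>2)) \<le> pi * (1 + N\<^sup>2)"
      by simp
  qed (use st in auto)
  then show "dist (unsqueeze s) (unsqueeze t) \<le> pi * (1 + N\<^sup>2) * dist s t" by (simp add: dist_norm)
qed simp

definition squeezed :: "(real \<Rightarrow> real) \<Rightarrow> real \<Rightarrow> real"
  where "squeezed f t = (if 0 < t \<and> t < 1 then squeeze (f (unsqueeze t)) else t)"

text \<open>
  Outside \<open>[squeeze (- N), squeeze N]\<close> the conjugated map is the identity; inside, all three factors are Lipschitz.
\<close>

lemma squeezed_lipschitz:
  assumes f: "pl_kappa_map f"
  shows "\<exists>L. L-lipschitz_on {0..1} (squeezed f)"
proof -
  obtain N' where N': "\<And>x. N' \<le> \<bar>x\<bar> \<Longrightarrow> f x = x" using f by (auto simp: pl_kappa_map_def)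
  define N where "N = \<bar>N'\<bar>"
  have N: "f x = x" if "N \<le> \<bar>x\<bar>" for x using N' that by (simp add: N_def)
  have "0 \<le> N" by (simp add: N_def)
  define a b where "a = squeeze (- N)" and "b = squeeze N"
  have ab: "0 < a" "a \<le> b" "b < 1"
    unfolding a_def b_def using squeeze_bounds squeeze_less_iff[of N "-N"] \<open>0 \<le> N\<close> by auto
  obtain K where K: "K-lipschitz_on {- N..N} f"
    using piecewise_linear_on_lipschitz[of UNIV f "-N" N] f \<open>0 \<le> N\<close> by (auto simp: pl_kappa_map_def)
  have mem: "unsqueeze t \<in> {- N..N}" if "t \<in> {a..b}" for t
  proof -
    have "0 < t" "t < 1" using that ab by auto
    then have "\<not> squeeze (unsqueeze t) < a" "\<not> b < squeeze (unsqueeze t)"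
      using that by (auto simp: squeeze_unsqueeze)
    then show ?thesis by (auto simp: a_def b_def squeeze_less_iff)
  qed
  have out: "squeezed f t = t" if "t \<notin> {a<..<b}" for t
  proof (cases "0 < t \<and> t < 1")
    case True
    then have "\<not> (a < squeeze (unsqueeze t) \<and> squeeze (unsqueeze t) < b)"
      using that by (auto simp: squeeze_unsqueeze)
    then have "N \<le> \<bar>unsqueeze t\<bar>" by (auto simp: a_def b_def squeeze_less_iff)
    then show ?thesis using True N by (simp add: squeezed_def squeeze_unsqueeze)
  qed (auto simp: squeezed_def)
  have "1-lipschitz_on {0..a} (squeezed f)" "1-lipschitz_on {b..1} (squeezed f)"
    using out by (auto intro!: lipschitz_onI)
  moreover have "(1 * (K * (pi * (1 + N\<^sup>2))))-lipschitz_on {a..b} (squeeze \<circ> (f \<circ> unsqueeze))"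
  proof (intro lipschitz_on_compose)
    show "(pi * (1 + N\<^sup>2))-lipschitz_on {a..b} unsqueeze"
      unfolding a_def b_def by (rule unsqueeze_lipschitz)
    show "K-lipschitz_on (unsqueeze ` {a..b}) f"
      using mem by (intro lipschitz_on_subset[OF K]) blast
  qed (rule lipschitz_on_subset[OF squeeze_lipschitz subset_UNIV])
  then have "(1 * (K * (pi * (1 + N\<^sup>2))))-lipschitz_on {a..b} (squeezed f)"
    using ab by (elim lipschitz_on_transform) (auto simp: squeezed_def)
  ultimately show ?thesis
    using lipschitz_on_concat_max[of _ 0 a "squeezed f" _ b "squeezed f"]
      lipschitz_on_concat_max[of _ 0 b "squeezed f" _ 1 "squeezed f"] by fastforce
qed

theorem contains_copy_PL_kappa:
  assumes "\<nexists>B :: 'h::complex_hilbert set. finite B \<and> cspan B = UNIV"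
  shows "contains_copy (Out_Roe :: ((int, 'h) ell2_op \<Rightarrow> (int, 'h) ell2_op) set monoid) PL_kappa"
proof (rule contains_copy_Out_Roe_of_interval_actions[OF assms group_PL_kappa, where \<rho> = "\<lambda>f n. squeezed f"])
  fix f n assume f: "f \<in> carrier PL_kappa"
  show "\<exists>L. \<forall>n::nat. L-lipschitz_on {0..1} (squeezed f)"
    using squeezed_lipschitz f by (simp add: PL_kappa_carrier)
  show "squeezed f 0 = 0" "squeezed f 1 = 1" by (auto simp: squeezed_def)
  show "squeezed f t \<in> {0..1}" if "t \<in> {0..1}" for t
    using that squeeze_bounds[of "f (unsqueeze t)"] by (auto simp: squeezed_def)
  show "squeezed (f \<otimes>\<^bsub>PL_kappa\<^esub> g) t = squeezed f (squeezed g t)" if "g \<in> carrier PL_kappa" for g t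
    using PL_kappa_mult[OF f that] squeeze_bounds[of "g (unsqueeze t)"]
    by (auto simp: squeezed_def unsqueeze_squeeze)
  assume triv: "\<And>(n::nat) t. t \<in> {0..1} \<Longrightarrow> squeezed f t = t"
  have "f x = x" for x
  proof -
    have "squeeze (f x) = squeeze x"
      using triv[of "squeeze x"] squeeze_bounds[of x] by (simp add: squeezed_def unsqueeze_squeeze)
    then show ?thesis by (metis unsqueeze_squeeze)
  qed
  then show "f = \<one>\<^bsub>PL_kappa\<^esub>" by (auto simp: PL_kappa_one)
next
  show "squeezed \<one>\<^bsub>PL_kappa\<^esub> t = t" for t
    by (simp add: squeezed_def PL_kappa_one squeeze_unsqueeze)
qed


section \<open>Thompson's group\<close>

lemma dyadic_add:
  assumes "a \<in> dyadic_rationals" "b \<in> dyadic_rationals"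
  shows "a + b \<in> dyadic_rationals"
proof -
  obtain k m l n where a: "a = real_of_int k / 2 ^ m" and b: "b = real_of_int l / 2 ^ n"
    using assms by (auto simp: dyadic_rationals_def)
  have "a + b = real_of_int (k * 2 ^ n + l * 2 ^ m) / 2 ^ (m + n)"
    by (simp add: a b power_add field_simps)
  then show ?thesis unfolding dyadic_rationals_def by blast
qed

lemma dyadic_uminus:
  assumes "a \<in> dyadic_rationals"
  shows "- a \<in> dyadic_rationals"
proof -
  obtain k m where "a = real_of_int k / 2 ^ m" using assms by (auto simp: dyadic_rationals_def)
  then have "- a = real_of_int (- k) / 2 ^ m" by simp
  then show ?thesis unfolding dyadic_rationals_def by blast
qed

lemma dyadic_diff: "a \<in> dyadic_rationals \<Longrightarrow> b \<in> dyadic_rationals \<Longrightarrow> a - b \<in> dyadic_rationals"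
  using dyadic_add[of a "- b"] dyadic_uminus[of b] by simp

lemma dyadic_powi_mult:
  assumes "a \<in> dyadic_rationals"
  shows "2 powi j * a \<in> dyadic_rationals"
proof -
  obtain k m where a: "a = real_of_int k / 2 ^ m" using assms by (auto simp: dyadic_rationals_def)
  show ?thesis
  proof (cases "0 \<le> j")
    case True
    then have "2 powi j * a = real_of_int (k * 2 ^ nat j) / 2 ^ m"
      by (simp add: a power_int_def)
    then show ?thesis unfolding dyadic_rationals_def by blast
  next
    case False
    then have "2 powi j * a = real_of_int k / 2 ^ (m + nat (- j))"
      by (simp add: a power_int_def power_add field_simps)
    then show ?thesis unfolding dyadic_rationals_def by blast
  qed
qed

lemma dyadic_01: "0 \<in> dyadic_rationals" "1 \<in> dyadic_rationals"
proof -
  have "(0::real) = real_of_int 0 / 2 ^ 0" "(1::real) = real_of_int 1 / 2 ^ 0" by auto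
  then show "0 \<in> dyadic_rationals" "1 \<in> dyadic_rationals" unfolding dyadic_rationals_def by blast+
qed

text \<open>
  The end points 0 and 1 are dyadic and may be counted among the exceptional points, so the derivative matters
  only in the interior, where it is two-sided.
\<close>

definition dyadic_breaks :: "real set \<Rightarrow> (real \<Rightarrow> real) \<Rightarrow> bool"
  where "dyadic_breaks D f \<longleftrightarrow> finite D \<and> D \<subseteq> dyadic_rationals \<and>
    (\<forall>x\<in>{0<..<1} - D. \<exists>k::int. (f has_real_derivative 2 powi k) (at x))"

lemma dyadic_breaksD:
  "dyadic_breaks D f \<Longrightarrow> 0 < x \<Longrightarrow> x < 1 \<Longrightarrow> x \<notin> D \<Longrightarrow> \<exists>k::int. (f has_real_derivative 2 powi k) (at x)"
  by (simp add: dyadic_breaks_def)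

definition thompson_map :: "(real \<Rightarrow> real) \<Rightarrow> bool"
  where "thompson_map f \<longleftrightarrow> continuous_on {0..1} f \<and> strict_mono_on {0..1} f \<and> f 0 = 0 \<and> f 1 = 1 \<and>
    piecewise_linear_on {0..1} f \<and> (\<exists>D. dyadic_breaks D f)"

lemma thompson_map_image:
  fixes f :: "real \<Rightarrow> real"
  assumes "continuous_on {0..1} f" "strict_mono_on {0..1} f" "f 0 = (0::real)" "f 1 = (1::real)"
  shows "f ` {0..1} = {0..1::real}"
proof (intro subset_antisym subsetI)
  fix y assume "y \<in> f ` {0..1}"
  then obtain x where x: "x \<in> {0..1}" "y = f x" by blast
  have "0 \<le> f x" "f x \<le> 1"
    using strict_mono_onD[OF assms(2), of 0 x] strict_mono_onD[OF assms(2), of x 1] x(1) assms(3,4)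
    by (auto simp: le_less)
  then show "y \<in> {0..1}" by (simp add: x(2))
next
  fix y :: real assume "y \<in> {0..1}"
  then show "y \<in> f ` {0..1}"
    using IVT'[of f 0 y 1] assms by auto
qed

text \<open>
  A break point of the piecewise linear structure at which the derivative exists is no genuine
  break point: the slopes on both sides equal the derivative.
\<close>

lemma thompson_map_slope:
  assumes pl: "piecewise_linear_on {0..1} f" and D: "dyadic_breaks D f"
    and ab: "0 \<le> a" "a \<le> b" "b \<le> 1" "{a<..<b} \<inter> D = {}"
  shows "\<exists>k::int. \<forall>x\<in>{a..b}. f x = 2 powi k * (x - a) + f a"
proof -
  obtain B where B: "\<And>s t. finite (B \<inter> {s..t})"
    "\<And>s t. {s..t} \<subseteq> {0..1} \<Longrightarrow> {s<..<t} \<inter> B = {} \<Longrightarrow> \<exists>m c. \<forall>x\<in>{s..t}. f x = m * x + c"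
    by (rule piecewise_linear_onE[OF pl]) blast
  have der: "\<exists>k::int. (f has_real_derivative 2 powi k) (at p)" if "a < p" "p < b" for p
  proof -
    have "p \<notin> D" using that ab(4) by auto
    then show ?thesis using dyadic_breaksD[OF D, of p] that ab by simp
  qed
  have fin: "finite (B \<inter> {a<..<b})"
    by (rule finite_subset[OF _ B(1)[of a b]]) auto
  show ?thesis
  proof (rule piecewise_linear_on_Icc_induct[OF fin \<open>a \<le> b\<close>,
        where P = "\<lambda>s t. \<exists>k::int. \<forall>x\<in>{s..t}. f x = 2 powi k * (x - s) + f s"])
    fix s t assume st: "a \<le> s" "s \<le> t" "t \<le> b" "{s<..<t} \<inter> B = {}"
    show "\<exists>k::int. \<forall>x\<in>{s..t}. f x = 2 powi k * (x - s) + f s"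
    proof (cases "s = t")
      case False
      then have "s < t" using st by simp
      have "{s..t} \<subseteq> {0..1}" using st ab by auto
      then obtain m c where mc: "\<forall>x\<in>{s..t}. f x = m * x + c" using B(2) st(4) by blast
      define p where "p = (s + t) / 2"
      have p: "s < p" "p < t" using \<open>s < t\<close> by (auto simp: p_def)
      then obtain k :: int where "(f has_real_derivative 2 powi k) (at p)" using der[of p] st by auto
      then have m: "2 powi k = m"
        using mc \<open>s < t\<close> p by (intro affine_slope_eq_derivative[of s t f m c p]) auto
      have "f s = m * s + c" using bspec[OF mc, of s] \<open>s < t\<close> by simp
      then have "\<forall>x\<in>{s..t}. f x = 2 powi k * (x - s) + f s"
        using mc unfolding m by (simp add: algebra_simps)
      then show ?thesis by blast
    qed (auto intro: exI[of _ 0])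
  next
    fix s p t assume st: "a \<le> s" "s < p" "p < t" "t \<le> b"
      and left: "\<exists>k::int. \<forall>x\<in>{s..p}. f x = 2 powi k * (x - s) + f s"
      and right: "\<exists>k::int. \<forall>x\<in>{p..t}. f x = 2 powi k * (x - p) + f p"
    obtain k :: int where k: "(f has_real_derivative 2 powi k) (at p)" using der[of p] st by auto
    obtain k1 :: int where k1: "\<forall>x\<in>{s..p}. f x = 2 powi k1 * (x - s) + f s" using left by blast
    obtain k2 :: int where k2: "\<forall>x\<in>{p..t}. f x = 2 powi k2 * (x - p) + f p" using right by blast
    have e1: "2 powi k = (2 powi k1 :: real)"
      by (rule affine_slope_eq_derivative[OF _ _ _ k, of s p _ "f s - 2 powi k1 * s"])
        (use k1 st in \<open>auto simp: algebra_simps\<close>)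
    have e2: "2 powi k = (2 powi k2 :: real)"
      by (rule affine_slope_eq_derivative[OF _ _ _ k, of p t _ "f p - 2 powi k2 * p"])
        (use k2 st in \<open>auto simp: algebra_simps\<close>)
    have "f x = 2 powi k * (x - s) + f s" if x: "x \<in> {s..t}" for x
    proof (cases "x \<le> p")
      case True
      then have "x \<in> {s..p}" using x by simp
      then show ?thesis unfolding e1 by (rule bspec[OF k1])
    next
      case False
      then have "x \<in> {p..t}" "p \<in> {s..p}" using x st by auto
      then have "f x = 2 powi k * (x - p) + f p" "f p = 2 powi k * (p - s) + f s"
        using bspec[OF k2, of x] bspec[OF k1, of p] unfolding e1[symmetric] e2[symmetric] by blast+
      then show ?thesis by (simp add: algebra_simps)
    qed
    then show "\<exists>k::int. \<forall>x\<in>{s..t}. f x = 2 powi k * (x - s) + f s" by blast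
  qed
qed

text \<open>
  Between consecutive points of \<open>D\<close>, which are dyadic, increments are multiplied by a power of 2; the
  increments from 0 to \<open>x\<close> add up to \<open>f x\<close>.
\<close>

lemma thompson_map_dyadic:
  assumes f: "piecewise_linear_on {0..1} f" "dyadic_breaks D f" "f 0 = 0"
    and x: "x \<in> {0..1}" "x \<in> dyadic_rationals"
  shows "f x \<in> dyadic_rationals"
proof -
  have fin: "finite (D \<inter> {0<..<x})" using f(2) by (simp add: dyadic_breaks_def)
  have "0 \<in> dyadic_rationals \<longrightarrow> x \<in> dyadic_rationals \<longrightarrow> f x - f 0 \<in> dyadic_rationals"
  proof (rule piecewise_linear_on_Icc_induct[OF fin, where
        P = "\<lambda>s t. s \<in> dyadic_rationals \<longrightarrow> t \<in> dyadic_rationals \<longrightarrow> f t - f s \<in> dyadic_rationals"])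
    show "0 \<le> x" using x by simp
    fix s t assume st: "0 \<le> s" "s \<le> t" "t \<le> x" "{s<..<t} \<inter> D = {}"
    have "t \<le> 1" using st x by simp
    then obtain k :: int where k: "\<forall>y\<in>{s..t}. f y = 2 powi k * (y - s) + f s"
      using thompson_map_slope[OF f(1,2) st(1,2) _ st(4)] by blast
    have "f t - f s = 2 powi k * (t - s)" using bspec[OF k, of t] st(2) by simp
    then show "s \<in> dyadic_rationals \<longrightarrow> t \<in> dyadic_rationals \<longrightarrow> f t - f s \<in> dyadic_rationals"
      by (simp add: dyadic_powi_mult dyadic_diff)
  next
    fix s p t assume "p \<in> D"
      and left: "s \<in> dyadic_rationals \<longrightarrow> p \<in> dyadic_rationals \<longrightarrow> f p - f s \<in> dyadic_rationals"
      and right: "p \<in> dyadic_rationals \<longrightarrow> t \<in> dyadic_rationals \<longrightarrow> f t - f p \<in> dyadic_rationals"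
    have "p \<in> dyadic_rationals" using \<open>p \<in> D\<close> f(2) by (auto simp: dyadic_breaks_def)
    then have "f t - f s \<in> dyadic_rationals" if "s \<in> dyadic_rationals" "t \<in> dyadic_rationals"
      using dyadic_add[of "f t - f p" "f p - f s"] left right that by simp
    then show "s \<in> dyadic_rationals \<longrightarrow> t \<in> dyadic_rationals \<longrightarrow> f t - f s \<in> dyadic_rationals"
      by blast
  qed
  then show ?thesis using x f(3) dyadic_01 by simp
qed

lemma thompson_map_cong:
  assumes "thompson_map f" "\<And>x. x \<in> {0..1} \<Longrightarrow> f x = g x"
  shows "thompson_map g"
proof -
  obtain D where D: "dyadic_breaks D f" using assms(1) by (auto simp: thompson_map_def)
  have "dyadic_breaks D g"
    unfolding dyadic_breaks_def
  proof (intro conjI ballI)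
    fix x assume x: "x \<in> {0<..<1} - D"
    then obtain k :: int where "(f has_real_derivative 2 powi k) (at x)"
      using dyadic_breaksD[OF D, of x] by auto
    then have "(g has_real_derivative 2 powi k) (at x)"
      by (rule has_field_derivative_transform_within_open[of _ _ _ "{0<..<1}"]) (use x assms(2) in auto)
    then show "\<exists>k::int. (g has_real_derivative 2 powi k) (at x)" by blast
  qed (use D in \<open>auto simp: dyadic_breaks_def\<close>)
  moreover have "piecewise_linear_on {0..1} g"
    using assms by (intro piecewise_linear_on_cong[of "{0..1}" f g]) (simp_all add: thompson_map_def)
  moreover have "continuous_on {0..1} g"
    using assms by (intro continuous_on_eq[of "{0..1}" f g]) (simp_all add: thompson_map_def)
  moreover have "strict_mono_on {0..1} g"
    using assms by (auto simp: thompson_map_def monotone_on_def)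
  moreover have "g 0 = 0" "g 1 = 1"
    using assms(1) assms(2)[of 0] assms(2)[of 1] by (simp_all add: thompson_map_def)
  ultimately show ?thesis
    unfolding thompson_map_def by blast
qed

text \<open>
  The exceptional points of the inverse are the images of those of \<open>f\<close>, which are dyadic since \<open>f\<close>
  preserves dyadic rationals.
\<close>

lemma thompson_map_inverse:
  assumes f: "thompson_map f" and g: "continuous_on {0..1} g"
    "\<And>y. y \<in> {0..1} \<Longrightarrow> g y \<in> {0..1}" "\<And>y. y \<in> {0..1} \<Longrightarrow> f (g y) = y"
  shows "thompson_map g"
proof -
  have f': "continuous_on {0..1} f" "strict_mono_on {0..1} f" "f 0 = 0" "f 1 = 1"
    "piecewise_linear_on {0..1} f"
    using f by (auto simp: thompson_map_def)
  obtain D where D: "dyadic_breaks D f" using f by (auto simp: thompson_map_def)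
  have inj: "inj_on f {0..1}" using f'(2) by (rule strict_mono_on_imp_inj_on)
  have im: "f ` {0..1} = {0..1}" by (rule thompson_map_image[OF f'(1-4)])
  have gf: "g (f x) = x" if "x \<in> {0..1}" for x
  proof -
    have "f x \<in> {0..1}" using im imageI[OF that, of f] by simp
    then have "g (f x) \<in> {0..1}" "f (g (f x)) = f x" using g(2,3) by blast+
    then show ?thesis using inj_onD[OF inj] that by blast
  qed
  have mono: "strict_mono_on {0..1} g"
  proof (rule strict_mono_onI, rule ccontr)
    fix s t :: real assume st: "s \<in> {0..1}" "t \<in> {0..1}" "s < t" "\<not> g s < g t"
    then have "f (g t) \<le> f (g s)"
      using g(2)[OF st(1)] g(2)[OF st(2)] strict_mono_onD[OF f'(2), of "g t" "g s"]
      by (cases "g t = g s") auto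
    then show False using st g(3) by simp
  qed
  have g01: "g 0 = 0" "g 1 = 1" using gf[of 0] gf[of 1] f'(3,4) by simp_all
  have "piecewise_linear_on {0..1} g"
    by (rule piecewise_linear_on_inverse[OF _ _ f'(2) _ g(1) _ g(3) f'(5)]) (use im g(2) in auto)
  moreover have "dyadic_breaks (f ` (D \<inter> {0..1})) g"
    unfolding dyadic_breaks_def
  proof (intro conjI ballI)
    show "finite (f ` (D \<inter> {0..1}))" using D by (simp add: dyadic_breaks_def)
    show "f ` (D \<inter> {0..1}) \<subseteq> dyadic_rationals"
      using thompson_map_dyadic[OF f'(5) D f'(3)] D by (auto simp: dyadic_breaks_def)
    fix y assume y: "y \<in> {0<..<1} - f ` (D \<inter> {0..1})"
    then have gy: "0 < g y" "g y < 1"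
      using strict_mono_onD[OF mono, of 0 y] strict_mono_onD[OF mono, of y 1] g01 by auto
    have "g y \<notin> D"
    proof
      assume "g y \<in> D"
      then have "f (g y) \<in> f ` (D \<inter> {0..1})" using gy by (intro imageI) simp
      then show False using y g(3)[of y] by simp
    qed
    then obtain k :: int where k: "(f has_real_derivative 2 powi k) (at (g y))"
      using dyadic_breaksD[OF D gy] by blast
    have "(g has_real_derivative inverse (2 powi k)) (at y)"
    proof (rule DERIV_inverse_function[where f = f and g = g and D = "2 powi k" and a = 0 and b = 1])
      show "(f has_real_derivative 2 powi k) (at (g y))" by (rule k)
      have "continuous_on {0<..<1} g" by (rule continuous_on_subset[OF g(1)]) auto
      then show "isCont g y" using y by (simp add: continuous_on_eq_continuous_at)
    qed (use y g(3) in auto)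
    then have "(g has_real_derivative 2 powi (- k)) (at y)" by (simp add: power_int_minus)
    then show "\<exists>k::int. (g has_real_derivative 2 powi k) (at y)" by blast
  qed
  ultimately show ?thesis
    using mono g(1) g01 by (auto simp: thompson_map_def)
qed

lemma thompson_map_ex_inverse:
  assumes "thompson_map f"
  shows "\<exists>g. thompson_map g \<and> homeomorphism {0..1} {0..1} f g"
proof -
  have f: "continuous_on {0..1} f" "strict_mono_on {0..1} f" "f 0 = 0" "f 1 = 1"
    using assms by (auto simp: thompson_map_def)
  obtain g where g: "homeomorphism {0..1} {0..1} f g"
    using homeomorphism_compact[OF compact_Icc f(1) thompson_map_image[OF f] strict_mono_on_imp_inj_on[OF f(2)]]
    by blast
  have "thompson_map g"
    by (rule thompson_map_inverse[OF assms]) (use g in \<open>auto simp: homeomorphism_def\<close>)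
  then show ?thesis using g by blast
qed

text \<open>
  The exceptional points of \<open>g\<close> have to be pulled back along \<open>f\<close>; they stay dyadic because the inverse of \<open>f\<close>
  is again a map of this kind.
\<close>

lemma thompson_map_compose:
  assumes f: "thompson_map f" and g: "thompson_map g"
  shows "thompson_map (\<lambda>x. g (f x))"
proof -
  have f': "continuous_on {0..1} f" "strict_mono_on {0..1} f" "f 0 = 0" "f 1 = 1"
    "piecewise_linear_on {0..1} f"
    using f by (auto simp: thompson_map_def)
  have g': "continuous_on {0..1} g" "strict_mono_on {0..1} g" "g 0 = 0" "g 1 = 1"
    "piecewise_linear_on {0..1} g"
    using g by (auto simp: thompson_map_def)
  obtain D where D: "dyadic_breaks D f" using f by (auto simp: thompson_map_def)
  obtain E where E: "dyadic_breaks E g" using g by (auto simp: thompson_map_def)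
  obtain h where h: "thompson_map h" "homeomorphism {0..1} {0..1} f h"
    using thompson_map_ex_inverse[OF f] by blast
  have im: "f ` {0..1} = {0..1}" by (rule thompson_map_image[OF f'(1-4)])
  have fI: "f x \<in> {0..1}" if "x \<in> {0..1}" for x using imageI[OF that, of f] im by simp
  have "dyadic_breaks (D \<union> h ` (E \<inter> {0..1})) (\<lambda>x. g (f x))"
    unfolding dyadic_breaks_def
  proof (intro conjI ballI)
    show "finite (D \<union> h ` (E \<inter> {0..1}))" using D E by (simp add: dyadic_breaks_def)
    obtain D' where "dyadic_breaks D' h" using h(1) by (auto simp: thompson_map_def)
    then show "D \<union> h ` (E \<inter> {0..1}) \<subseteq> dyadic_rationals"
      using thompson_map_dyadic[of h D'] h(1) D E by (auto simp: dyadic_breaks_def thompson_map_def)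
    fix x assume x: "x \<in> {0<..<1} - (D \<union> h ` (E \<inter> {0..1}))"
    then have fx: "0 < f x" "f x < 1"
      using strict_mono_onD[OF f'(2), of 0 x] strict_mono_onD[OF f'(2), of x 1] f'(3,4) by auto
    have "f x \<notin> E"
    proof
      assume "f x \<in> E"
      then have "h (f x) \<in> h ` (E \<inter> {0..1})" using fx by (intro imageI) simp
      moreover have "h (f x) = x" using h(2) x by (auto simp: homeomorphism_def)
      ultimately show False using x by simp
    qed
    then obtain l :: int where l: "(g has_real_derivative 2 powi l) (at (f x))"
      using dyadic_breaksD[OF E fx] by blast
    obtain k :: int where k: "(f has_real_derivative 2 powi k) (at x)"
      using dyadic_breaksD[OF D, of x] x by auto
    have "((\<lambda>x. g (f x)) has_real_derivative 2 powi l * 2 powi k) (at x)"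
      by (rule DERIV_chain2[OF l k])
    then have "((\<lambda>x. g (f x)) has_real_derivative 2 powi (l + k)) (at x)"
      by (simp add: power_int_add)
    then show "\<exists>k::int. ((\<lambda>x. g (f x)) has_real_derivative 2 powi k) (at x)" by blast
  qed
  moreover have "piecewise_linear_on {0..1} (\<lambda>x. g (f x))"
    by (rule piecewise_linear_on_compose[OF closed_atLeastAtMost f'(1,2) _ f'(5) g'(5)]) (simp add: im)
  moreover have "continuous_on {0..1} (\<lambda>x. g (f x))"
    by (rule continuous_on_compose2[OF g'(1) f'(1)]) (simp add: im)
  moreover have "strict_mono_on {0..1} (\<lambda>x. g (f x))"
    by (rule strict_mono_onI)
      (rule strict_mono_onD[OF g'(2) fI fI strict_mono_onD[OF f'(2)]]; assumption)
  ultimately show ?thesis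
    using f'(3,4) g'(3,4) by (auto simp: thompson_map_def)
qed

lemma thompson_map_id: "thompson_map (\<lambda>x. x)"
proof -
  have "\<forall>x\<in>{s..t}. x = 1 * x + (0::real)" for s t :: real by simp
  then have "piecewise_linear_on {0..1} (\<lambda>x. x)"
    by (intro piecewise_linear_onI[of "{}"]) (simp, blast)
  moreover have "((\<lambda>x. x) has_real_derivative 2 powi 0) (at x)" for x :: real
    by (auto intro!: derivative_eq_intros)
  then have "dyadic_breaks {} (\<lambda>x. x)"
    unfolding dyadic_breaks_def by blast
  ultimately show ?thesis by (auto simp: thompson_map_def monotone_on_def)
qed

text \<open>
  A continuous injective map on an interval is monotone in one of the two directions; a single positive
  derivative decides which.
\<close>

lemma strict_mono_on_of_positive_derivative:
  fixes f :: "real \<Rightarrow> real"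
  assumes cont: "continuous_on {a..b} f" and inj: "inj_on f {a..b}"
    and p: "a < p" "p < b" and der: "(f has_real_derivative d) (at p)" "0 < d"
  shows "strict_mono_on {a..b} f"
proof -
  have dichotomy: "f s < f t \<and> f t < f u \<or> f u < f t \<and> f t < f s"
    if "a \<le> s" "s < t" "t < u" "u \<le> b" for s t u
    using that(2,3) by (rule continuous_inj_imp_mono)
      (use that in \<open>auto intro: continuous_on_subset[OF cont] inj_on_subset[OF inj]\<close>)
  obtain e where e: "e > 0" "\<And>h. 0 < h \<Longrightarrow> h < e \<Longrightarrow> f p < f (p + h)"
    using DERIV_pos_inc_right[OF der] by auto
  define h where "h = min (e / 2) ((b - p) / 2)"
  have h: "0 < h" "h < e" "h < b - p" using e(1) p by (auto simp: h_def min_def)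
  define q where "q = p + h"
  have q: "p < q" "q < b" "f p < f q"
    using h e(2)[OF h(1,2)] by (auto simp: q_def)
  have up_p: "f a < f p" "f p < f b"
    using dichotomy[of a p q] dichotomy[of p q b] p q by auto
  show ?thesis
  proof (rule strict_mono_onI)
    fix s t assume st: "s \<in> {a..b}" "t \<in> {a..b}" "s < t"
    have ab: "f a < f b" using up_p by simp
    have s: "f s < f b" if "s < b"
      using dichotomy[of a s b] that st ab by (cases "a = s") auto
    show "f s < f t"
      using dichotomy[of s t b] s st ab by (cases "t = b") auto
  qed
qed

lemma Thompson_F_carrier: "f \<in> carrier Thompson_F \<longleftrightarrow> f \<in> extensional {0..1} \<and> thompson_map f"
proof (intro iffI conjI)
  assume f: "f \<in> carrier Thompson_F"
  then show "f \<in> extensional {0..1}" by (simp add: Thompson_F_def)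
  obtain g where g: "homeomorphism {0..1} {0..1} f g" and pl: "piecewise_linear_on {0..1} f"
    using f by (auto simp: Thompson_F_def)
  obtain D where D: "D \<subseteq> dyadic_rationals" "finite D"
    "\<And>x. x \<in> {0..1} - D \<Longrightarrow> \<exists>k::int. (f has_real_derivative 2 powi k) (at x within {0..1})"
    using f by (auto simp: Thompson_F_def)
  have der: "\<exists>k::int. (f has_real_derivative 2 powi k) (at x)" if x: "x \<in> {0<..<1} - D" for x
    using D(3)[of x] x by (auto simp: at_within_Icc_at)
  have cont: "continuous_on {0..1} f" using g by (rule homeomorphism_cont1)
  have inj: "inj_on f {0..1}"
    by (rule inj_on_inverseI[of _ g]) (rule homeomorphism_apply1[OF g])
  have "infinite ({0<..<1::real} - D)"
    using D(2) by (simp add: infinite_Ioo)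
  then have "{0<..<1::real} - D \<noteq> {}" by (metis finite.emptyI)
  then obtain p where p: "p \<in> {0<..<1} - D" by blast
  then obtain k :: int where "(f has_real_derivative 2 powi k) (at p)" using der by blast
  then have mono: "strict_mono_on {0..1} f"
    using p by (intro strict_mono_on_of_positive_derivative[OF cont inj, of p]) auto
  have im: "f ` {0..1} = {0..1}" using g by (rule homeomorphism_image1)
  have fI: "f x \<in> {0..1}" if "x \<in> {0..1}" for x using imageI[OF that, of f] im by simp
  have f0: "f 0 = 0"
  proof -
    have "0 \<in> f ` {0..1}" unfolding im by simp
    then obtain x where x: "x \<in> {0..1}" "f x = 0" by force
    then show ?thesis
      using strict_mono_onD[OF mono, of 0 x] fI[of 0] by (cases "x = 0") auto
  qed
  have f1: "f 1 = 1"
  proof -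
    have "1 \<in> f ` {0..1}" unfolding im by simp
    then obtain x where x: "x \<in> {0..1}" "f x = 1" by force
    then show ?thesis
      using strict_mono_onD[OF mono, of x 1] fI[of 1] by (cases "x = 1") auto
  qed
  show "thompson_map f"
    using cont mono f0 f1 pl D(1,2) der unfolding thompson_map_def dyadic_breaks_def by blast
next
  assume f: "f \<in> extensional {0..1} \<and> thompson_map f"
  then obtain g where g: "homeomorphism {0..1} {0..1} f g"
    using thompson_map_ex_inverse by blast
  obtain D where D: "dyadic_breaks D f" using f by (auto simp: thompson_map_def)
  have "\<exists>k::int. (f has_real_derivative 2 powi k) (at x within {0..1})" if "x \<in> {0..1} - (D \<union> {0, 1})" for x
  proof -
    have "x \<in> {0<..<1} - D" using that by auto
    then show ?thesis using D has_field_derivative_at_within by (fastforce simp: dyadic_breaks_def)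
  qed
  moreover have "finite (D \<union> {0, 1})" "D \<union> {0, 1} \<subseteq> dyadic_rationals"
    using D dyadic_01 by (auto simp: dyadic_breaks_def)
  ultimately have "\<exists>D\<subseteq>dyadic_rationals. finite D \<and>
      (\<forall>x\<in>{0..1} - D. \<exists>k::int. (f has_real_derivative 2 powi k) (at x within {0..1}))"
    by blast
  then show "f \<in> carrier Thompson_F"
    using f g unfolding Thompson_F_def by (simp add: thompson_map_def) blast
qed

lemma Thompson_F_maps:
  assumes "f \<in> carrier Thompson_F" "t \<in> {0..1}"
  shows "f t \<in> {0..1}"
proof -
  have "f ` {0..1} = {0..1}"
    using assms(1) by (intro thompson_map_image) (auto simp: Thompson_F_carrier thompson_map_def)
  then show ?thesis using imageI[OF assms(2), of f] by simp
qed

lemma Thompson_F_mult: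
  assumes "f \<in> carrier Thompson_F" "g \<in> carrier Thompson_F"
  shows "f \<otimes>\<^bsub>Thompson_F\<^esub> g = (\<lambda>x\<in>{0..1}. f (g x))"
proof -
  have "f \<in> Bij {0..1}" if "f \<in> carrier Thompson_F" for f
  proof -
    have f: "f \<in> extensional {0..1}" "thompson_map f" using that by (auto simp: Thompson_F_carrier)
    then have "inj_on f {0..1}" "f ` {0..1} = {0..1}"
      by (auto simp: thompson_map_def thompson_map_image strict_mono_on_imp_inj_on)
    then show ?thesis using f by (simp add: Bij_def bij_betw_def)
  qed
  then show ?thesis using assms by (simp add: Thompson_F_def BijGroup_def compose_def)
qed

lemma Thompson_F_one: "\<one>\<^bsub>Thompson_F\<^esub> = (\<lambda>x\<in>{0..1}. x)"
  by (simp add: Thompson_F_def BijGroup_def)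

lemma Thompson_F_I: "thompson_map f \<Longrightarrow> restrict f {0..1} \<in> carrier Thompson_F"
  by (auto simp: Thompson_F_carrier intro: thompson_map_cong[of f])

lemma group_Thompson_F: "group Thompson_F"
proof (rule groupI)
  show "\<one>\<^bsub>Thompson_F\<^esub> \<in> carrier Thompson_F"
    unfolding Thompson_F_one by (rule Thompson_F_I[OF thompson_map_id])
  fix f g assume f: "f \<in> carrier Thompson_F" and g: "g \<in> carrier Thompson_F"
  show fg: "f \<otimes>\<^bsub>Thompson_F\<^esub> g \<in> carrier Thompson_F"
    if "f \<in> carrier Thompson_F" "g \<in> carrier Thompson_F" for f g
    unfolding Thompson_F_mult[OF that]
    using that by (intro Thompson_F_I thompson_map_compose[of g f]) (simp_all add: Thompson_F_carrier)
  show "f \<otimes>\<^bsub>Thompson_F\<^esub> g \<otimes>\<^bsub>Thompson_F\<^esub> h = f \<otimes>\<^bsub>Thompson_F\<^esub> (g \<otimes>\<^bsub>Thompson_F\<^esub> h)"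
    if h: "h \<in> carrier Thompson_F" for h
    unfolding Thompson_F_mult[OF fg[OF f g] h] Thompson_F_mult[OF f fg[OF g h]]
    unfolding Thompson_F_mult[OF f g] Thompson_F_mult[OF g h]
    using Thompson_F_maps[OF h] by (intro restrict_ext) simp
  show "\<one>\<^bsub>Thompson_F\<^esub> \<otimes>\<^bsub>Thompson_F\<^esub> f = f"
    unfolding Thompson_F_mult[OF \<open>\<one>\<^bsub>Thompson_F\<^esub> \<in> carrier Thompson_F\<close> f]
    unfolding Thompson_F_one
    using f Thompson_F_maps[OF f] by (auto simp: Thompson_F_carrier extensional_def fun_eq_iff)
  show "\<exists>g\<in>carrier Thompson_F. g \<otimes>\<^bsub>Thompson_F\<^esub> f = \<one>\<^bsub>Thompson_F\<^esub>"
  proof -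
    obtain h where h: "thompson_map h" "homeomorphism {0..1} {0..1} f h"
      using thompson_map_ex_inverse f by (auto simp: Thompson_F_carrier)
    have "restrict h {0..1} \<otimes>\<^bsub>Thompson_F\<^esub> f = \<one>\<^bsub>Thompson_F\<^esub>"
      unfolding Thompson_F_mult[OF Thompson_F_I[OF h(1)] f] Thompson_F_one
      using h(2) Thompson_F_maps[OF f] by (intro restrict_ext) (auto simp: homeomorphism_def)
    then show ?thesis using Thompson_F_I[OF h(1)] by blast
  qed
qed

theorem contains_copy_Thompson_F:
  assumes "\<nexists>B :: 'h::complex_hilbert set. finite B \<and> cspan B = UNIV"
  shows "contains_copy (Out_Roe :: ((int, 'h) ell2_op \<Rightarrow> (int, 'h) ell2_op) set monoid) Thompson_F"
proof (rule contains_copy_Out_Roe_of_interval_actions[OF assms group_Thompson_F, where \<rho> = "\<lambda>f n. f"])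
  fix f n assume f: "f \<in> carrier Thompson_F"
  then have f': "f \<in> extensional {0..1}" "thompson_map f" by (auto simp: Thompson_F_carrier)
  then show "\<exists>L. \<forall>n::nat. L-lipschitz_on {0..1} f"
    using piecewise_linear_on_lipschitz[of "{0..1}" f 0 1] by (auto simp: thompson_map_def)
  show "f 0 = 0" "f 1 = 1" using f' by (auto simp: thompson_map_def)
  show "f t \<in> {0..1}" if "t \<in> {0..1}" for t using Thompson_F_maps[OF f that] .
  show "(f \<otimes>\<^bsub>Thompson_F\<^esub> g) t = f (g t)" if "g \<in> carrier Thompson_F" "t \<in> {0..1}" for g t
    using Thompson_F_mult[OF f that(1)] that(2) by simp
  assume "\<And>(n::nat) t. t \<in> {0..1} \<Longrightarrow> f t = t"
  then show "f = \<one>\<^bsub>Thompson_F\<^esub>"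
    using f'(1) unfolding Thompson_F_one by (intro extensionalityI[of f "{0..1}"]) auto
next
  show "\<one>\<^bsub>Thompson_F\<^esub> t = t" if "t \<in> {0..1}" for t using that by (simp add: Thompson_F_one)
qed


section \<open>Free groups of bi-Lipschitz maps\<close>

definition stretch :: "real \<Rightarrow> (real \<Rightarrow> real) \<Rightarrow> bool"
  where "stretch C f \<longleftrightarrow> f 0 = 0 \<and> f 1 = 1 \<and>
    (\<forall>x\<in>{0..1}. \<forall>y\<in>{0..1}. x \<le> y \<longrightarrow> (y - x) / C \<le> f y - f x \<and> f y - f x \<le> C * (y - x))"

lemma stretchD:
  assumes "stretch C f" "0 \<le> x" "x \<le> y" "y \<le> 1"
  shows "(y - x) / C \<le> f y - f x" "f y - f x \<le> C * (y - x)"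
  using assms by (auto simp: stretch_def)

lemma stretch_maps:
  assumes "stretch C f" "0 < C" "x \<in> {0..1}"
  shows "f x \<in> {0..1}"
proof -
  have "0 \<le> (x - 0) / C" "0 \<le> (1 - x) / C" using assms by auto
  then have "f 0 \<le> f x" "f x \<le> f 1"
    using stretchD(1)[OF assms(1), of 0 x] stretchD(1)[OF assms(1), of x 1] assms(3) by auto
  then show ?thesis using assms(1) by (simp add: stretch_def)
qed

lemma stretch_lipschitz:
  assumes "stretch C f" "0 < C"
  shows "C-lipschitz_on {0..1} f"
proof (rule lipschitz_on_leI)
  fix x y :: real assume xy: "x \<in> {0..1}" "y \<in> {0..1}" "x \<le> y"
  have "0 \<le> (y - x) / C" using assms(2) xy by simp
  then show "dist (f x) (f y) \<le> C * dist x y"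
    using stretchD[OF assms(1), of x y] xy by (simp add: dist_real_def)
qed (use assms in simp)

definition interval_inverse :: "(real \<Rightarrow> real) \<Rightarrow> real \<Rightarrow> real"
  where "interval_inverse f = inv_into {0..1} f"

lemma
  assumes f: "stretch C f" and C: "0 < C"
  shows stretch_inverse: "stretch C (interval_inverse f)"
    and stretch_f_inverse: "y \<in> {0..1} \<Longrightarrow> f (interval_inverse f y) = y"
    and stretch_inverse_f: "x \<in> {0..1} \<Longrightarrow> interval_inverse f (f x) = x"
proof -
  have less: "f x < f y" if "0 \<le> x" "x < y" "y \<le> 1" for x y
  proof -
    have "0 < (y - x) / C" using that C by simp
    then show ?thesis using stretchD(1)[OF f, of x y] that by simp
  qed
  have inj: "inj_on f {0..1}"
    by (rule linorder_inj_onI) (use less in fastforce)+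
  have "continuous_on {0..1} f"
    by (rule lipschitz_on_continuous_on[OF stretch_lipschitz[OF f C]])
  then have surj: "y \<in> f ` {0..1}" if "y \<in> {0..1}" for y
    using IVT'[of f 0 y 1] that f by (auto simp: stretch_def)
  show fi: "f (interval_inverse f y) = y" if "y \<in> {0..1}" for y
    unfolding interval_inverse_def by (rule f_inv_into_f[OF surj[OF that]])
  have mem: "interval_inverse f y \<in> {0..1}" if "y \<in> {0..1}" for y
    unfolding interval_inverse_def by (rule inv_into_into[OF surj[OF that]])
  show if': "interval_inverse f (f x) = x" if "x \<in> {0..1}" for x
    unfolding interval_inverse_def by (rule inv_into_f_f[OF inj that])
  show "stretch C (interval_inverse f)"
    unfolding stretch_def
  proof (intro conjI ballI impI)
    show "interval_inverse f 0 = 0" "interval_inverse f 1 = 1"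
      using if'[of 0] if'[of 1] f by (simp_all add: stretch_def)
    fix x y :: real assume xy: "x \<in> {0..1}" "y \<in> {0..1}" "x \<le> y"
    define s t where "s = interval_inverse f x" and "t = interval_inverse f y"
    have st: "0 \<le> s" "s \<le> 1" "0 \<le> t" "t \<le> 1" "f s = x" "f t = y"
      using mem fi xy by (auto simp: s_def t_def)
    have "s \<le> t" using less[of t s] st xy by (cases "s \<le> t") auto
    then have "(t - s) / C \<le> y - x" "y - x \<le> C * (t - s)"
      using stretchD[OF f, of s t] st by auto
    then show "(y - x) / C \<le> interval_inverse f y - interval_inverse f x"
      "interval_inverse f y - interval_inverse f x \<le> C * (y - x)"
      using C unfolding s_def[symmetric] t_def[symmetric] by (simp_all add: field_simps)
  qed
qed

lemma stretch_id: "1 \<le> C \<Longrightarrow> stretch C (\<lambda>x. x)"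
proof -
  assume C: "1 \<le> C"
  have "d / C \<le> d" "d \<le> C * d" if "0 \<le> d" for d
    using C that mult_right_mono[OF C that] by (auto simp: divide_le_eq mult.commute)
  then show ?thesis by (simp add: stretch_def)
qed

fun letter_map :: "('s \<Rightarrow> real \<Rightarrow> real) \<Rightarrow> 's \<times> bool \<Rightarrow> real \<Rightarrow> real" where
  "letter_map a (s, True) = a s"
| "letter_map a (s, False) = interval_inverse (a s)"

definition word_map :: "('s \<Rightarrow> real \<Rightarrow> real) \<Rightarrow> ('s \<times> bool) list \<Rightarrow> real \<Rightarrow> real"
  where "word_map a w t = foldr (letter_map a) w t"

lemma word_map_simps [simp]:
  "word_map a [] t = t" "word_map a (g # w) t = letter_map a g (word_map a w t)"
  by (simp_all add: word_map_def)

locale stretch_generators =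
  fixes a :: "'s \<Rightarrow> real \<Rightarrow> real" and C :: real
  assumes stretch: "\<And>s. stretch C (a s)" and C: "0 < C"
begin

lemma letter_map_stretch: "stretch C (letter_map a g)"
  by (cases g; cases "snd g") (auto simp: stretch stretch_inverse C)

lemma letter_map_cancel: "t \<in> {0..1} \<Longrightarrow> letter_map a (s, b) (letter_map a (s, \<not> b) t) = t"
  by (cases b) (auto simp: stretch_f_inverse[OF stretch C] stretch_inverse_f[OF stretch C])

lemma word_map_maps: "t \<in> {0..1} \<Longrightarrow> word_map a w t \<in> {0..1}"
  by (induction w) (use stretch_maps[OF letter_map_stretch C] in auto)

lemma word_map_ends: "word_map a w 0 = 0" "word_map a w 1 = 1"
  using letter_map_stretch by (induction w) (auto simp: stretch_def)

lemma word_map_lipschitz: "(C ^ length w)-lipschitz_on {0..1} (word_map a w)"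
proof (induction w)
  case Nil
  then show ?case by (simp add: lipschitz_on_def)
next
  case (Cons g w)
  have "(C * C ^ length w)-lipschitz_on {0..1} (letter_map a g \<circ> word_map a w)"
    by (intro lipschitz_on_compose Cons lipschitz_on_subset[OF stretch_lipschitz[OF letter_map_stretch C]])
      (use word_map_maps in blast)
  moreover have "letter_map a g \<circ> word_map a w = word_map a (g # w)" by (simp add: fun_eq_iff)
  ultimately show ?case by simp
qed

lemma word_map_cancel_Cons:
  assumes "t \<in> {0..1}"
  shows "word_map a (cancel_Cons g w) t = letter_map a g (word_map a w t)"
proof (cases w)
  case (Cons h w')
  show ?thesis
  proof (cases "fst g = fst h \<and> snd g \<noteq> snd h")
    case True
    then obtain s b where "g = (s, b)" "h = (s, \<not> b)"
      by (cases g; cases h) auto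
    then show ?thesis
      using Cons True letter_map_cancel[OF word_map_maps[OF assms]] by simp
  qed (use Cons in auto)
qed simp

lemma word_map_mult:
  assumes "t \<in> {0..1}"
  shows "word_map a (foldr cancel_Cons v w) t = word_map a v (word_map a w t)"
  by (induction v) (simp_all add: word_map_cancel_Cons[OF assms])

end

lemma reduced_word_nth:
  assumes "reduced_word w" "Suc i < length w"
  shows "\<not> (fst (w ! i) = fst (w ! Suc i) \<and> snd (w ! i) \<noteq> snd (w ! Suc i))"
  using assms
proof (induction w arbitrary: i)
  case (Cons g w)
  then obtain h w' where w: "w = h # w'" by (cases w) auto
  show ?case
  proof (cases i)
    case 0
    then show ?thesis using Cons.prems w by simp
  next
    case (Suc j)
    then show ?thesis using Cons.IH[of j] Cons.prems(2) reduced_word_tl[OF Cons.prems(1)] by simp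
  qed
qed simp


text \<open>
  The points \<open>-1, 0, \<dots>, l + 1\<close> correspond to equidistant points of \<open>[0, 1]\<close>. The outermost two are the end
  points of the interval; they have to stay fixed, so the path of a word uses only \<open>0, \<dots>, l\<close>.
\<close>

definition path_point :: "nat \<Rightarrow> int \<Rightarrow> real"
  where "path_point l i = real_of_int (i + 1) / real (l + 2)"

text \<open>
  The pairs \<open>(p, q)\<close> such that the letter \<open>s\<close> has to take the point \<open>p\<close> to the point \<open>q\<close>. The last letter of a word acts
  first, so the letter at position \<open>i\<close> has to take \<open>i + 1\<close> to \<open>i\<close>; if this letter is the inverse of \<open>s\<close>, then \<open>s\<close>
  has to take \<open>i\<close> to \<open>i + 1\<close>.
\<close>

definition path_moves :: "('s \<times> bool) list \<Rightarrow> 's \<Rightarrow> (int \<times> int) set"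
  where "path_moves v s =
    {(-1, -1), (int (length v) + 1, int (length v) + 1)} \<union>
    {(int i + 1, int i) | i. i < length v \<and> v ! i = (s, True)} \<union>
    {(int i, int i + 1) | i. i < length v \<and> v ! i = (s, False)}"

lemma finite_path_moves: "finite (path_moves v s)"
  unfolding path_moves_def by (auto intro!: finite_image_set)

text \<open>
  Points that move in the same direction keep their distance, and the distance to a fixed end point changes
  by 1 and is at least 1 before and after. For points that move in opposite directions the distance
  changes by 2. This breaks the estimate only at distance 0, or at distance 1 or 2 if they move
  towards each other. At distance 0 or 2 the two prescriptions come from adjacent letters \<open>s\<close> and
  \<open>s\<^sup>-\<^sup>1\<close>, which a reduced word excludes; at distance 1 they would come from one and the same letter.
\<close>

lemma path_moves_stretch:
  assumes v: "reduced_word v" and pq: "(p, q) \<in> path_moves v s" "(p', q') \<in> path_moves v s" and le: "p \<le> p'"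
  shows "p' - p \<le> 3 * (q' - q) \<and> q' - q \<le> 3 * (p' - p)"
proof -
  have turn: "\<not> (v ! i = (s, b) \<and> v ! Suc i = (s, \<not> b))" if "Suc i < length v" for i b
    using reduced_word_nth[OF v that] by auto
  have cases: "(p = -1 \<and> q = -1) \<or> (p = int (length v) + 1 \<and> q = p) \<or>
      (\<exists>i<length v. p = int i + 1 \<and> q = int i \<and> v ! i = (s, True)) \<or>
      (\<exists>i<length v. p = int i \<and> q = int i + 1 \<and> v ! i = (s, False))"
    if "(p, q) \<in> path_moves v s" for p q
    using that unfolding path_moves_def by auto
  from cases[OF pq(1)] consider (low) "p = -1" "q = -1" | (high) "p = int (length v) + 1" "q = p"
    | (dn) i where "i < length v" "p = int i + 1" "q = int i" "v ! i = (s, True)"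
    | (up) i where "i < length v" "p = int i" "q = int i + 1" "v ! i = (s, False)"
    by blast
  note 1 = this
  from cases[OF pq(2)] consider (low) "p' = -1" "q' = -1" | (high) "p' = int (length v) + 1" "q' = p'"
    | (dn) j where "j < length v" "p' = int j + 1" "q' = int j" "v ! j = (s, True)"
    | (up) j where "j < length v" "p' = int j" "q' = int j + 1" "v ! j = (s, False)"
    by blast
  note 2 = this
  show ?thesis
  proof (cases rule: 1)
    case low
    show ?thesis by (cases rule: 2) (use low le in auto)
  next
    case high
    show ?thesis by (cases rule: 2) (use high le in auto)
  next
    case (dn i)
    show ?thesis
    proof (cases rule: 2)
      case (up j)
      have "j \<noteq> Suc i" using turn[of i True] dn up by auto
      then show ?thesis using dn up le by auto
    qed (use dn le in auto)
  next
    case (up i)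
    show ?thesis
    proof (cases rule: 2)
      case (dn j)
      have "j \<noteq> Suc i" using turn[of i False] dn up by auto
      moreover have "i \<noteq> Suc j" using turn[of j True] dn up by auto
      moreover have "j \<noteq> i" using dn up by auto
      ultimately show ?thesis using dn up le by auto
    qed (use up le in auto)
  qed
qed

text \<open>
  The smallest function vanishing at 0 all of whose difference quotients lie between \<open>1/3\<close> and 3.
\<close>

definition ramp :: "real \<Rightarrow> real"
  where "ramp x = min (x / 3) (3 * x)"

text \<open>
  The McShane extension of the prescriptions: the smallest map with difference quotients between \<open>1/3\<close> and
  3 that lies above all prescribed values.
\<close>

definition path_map :: "('s \<times> bool) list \<Rightarrow> 's \<Rightarrow> real \<Rightarrow> real"
  where "path_map v s x = Max ((\<lambda>(p, q). path_point (length v) q + ramp (x - path_point (length v) p)) ` path_moves v s)"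

lemma path_map_agrees:
  assumes v: "reduced_word v" and pq: "(p, q) \<in> path_moves v s"
  shows "path_map v s (path_point (length v) p) = path_point (length v) q"
  unfolding path_map_def
proof (rule Max_eqI)
  let ?l = "length v"
  show "finite ((\<lambda>(p', q). path_point ?l q + ramp (path_point ?l p - path_point ?l p')) ` path_moves v s)"
    by (intro finite_imageI finite_path_moves)
  show "path_point ?l q \<in> (\<lambda>(p', q). path_point ?l q + ramp (path_point ?l p - path_point ?l p')) ` path_moves v s"
    using pq by (force simp: ramp_def intro!: image_eqI[of _ _ "(p, q)"])
  fix y assume "y \<in> (\<lambda>(p', q). path_point ?l q + ramp (path_point ?l p - path_point ?l p')) ` path_moves v s"
  then obtain p' q' where pq': "(p', q') \<in> path_moves v s"
    and y: "y = path_point ?l q' + ramp (path_point ?l p - path_point ?l p')" by auto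
  have diff: "path_point ?l i - path_point ?l j = real_of_int (i - j) / real (?l + 2)" for i j
    by (simp add: path_point_def diff_divide_distrib[symmetric])
  have "(p - p' \<le> 3 * (q - q')) \<or> (3 * (p - p') \<le> q - q')"
  proof (cases "p \<le> p'")
    case True
    then show ?thesis using path_moves_stretch[OF v pq pq' True] by auto
  next
    case False
    then show ?thesis using path_moves_stretch[OF v pq' pq] by auto
  qed
  then have "real_of_int (p - p') \<le> 3 * real_of_int (q - q') \<or> 3 * real_of_int (p - p') \<le> real_of_int (q - q')"
    by linarith
  then have "path_point ?l p - path_point ?l p' \<le> 3 * (path_point ?l q - path_point ?l q') \<or>
      3 * (path_point ?l p - path_point ?l p') \<le> path_point ?l q - path_point ?l q'"
    unfolding diff times_divide_eq_right
    by (elim disjE) (blast intro: divide_right_mono of_nat_0_le_iff)+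
  then have "ramp (path_point ?l p - path_point ?l p') \<le> path_point ?l q - path_point ?l q'"
    unfolding ramp_def min_le_iff_disj by auto
  then show "y \<le> path_point ?l q" by (simp add: y)
qed

lemma path_map_stretch:
  assumes v: "reduced_word v"
  shows "stretch 3 (path_map v s)"
proof -
  let ?l = "length v"
  let ?h = "\<lambda>x (p, q). path_point ?l q + ramp (x - path_point ?l p)"
  have fin: "finite (?h x ` path_moves v s)" for x
    by (intro finite_imageI finite_path_moves)
  have ne: "?h x ` path_moves v s \<noteq> {}" for x by (simp add: path_moves_def)
  have ends: "path_point ?l (-1) = 0" "path_point ?l (int ?l + 1) = 1"
    by (simp_all add: path_point_def)
  have "(y - x) / 3 \<le> path_map v s y - path_map v s x \<and> path_map v s y - path_map v s x \<le> 3 * (y - x)"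
    if "x \<le> y" for x y
  proof
    have ramp: "ramp (x - p) + (y - x) / 3 \<le> ramp (y - p)" "ramp (y - p) \<le> ramp (x - p) + 3 * (y - x)" for p
      using that by (auto simp: ramp_def min_def field_simps)
    have "path_map v s x \<in> ?h x ` path_moves v s"
      unfolding path_map_def by (rule Max_in[OF fin ne])
    then obtain p q where m: "(p, q) \<in> path_moves v s" "path_map v s x = path_point ?l q + ramp (x - path_point ?l p)"
      by auto
    have "?h y (p, q) \<le> path_map v s y"
      unfolding path_map_def using m(1) by (intro Max_ge[OF fin] imageI)
    then show "(y - x) / 3 \<le> path_map v s y - path_map v s x"
      using m(2) ramp(1)[of "path_point ?l p"] unfolding prod.case by linarith
    have "path_map v s y \<in> ?h y ` path_moves v s"
      unfolding path_map_def by (rule Max_in[OF fin ne])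
    then obtain p q where m: "(p, q) \<in> path_moves v s" "path_map v s y = path_point ?l q + ramp (y - path_point ?l p)"
      by auto
    have "?h x (p, q) \<le> path_map v s x"
      unfolding path_map_def using m(1) by (intro Max_ge[OF fin] imageI)
    then show "path_map v s y - path_map v s x \<le> 3 * (y - x)"
      using m(2) ramp(2)[of "path_point ?l p"] unfolding prod.case by linarith
  qed
  moreover have "path_map v s 0 = 0" "path_map v s 1 = 1"
    using path_map_agrees[OF v, of "-1" "-1" s] path_map_agrees[OF v, of "int ?l + 1" "int ?l + 1" s]
    by (simp_all add: path_moves_def ends)
  ultimately show ?thesis by (simp add: stretch_def)
qed

text \<open>
  The suffix of \<open>w\<close> from position \<open>i\<close> on takes the last point of the path to the point \<open>i\<close>.
\<close>

lemma word_map_moves_path: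
  fixes c :: "'s \<Rightarrow> 'c"
  assumes v: "reduced_word v" "v = map (\<lambda>(s, b). (c s, b)) w" and i: "i \<le> length w"
  shows "word_map (\<lambda>s. path_map v (c s)) (drop i w) (path_point (length w) (int (length w))) =
    path_point (length w) (int i)"
  using i
proof (induction "length w - i" arbitrary: i)
  case 0
  then show ?case by simp
next
  case (Suc n)
  interpret stretch_generators "\<lambda>s. path_map v (c s)" 3
    by unfold_locales (simp_all add: path_map_stretch v(1))
  let ?l = "length w"
  have l: "length v = ?l" by (simp add: v(2))
  have i: "i < ?l" using Suc by simp
  have IH: "word_map (\<lambda>s. path_map v (c s)) (drop (Suc i) w) (path_point ?l (int ?l)) = path_point ?l (int i + 1)"
    using Suc.hyps(1)[of "Suc i"] Suc.hyps(2) i by (simp add: add.commute)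
  obtain s b where sb: "w ! i = (s, b)" by fastforce
  then have vi: "v ! i = (c s, b)" using i by (simp add: v(2))
  have unit: "path_point ?l j \<in> {0..1}" if "-1 \<le> j" "j \<le> int ?l + 1" for j
    using that by (simp add: path_point_def divide_le_eq)
  have "letter_map (\<lambda>s. path_map v (c s)) (s, b) (path_point ?l (int i + 1)) = path_point ?l (int i)"
  proof (cases b)
    case True
    then have "(int i + 1, int i) \<in> path_moves v (c s)"
      using vi i l by (auto simp: path_moves_def)
    then show ?thesis using path_map_agrees[OF v(1)] True l by fastforce
  next
    case False
    then have "(int i, int i + 1) \<in> path_moves v (c s)"
      using vi i l by (auto simp: path_moves_def)
    then have "path_map v (c s) (path_point ?l (int i)) = path_point ?l (int i + 1)"
      using path_map_agrees[OF v(1)] l by fastforce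
    then show ?thesis
      using stretch_inverse_f[OF stretch C unit, of "int i" s] False i by simp
  qed
  then show ?case
    using IH sb i by (simp flip: Cons_nth_drop_Suc)
qed

lemma reduced_word_map:
  assumes "reduced_word w" "inj_on c (fst ` set w)"
  shows "reduced_word (map (\<lambda>(s, b). (c s, b)) w)"
  using assms
proof (induction w rule: reduced_word.induct)
  case (3 g h w)
  have "reduced_word (map (\<lambda>(s, b). (c s, b)) (h # w))"
    using 3(1,2) inj_on_subset[OF 3(3), of "fst ` set (h # w)"] by auto
  moreover have "c (fst g) = c (fst h) \<longleftrightarrow> fst g = fst h"
    by (rule inj_on_eq_iff[OF 3(3)]) auto
  ultimately show ?case using 3(2) by (cases g; cases h) auto
qed (auto split: prod.splits)

text \<open>
  Once \<open>n \<bar>x - y\<bar> > 1\<close>, the integer parts of \<open>n x\<close> and \<open>n y\<close> are different.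
\<close>

lemma ex_separating_floor:
  fixes A :: "real set"
  assumes "finite A"
  shows "\<exists>n::nat. inj_on (\<lambda>x. \<lfloor>real n * x\<rfloor>) A"
proof -
  have sep: "\<exists>M. \<forall>n\<ge>M. \<lfloor>real n * x\<rfloor> \<noteq> \<lfloor>real n * y\<rfloor>" if "x \<noteq> y" for x y
  proof -
    have "0 < \<bar>x - y\<bar>" using that by simp
    then obtain M :: nat where M: "1 < real M * \<bar>x - y\<bar>"
      using reals_Archimedean3 by blast
    have "\<lfloor>real n * x\<rfloor> \<noteq> \<lfloor>real n * y\<rfloor>" if "n \<ge> M" for n
    proof
      assume eq: "\<lfloor>real n * x\<rfloor> = \<lfloor>real n * y\<rfloor>"
      have "1 < real n * \<bar>x - y\<bar>"
        using M mult_right_mono[of "real M" "real n" "\<bar>x - y\<bar>"] that by simp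
      also have "\<dots> = \<bar>real n * x - real n * y\<bar>"
        by (simp add: abs_mult flip: right_diff_distrib)
      also have "\<dots> < 1" using eq by linarith
      finally show False .
    qed
    then show ?thesis by blast
  qed
  then obtain M where M: "\<And>x y n. x \<noteq> y \<Longrightarrow> n \<ge> M x y \<Longrightarrow> \<lfloor>real n * x\<rfloor> \<noteq> \<lfloor>real n * y\<rfloor>"
    by metis
  define n where "n = Max (insert 0 ((\<lambda>(x, y). M x y) ` (A \<times> A)))"
  have "M x y \<le> n" if "x \<in> A" "y \<in> A" for x y
    unfolding n_def using assms that by (intro Max_ge) auto
  then have "inj_on (\<lambda>x. \<lfloor>real n * x\<rfloor>) A"
    using M by (meson inj_onI)
  then show ?thesis by blast
qed

text \<open>
  The natural number encodes the pair \<open>(N, v)\<close>; numbers that encode a word which is not reduced get the trivial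
  action.
\<close>

definition free_action :: "nat \<Rightarrow> real \<Rightarrow> real \<Rightarrow> real"
  where "free_action n s = (case from_nat n :: nat \<times> (int \<times> bool) list of
    (N, v) \<Rightarrow> if reduced_word v then path_map v \<lfloor>real N * s\<rfloor> else (\<lambda>x. x))"

lemma free_action_generators: "stretch_generators (free_action n) 3"
  by unfold_locales (auto simp: free_action_def path_map_stretch stretch_id split: prod.split)

lemma free_action_faithful:
  assumes w: "reduced_word w" "w \<noteq> []"
  shows "\<exists>n. \<exists>t\<in>{0..1}. word_map (free_action n) w t \<noteq> t"
proof -
  obtain N where N: "inj_on (\<lambda>s. \<lfloor>real N * s\<rfloor>) (fst ` set w)"
    using ex_separating_floor[of "fst ` set w"] by auto
  define v where "v = map (\<lambda>(s, b). (\<lfloor>real N * s\<rfloor>, b)) w"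
  have v: "reduced_word v" unfolding v_def by (rule reduced_word_map[OF w(1) N])
  define n where "n = to_nat (N, v)"
  have "free_action n = (\<lambda>s. path_map v \<lfloor>real N * s\<rfloor>)"
    by (simp add: free_action_def[abs_def] n_def v)
  moreover have "word_map (\<lambda>s. path_map v \<lfloor>real N * s\<rfloor>) w (path_point (length w) (int (length w))) = path_point (length w) 0"
    using word_map_moves_path[OF v v_def, of 0] by simp
  moreover have "path_point (length w) 0 \<noteq> path_point (length w) (int (length w))"
    using w(2) by (simp add: path_point_def)
  moreover have "path_point (length w) (int (length w)) \<in> {0..1}"
    by (simp add: path_point_def)
  ultimately show ?thesis by metis
qed

theorem contains_copy_free_group:
  assumes "\<nexists>B :: 'h::complex_hilbert set. finite B \<and> cspan B = UNIV"
  shows "contains_copy (Out_Roe :: ((int, 'h) ell2_op \<Rightarrow> (int, 'h) ell2_op) set monoid)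
    (free_group (UNIV :: real set))"
proof (rule contains_copy_Out_Roe_of_interval_actions[OF assms group_free_group,
      where \<rho> = "\<lambda>w n. word_map (free_action n) w"])
  note gen = stretch_generators.word_map_lipschitz[OF free_action_generators]
    stretch_generators.word_map_ends[OF free_action_generators]
    stretch_generators.word_map_maps[OF free_action_generators]
    stretch_generators.word_map_mult[OF free_action_generators]
  fix w n assume w: "w \<in> carrier (free_group (UNIV :: real set))"
  show "\<exists>L. \<forall>n. L-lipschitz_on {0..1} (word_map (free_action n) w)" using gen(1) by blast
  show "word_map (free_action n) w 0 = 0" "word_map (free_action n) w 1 = 1" by (rule gen)+
  show "word_map (free_action n) w t \<in> {0..1}" if "t \<in> {0..1}" for t using that by (rule gen)
  show "word_map (free_action n) (w \<otimes>\<^bsub>free_group UNIV\<^esub> u) t = word_map (free_action n) w (word_map (free_action n) u t)"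
    if "t \<in> {0..1}" for u t
    using gen(5)[OF that] by (simp add: free_group_def)
  assume triv: "\<And>n t. t \<in> {0..1} \<Longrightarrow> word_map (free_action n) w t = t"
  have "reduced_word w" using w by (simp add: free_group_def)
  then have "w = []" using free_action_faithful triv by blast
  then show "w = \<one>\<^bsub>free_group UNIV\<^esub>" by (simp add: free_group_def)
next
  show "word_map (free_action n) \<one>\<^bsub>free_group UNIV\<^esub> t = t" for n t by (simp add: free_group_def)
qed

theorem corollary6p6:
  assumes separable: "\<exists>D :: 'h::complex_hilbert set. countable D \<and> closure D = UNIV"
    and infinite_dimensional: "\<nexists>B :: 'h set. finite B \<and> cspan B = UNIV"
  shows "contains_copy (Out_Roe :: ((int, 'h) ell2_op \<Rightarrow> (int, 'h) ell2_op) set monoid) PL_kappa \<and>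
    contains_copy (Out_Roe :: ((int, 'h) ell2_op \<Rightarrow> (int, 'h) ell2_op) set monoid) Thompson_F \<and>
    contains_copy (Out_Roe :: ((int, 'h) ell2_op \<Rightarrow> (int, 'h) ell2_op) set monoid)
      (free_group (UNIV :: real set))"
  using contains_copy_PL_kappa[OF infinite_dimensional] contains_copy_Thompson_F[OF infinite_dimensional]
    contains_copy_free_group[OF infinite_dimensional]
  by blast

end
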